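(* Suppose there is a constant $\gamma\in[0,1/2)$ with $k_u\lesssim p^\gamma$, and that $\sqrt n/\log p\ll k_u\ll k_\xi\lesssim n/\log p$. Assume there exists a polynomial-time algorithm that solves $\mathrm{LT}(n,k_u,k,k_\xi,p,\tau)$ for some $1\le k\le k_u$ with total error probability at most $\alpha+\eta$, where $$\tau=c\,\rho_n^2\,\frac{k_u}{\sqrt{k_\xi}}$$ for a sufficiently small constant $c>0$ and some $0<\rho_n<1/2$. Then there exists a polynomial-time algorithm that solves $$\mathrm{SCCA}\big(2n,\ \lfloor k_u/4\rfloor,\ k_\xi,\ p-k_\xi,\ \rho_n\big)$$ with total error probability at most $\alpha+\eta$.
   Context: Regression model: one observes $n$ i.i.d. pairs $Z_i=(Y_i,X_{i\cdot})\in\mathbb R\times\mathbb R^p$, with $X_{i\cdot}\sim\mathcal N(0,\Sigma)$, $Y_i=X_{i\cdot}^\top\beta+\varepsilon_i$, $\varepsilon_i\sim\mathcal N(0,\sigma^2)$ independent of the $X$'s; $\theta=(\beta,\Sigma,\sigma)$. For fixed constants $M_1>1$, $M_2>0$, $$\Theta(k)=\{(\beta,\Sigma,\sigma):\|\beta\|_0\le k,\ 1/M_1\le\lambda_{\min}(\Sigma)\le\lambda_{\max}(\Sigma)\le M_1,\ 0<\sigma\le M_2\}.$$ For $t_0\in\mathbb R$: $\Theta(k;\xi,t_0)=\{\theta\in\Theta(k):\xi^\top\beta=t_0\}$ and $\Theta_{\pm\tau}(k;\xi,t_0)=\{\theta\in\Theta(k):|\xi^\top\beta-t_0|\ge\tau\}$.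 $\mathrm{LT}(n,k_u,k,k_\xi,p,\tau)$ is the problem of testing $H_0:\theta\in\Theta(k_u;\xi,t_0)$ against $H_1:\theta\in\Theta_{\pm\tau}(k;\xi,t_0)$ from the $n$ observations, where $\xi$ has $\xi_j=1$ for $1\le j\le k_\xi$ and $\xi_j=0$ for $j>k_\xi$. $\mathrm{SCCA}(n,s,p_1,p_2,\lambda)$ is the problem of testing, from $n$ i.i.d. observations of $(U_1,U_2)\in\mathbb R^{p_1}\times\mathbb R^{p_2}$, $$H_0:\ (U_1,U_2)\sim\mathcal N(0,\mathbf I_{p_1+p_2})^{\otimes n}\quad\text{vs.}\quad H_1:\ (U_1,U_2)\sim\mathcal N\left(0,\begin{pmatrix}\mathbf I_{p_1}&\lambda\delta_1\delta_2^\top\\ \lambda\delta_2\delta_1^\top&\mathbf I_{p_2}\end{pmatrix}\right)^{\otimes n},$$ where under $H_1$ the vectors $\delta_1,\delta_2$ are drawn (once, shared by all observations) uniformly from $\mathcal V_{s,p_1}$ and $\mathcal V_{s,p_2}$ respectively, with $\mathcal V_{s,q}=\{v\in\mathbb R^q:\|v\|_0=s,\ v_i=s^{-1/2}\text{ for all }i\in\mathrm{supp}(v)\}$. The total error probability of a test is the sum of its size (worst-case Type I error) and its worst-case Type II error; for SCCA the Type II error is under the mixture distribution $H_1$. Algorithms (tests) may be randomized. $\alpha,\eta\in(0,1)$ are fixed. Asymptotics: $n,p,k_u,k_\xi\to\infty$ along a sequence; $a\lesssim b$ means $a\le Cb$ for a constant $C>0$; $a\ll b$ means $a/b\to0$;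 statements are for all sufficiently large $n$. *)

theory Defs
  imports "HOL-Probability.Probability" "Jordan_Normal_Form.Spectral_Radius"
begin

unbundle no vec_syntax
no_notation inner (infix "\<bullet>" 70)

section \<open>Randomized real-number machines\<close>

text \<open>
  Samples are real numbers, so polynomial time refers to a Blum--Shub--Smale type random access
  machine: exact field operations and comparisons on reals at unit cost, finitely many real program
  constants, and unbounded natural numbers (with addition and subtraction only) for addressing and
  counting. There is no rounding from reals to integers. Randomness is a stream of independent
  uniform variables on [0,1], consumed one by one.
\<close>

record machine =
  ireg :: "nat \<Rightarrow> nat"
  imem :: "nat \<Rightarrow> nat"
  rreg :: "nat \<Rightarrow> real"
  rmem :: "nat \<Rightarrow> real"
  tape :: "nat \<Rightarrow> real"

datatype instr =
    IConst nat nat | IAdd nat nat nat | ISub nat nat nat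
  | ILoad nat nat | IStore nat nat
  | RConst nat real | RNat nat nat
  | RAdd nat nat nat | RSub nat nat nat | RMul nat nat nat | RDiv nat nat nat
  | RLoad nat nat | RStore nat nat
  | RDraw nat

fun exec_instr :: "instr \<Rightarrow> machine \<Rightarrow> machine" where
  "exec_instr (IConst d m) s = s\<lparr>ireg := (ireg s)(d := m)\<rparr>"
| "exec_instr (IAdd d a b) s = s\<lparr>ireg := (ireg s)(d := ireg s a + ireg s b)\<rparr>"
| "exec_instr (ISub d a b) s = s\<lparr>ireg := (ireg s)(d := ireg s a - ireg s b)\<rparr>"
| "exec_instr (ILoad d a) s = s\<lparr>ireg := (ireg s)(d := imem s (ireg s a))\<rparr>"
| "exec_instr (IStore a b) s = s\<lparr>imem := (imem s)(ireg s a := ireg s b)\<rparr>"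
| "exec_instr (RConst d x) s = s\<lparr>rreg := (rreg s)(d := x)\<rparr>"
| "exec_instr (RNat d a) s = s\<lparr>rreg := (rreg s)(d := real (ireg s a))\<rparr>"
| "exec_instr (RAdd d a b) s = s\<lparr>rreg := (rreg s)(d := rreg s a + rreg s b)\<rparr>"
| "exec_instr (RSub d a b) s = s\<lparr>rreg := (rreg s)(d := rreg s a - rreg s b)\<rparr>"
| "exec_instr (RMul d a b) s = s\<lparr>rreg := (rreg s)(d := rreg s a * rreg s b)\<rparr>"
| "exec_instr (RDiv d a b) s = s\<lparr>rreg := (rreg s)(d := rreg s a / rreg s b)\<rparr>"
| "exec_instr (RLoad d a) s = s\<lparr>rreg := (rreg s)(d := rmem s (ireg s a))\<rparr>"
| "exec_instr (RStore a b) s = s\<lparr>rmem := (rmem s)(ireg s a := rreg s b)\<rparr>"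
| "exec_instr (RDraw d) s =
     s\<lparr>rreg := (rreg s)(d := tape s 0), tape := (\<lambda>j. tape s (Suc j))\<rparr>"

datatype guard = ILe nat nat | RLe nat nat

fun holds :: "guard \<Rightarrow> machine \<Rightarrow> bool" where
  "holds (ILe a b) s \<longleftrightarrow> ireg s a \<le> ireg s b"
| "holds (RLe a b) s \<longleftrightarrow> rreg s a \<le> rreg s b"

datatype prog = Skip | Do instr | Seq prog prog | Cond guard prog prog | Loop guard prog

text \<open>\<open>exec \<pi> s t s'\<close>: started in \<open>s\<close>, program \<open>\<pi>\<close> halts in \<open>s'\<close> after \<open>t\<close> steps.\<close>

inductive exec :: "prog \<Rightarrow> machine \<Rightarrow> nat \<Rightarrow> machine \<Rightarrow> bool" where
  Skip: "exec Skip s 1 s"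
| Do: "exec (Do c) s 1 (exec_instr c s)"
| Seq: "exec \<pi> s t s' \<Longrightarrow> exec \<pi>' s' t' s'' \<Longrightarrow> exec (Seq \<pi> \<pi>') s (t + t') s''"
| CondTrue: "holds g s \<Longrightarrow> exec \<pi> s t s' \<Longrightarrow> exec (Cond g \<pi> \<pi>') s (Suc t) s'"
| CondFalse: "\<not> holds g s \<Longrightarrow> exec \<pi>' s t s' \<Longrightarrow> exec (Cond g \<pi> \<pi>') s (Suc t) s'"
| LoopFalse: "\<not> holds g s \<Longrightarrow> exec (Loop g \<pi>) s 1 s"
| LoopTrue: "holds g s \<Longrightarrow> exec \<pi> s t s' \<Longrightarrow> exec (Loop g \<pi>) s' t' s''
    \<Longrightarrow> exec (Loop g \<pi>) s (Suc (t + t')) s''"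

definition initial :: "nat list \<Rightarrow> real list \<Rightarrow> (nat \<Rightarrow> real) \<Rightarrow> machine" where
  "initial ns xs \<omega> =
     \<lparr>ireg = (\<lambda>_. 0),
      imem = (\<lambda>j. if j < length ns then ns ! j else 0),
      rreg = (\<lambda>_. 0),
      rmem = (\<lambda>j. if j < length xs then xs ! j else 0),
      tape = \<omega>\<rparr>"

definition tape_law :: "(nat \<Rightarrow> real) measure" where
  "tape_law = Pi\<^sub>M UNIV (\<lambda>_. uniform_measure lborel {0..1})"

section \<open>Testing problems and polynomial-time tests\<close>

record 'z testing =
  samples :: "'z measure"  \<comment> \<open>only the measurable space matters\<close>
  null :: "'z measure set"
  alt :: "'z measure set"
  encode :: "'z \<Rightarrow> real list"

text \<open>A randomized test is a measurable function of the sample and the tape; true means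
  that the null hypothesis is rejected.\<close>

definition total_error ::
  "('z, 'b) testing_scheme \<Rightarrow> ('z \<times> (nat \<Rightarrow> real) \<Rightarrow> bool) \<Rightarrow> ennreal" where
  "total_error T \<phi> =
     (SUP P\<in>null T. emeasure (P \<Otimes>\<^sub>M tape_law) {x \<in> space (P \<Otimes>\<^sub>M tape_law). \<phi> x})
   + (SUP P\<in>alt T. emeasure (P \<Otimes>\<^sub>M tape_law) {x \<in> space (P \<Otimes>\<^sub>M tape_law). \<not> \<phi> x})"

text \<open>
  One program serves the whole sequence \<open>T\<close>. Besides the sample it reads the numerical parameters
  \<open>ns i\<close>, \<open>xs i\<close> of the \<open>i\<close>-th problem. The time bound is worst case over samples and tapes, and the
  verdict is read off integer register 0.
\<close>

definition poly_time_solvable ::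
  "ennreal \<Rightarrow> (nat \<Rightarrow> nat list) \<Rightarrow> (nat \<Rightarrow> real list) \<Rightarrow> (nat \<Rightarrow> 'z testing) \<Rightarrow> bool" where
  "poly_time_solvable err ns xs T \<longleftrightarrow>
     (\<exists>\<pi> K d. \<forall>\<^sub>F i in sequentially. \<exists>\<phi>.
        Measurable.pred (samples (T i) \<Otimes>\<^sub>M tape_law) \<phi> \<and>
        total_error (T i) \<phi> \<le> err \<and>
        (\<forall>z\<in>space (samples (T i)). \<forall>\<omega>\<in>space tape_law. \<exists>t s.
           exec \<pi> (initial (ns i) (xs i @ encode (T i) z) \<omega>) t s \<and>
           t \<le> K * length (encode (T i) z) ^ d \<and>
           (\<phi> (z, \<omega>) \<longleftrightarrow> ireg s 0 \<noteq> 0)))"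

section \<open>Gaussian vectors\<close>

abbreviation euclid :: "nat \<Rightarrow> (nat \<Rightarrow> real) measure" where
  "euclid d \<equiv> Pi\<^sub>M {..<d} (\<lambda>_. borel)"

text \<open>The law of \<open>A g\<close> for a standard Gaussian vector \<open>g\<close>, where \<open>A\<close> is any square root of
  \<open>\<Sigma>\<close> in the sense \<open>A A\<^sup>T = \<Sigma>\<close>; the law does not depend on which one is chosen.\<close>

definition mvn :: "nat \<Rightarrow> real mat \<Rightarrow> (nat \<Rightarrow> real) measure" where
  "mvn d \<Sigma> =
     (let A = (SOME A. A \<in> carrier_mat d d \<and> A * transpose_mat A = \<Sigma>)
      in distr (Pi\<^sub>M {..<d} (\<lambda>_. std_normal_distribution)) (euclid d)
           (\<lambda>g. \<lambda>i\<in>{..<d}. \<Sum>j<d. A $$ (i, j) * g j))"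

section \<open>Testing a linear functional in sparse linear regression\<close>

definition l0 :: "real vec \<Rightarrow> nat" where
  "l0 v = card {i. i < dim_vec v \<and> v $ i \<noteq> 0}"

definition lambda_min :: "real mat \<Rightarrow> real" where
  "lambda_min \<Sigma> = Min (spectrum \<Sigma>)"

definition lambda_max :: "real mat \<Rightarrow> real" where
  "lambda_max \<Sigma> = Max (spectrum \<Sigma>)"

type_synonym param = "real vec \<times> real mat \<times> real"

definition Theta :: "real \<Rightarrow> real \<Rightarrow> nat \<Rightarrow> nat \<Rightarrow> param set" where
  "Theta M1 M2 p k = {(\<beta>, \<Sigma>, \<sigma>).
     \<beta> \<in> carrier_vec p \<and> \<Sigma> \<in> carrier_mat p p \<and> transpose_mat \<Sigma> = \<Sigma> \<and>
     l0 \<beta> \<le> k \<and>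
     1 / M1 \<le> lambda_min \<Sigma> \<and> lambda_min \<Sigma> \<le> lambda_max \<Sigma> \<and> lambda_max \<Sigma> \<le> M1 \<and>
     0 < \<sigma> \<and> \<sigma> \<le> M2}"

definition Theta_null :: "real \<Rightarrow> real \<Rightarrow> nat \<Rightarrow> nat \<Rightarrow> real vec \<Rightarrow> real \<Rightarrow> param set" where
  "Theta_null M1 M2 p k \<xi> t0 = {(\<beta>, \<Sigma>, \<sigma>) \<in> Theta M1 M2 p k. \<xi> \<bullet> \<beta> = t0}"

definition Theta_alt ::
  "real \<Rightarrow> real \<Rightarrow> nat \<Rightarrow> nat \<Rightarrow> real vec \<Rightarrow> real \<Rightarrow> real \<Rightarrow> param set" where
  "Theta_alt M1 M2 p k \<xi> t0 \<tau> = {(\<beta>, \<Sigma>, \<sigma>) \<in> Theta M1 M2 p k. \<bar>\<xi> \<bullet> \<beta> - t0\<bar> \<ge> \<tau>}"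

text \<open>An observation is a pair \<open>(y, x)\<close>. Coordinates are numbered from 0.\<close>

abbreviation obs_space :: "nat \<Rightarrow> (real \<times> (nat \<Rightarrow> real)) measure" where
  "obs_space p \<equiv> borel \<Otimes>\<^sub>M euclid p"

definition regression_law :: "nat \<Rightarrow> nat \<Rightarrow> param \<Rightarrow> (nat \<Rightarrow> real \<times> (nat \<Rightarrow> real)) measure" where
  "regression_law n p = (\<lambda>(\<beta>, \<Sigma>, \<sigma>).
     Pi\<^sub>M {..<n} (\<lambda>_.
       distr (mvn p \<Sigma> \<Otimes>\<^sub>M density lborel (normal_density 0 \<sigma>)) (obs_space p)
         (\<lambda>(x, e). ((\<Sum>j<p. x j * \<beta> $ j) + e, x))))"

definition loading :: "nat \<Rightarrow> nat \<Rightarrow> real vec" where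
  "loading p k\<^sub>\<xi> = vec p (\<lambda>j. if j < k\<^sub>\<xi> then 1 else 0)"

definition LT_problem :: "real \<Rightarrow> real \<Rightarrow> real \<Rightarrow> nat \<Rightarrow> nat \<Rightarrow> nat \<Rightarrow> nat \<Rightarrow> nat \<Rightarrow> real
    \<Rightarrow> (nat \<Rightarrow> real \<times> (nat \<Rightarrow> real)) testing" where
  "LT_problem M1 M2 t0 n k\<^sub>u k k\<^sub>\<xi> p \<tau> =
     \<lparr>samples = Pi\<^sub>M {..<n} (\<lambda>_. obs_space p),
      null = regression_law n p ` Theta_null M1 M2 p k\<^sub>u (loading p k\<^sub>\<xi>) t0,
      alt = regression_law n p ` Theta_alt M1 M2 p k (loading p k\<^sub>\<xi>) t0 \<tau>,
      encode = (\<lambda>z. concat (map (\<lambda>i. fst (z i) # map (snd (z i)) [0..<p]) [0..<n]))\<rparr>"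

section \<open>Sparse canonical correlation\<close>

definition flat_sparse :: "nat \<Rightarrow> nat \<Rightarrow> real vec set" where
  "flat_sparse s q =
     {v \<in> carrier_vec q. l0 v = s \<and> (\<forall>i<q. v $ i \<noteq> 0 \<longrightarrow> v $ i = 1 / sqrt (real s))}"

definition outer :: "real vec \<Rightarrow> real vec \<Rightarrow> real mat" where
  "outer u v = mat (dim_vec u) (dim_vec v) (\<lambda>(i, j). u $ i * v $ j)"

definition cca_cov :: "nat \<Rightarrow> nat \<Rightarrow> real \<Rightarrow> real vec \<times> real vec \<Rightarrow> real mat" where
  "cca_cov p1 p2 lam = (\<lambda>(\<delta>\<^sub>1, \<delta>\<^sub>2).
     four_block_mat (1\<^sub>m p1) (lam \<cdot>\<^sub>m outer \<delta>\<^sub>1 \<delta>\<^sub>2) (lam \<cdot>\<^sub>m outer \<delta>\<^sub>2 \<delta>\<^sub>1) (1\<^sub>m p2))"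

text \<open>The directions are drawn once and shared by all observations. If \<open>s\<close> exceeds \<open>p1\<close> or \<open>p2\<close>
  there is nothing to draw from and the mixture is the zero measure.\<close>

definition cca_mixture :: "nat \<Rightarrow> nat \<Rightarrow> nat \<Rightarrow> nat \<Rightarrow> real \<Rightarrow> (nat \<Rightarrow> nat \<Rightarrow> real) measure" where
  "cca_mixture n s p1 p2 lam =
     uniform_count_measure (flat_sparse s p1 \<times> flat_sparse s p2) \<bind>
       (\<lambda>\<delta>. Pi\<^sub>M {..<n} (\<lambda>_. mvn (p1 + p2) (cca_cov p1 p2 lam \<delta>)))"

text \<open>\<open>(U\<^sub>1, U\<^sub>2)\<close> is stored as one vector, \<open>U\<^sub>1\<close> first.\<close>

definition SCCA_problem :: "nat \<Rightarrow> nat \<Rightarrow> nat \<Rightarrow> nat \<Rightarrow> real \<Rightarrow> (nat \<Rightarrow> nat \<Rightarrow> real) testing" where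
  "SCCA_problem n s p1 p2 lam =
     \<lparr>samples = Pi\<^sub>M {..<n} (\<lambda>_. euclid (p1 + p2)),
      null = {Pi\<^sub>M {..<n} (\<lambda>_. mvn (p1 + p2) (1\<^sub>m (p1 + p2)))},
      alt = {cca_mixture n s p1 p2 lam},
      encode = (\<lambda>z. concat (map (\<lambda>i. map (z i) [0..<p1 + p2]) [0..<n]))\<rparr>"

section \<open>Asymptotic comparison\<close>

definition asymp_le :: "(nat \<Rightarrow> real) \<Rightarrow> (nat \<Rightarrow> real) \<Rightarrow> bool"  (infix "\<lesssim>" 50) where
  "a \<lesssim> b \<longleftrightarrow> (\<exists>C>0. \<forall>\<^sub>F i in sequentially. a i \<le> C * b i)"

definition asymp_less :: "(nat \<Rightarrow> real) \<Rightarrow> (nat \<Rightarrow> real) \<Rightarrow> bool"  (infix "\<lless>" 50) where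
  "a \<lless> b \<longleftrightarrow> (\<lambda>i. a i / b i) \<longlonglongrightarrow> 0"

end

theory Submission
  imports Defs "HOL-Real_Asymp.Real_Asymp"
begin

text \<open>
  The reduction runs the given test on transformed samples and negates its verdict. Independence of
  \<open>U\<^sub>1\<close> and \<open>U\<^sub>2\<close> is sent to a single point of the regression alternative, whose coefficient vector has
  at most one nonzero entry and hence suits every \<open>k \<ge> 1\<close>; each correlated law with directions
  \<open>(\<delta>\<^sub>1, \<delta>\<^sub>2)\<close> is sent to a point of the regression null, whose coefficient vector may have up to \<open>k\<^sub>u\<close>
  nonzero entries. The transported laws agree exactly with regression laws, so no error is lost: the
  size of the new test is at most the old Type II error, and its mixture error is an average of
  errors that are each at most the old size.

  Two SCCA samples \<open>(U\<^sub>1, U\<^sub>2)\<close>, \<open>(U\<^sub>1', U\<^sub>2')\<close> give one regression observation. Fix \<open>a\<^sup>2 + b\<^sup>2 = 1\<close>, let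
  \<open>w = M2 / sqrt k\<^sub>\<xi>\<close> and put
    \<open>X = (a U\<^sub>1 + b U\<^sub>1', U\<^sub>2)\<close>, \<open>Y = w \<Sum>\<^sub>j (b U\<^sub>1 - a U\<^sub>1')\<^sub>j + \<kappa> X\<^sub>0\<close>.
  The second sample serves as fresh Gaussian noise: it damps the correlation of \<open>X\<close> from \<open>\<lambda>\<close> to
  \<open>\<mu> = a \<lambda>\<close>, so that \<open>a = 1 - 1 / M1\<close> keeps the spectrum of the covariance in \<open>[1 / M1, M1]\<close>, and the
  rotation makes \<open>b U\<^sub>1 - a U\<^sub>1'\<close> uncorrelated with the first block of \<open>X\<close>. Its correlation with the
  second block remains, and solving the normal equations gives the coefficients
    \<open>\<kappa> e\<^sub>0 - \<mu> y \<delta>\<^sub>1 + y \<delta>\<^sub>2\<close>  with  \<open>y = b \<lambda> w sqrt s / (1 - \<mu>\<^sup>2)\<close>.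
  They have at most \<open>2 s + 1\<close> nonzero entries, and the entries in the first \<open>k\<^sub>\<xi>\<close> coordinates sum to
  \<open>\<kappa> - a b w \<lambda>\<^sup>2 s / (1 - \<mu>\<^sup>2)\<close>, whatever the directions are. The offset \<open>\<kappa>\<close> is chosen so that this sum
  is \<open>t\<^sub>0\<close> for \<open>\<lambda> = \<rho>\<close>; for \<open>\<lambda> = 0\<close> it then differs from \<open>t\<^sub>0\<close> by an amount of order
  \<open>\<rho>\<^sup>2 s / sqrt k\<^sub>\<xi>\<close>, which exceeds \<open>\<tau>\<close> once the constant \<open>c\<close> is small.

  Equality of laws is checked on characteristic functions (\<open>pair_to_observation_law\<close>), for which the
  multivariate uniqueness theorem is derived from the one on the real line (\<open>pair_char_unique\<close>,
  \<open>euclid_char_unique\<close>). The errors are compared in \<open>total_error_reduction\<close>. The transformation needs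
  only field operations: the one irrational quantity that varies with the problem, \<open>sqrt k\<^sub>\<xi>\<close>, is
  recovered from \<open>\<tau>\<close>, and the others are constants of the program. The program overwrites the input
  by the transformed sample and clears everything else, so that the given algorithm starts from
  exactly the configuration it expects (\<open>convert_prog_runs\<close>).
\<close>

section \<open>Laws with equal characteristic functions\<close>

lemma integrable_iexp_finite:
  assumes "finite_measure M" and [measurable]: "f \<in> borel_measurable M"
  shows "integrable M (\<lambda>x. iexp (f x :: real))"
proof -
  interpret finite_measure M by fact
  show ?thesis by (rule integrable_const_bound[where B = 1]) auto
qed

text \<open>
  One-dimensional uniqueness, applied to the image under \<open>f\<close> of the measure with density \<open>w\<close>. The
  weight stays above a positive constant, so that normalization only fails for the zero measure.
\<close>

lemma weighted_marginal_unique: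
  fixes \<mu> \<nu> :: "'a measure" and f w :: "'a \<Rightarrow> real"
  assumes "finite_measure \<mu>" "finite_measure \<nu>" and sets: "sets \<mu> = sets \<nu>"
    and f[measurable]: "f \<in> borel_measurable \<mu>"
    and w[measurable]: "w \<in> borel_measurable \<mu>"
    and w_bounds: "\<And>x. 1 \<le> w x" "\<And>x. w x \<le> 3"
    and cf: "\<And>s. (CLINT x|\<mu>. iexp (s * f x) * w x) = (CLINT x|\<nu>. iexp (s * f x) * w x)"
    and B[measurable]: "B \<in> sets borel"
  shows "(LINT x|\<mu>. indicator B (f x) * w x) = (LINT x|\<nu>. indicator B (f x) * w x)"
proof -
  have main: "\<exists>D. real_distribution D \<and>
      (\<forall>s. char D s = (CLINT x|M. iexp (s * f x) * w x) / complex_of_real (LINT x|M. w x)) \<and>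
      measure D B = (LINT x|M. indicator B (f x) * w x) / (LINT x|M. w x)"
    if "finite_measure M" and s: "sets M = sets \<mu>" and pos: "(LINT x|M. w x) > 0" for M
  proof -
    interpret M: finite_measure M by fact
    have [measurable]: "f \<in> borel_measurable M" "w \<in> borel_measurable M"
      using s f w by (simp_all cong: measurable_cong_sets)
    define c where "c = (LINT x|M. w x)"
    define D where "D = distr (density M (\<lambda>x. ennreal (w x / c))) borel f"
    have c: "c > 0" using pos by (simp add: c_def)
    have w0: "0 \<le> w x" for x using w_bounds(1)[of x] by linarith
    have int_w: "integrable M w"
      by (rule M.integrable_const_bound[where B = 3]) (use w_bounds w0 in auto)
    have "emeasure (density M (\<lambda>x. ennreal (w x / c))) (space M) = (\<integral>\<^sup>+x. ennreal (w x / c) \<partial>M)"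
      by (subst emeasure_density) (auto intro!: nn_integral_cong)
    also have "\<dots> = ennreal (LINT x|M. w x / c)"
      using int_w c w0 by (intro nn_integral_eq_integral) auto
    also have "\<dots> = 1" using c by (simp add: c_def)
    finally have "prob_space (density M (\<lambda>x. ennreal (w x / c)))" by (intro prob_spaceI) simp
    then have D: "real_distribution D"
      unfolding D_def by (intro prob_space.real_distribution_distr) auto
    have ch: "char D s = (CLINT x|M. iexp (s * f x) * w x) / complex_of_real c" for s
    proof -
      have "char D s = (CLINT x|density M (\<lambda>x. ennreal (w x / c)). iexp (s * f x))"
        unfolding char_def D_def by (subst integral_distr) auto
      also have "\<dots> = (CLINT x|M. (w x / c) *\<^sub>R iexp (s * f x))"
        using c w0 by (subst integral_density) auto
      also have "\<dots> = (CLINT x|M. (iexp (s * f x) * w x) / complex_of_real c)"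
        by (intro Bochner_Integration.integral_cong) (auto simp: scaleR_conv_of_real field_simps)
      also have "\<dots> = (CLINT x|M. iexp (s * f x) * w x) / complex_of_real c" by simp
      finally show ?thesis .
    qed
    interpret D: real_distribution D by (rule D)
    have "measure D B = (LINT x|D. indicator B x)" by (simp add: D_def)
    also have "\<dots> = (LINT x|density M (\<lambda>x. ennreal (w x / c)). indicator B (f x))"
      unfolding D_def by (subst integral_distr) auto
    also have "\<dots> = (LINT x|M. (w x / c) *\<^sub>R indicator B (f x))"
      using c w0 by (subst integral_density) auto
    also have "\<dots> = (LINT x|M. (indicator B (f x) * w x) / c)"
      by (intro Bochner_Integration.integral_cong) auto
    finally have "measure D B = (LINT x|M. indicator B (f x) * w x) / c" by simp
    with D ch show ?thesis unfolding c_def by blast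
  qed
  have w0: "0 \<le> w x" for x using w_bounds(1)[of x] by linarith
  have w\<nu>[measurable]: "w \<in> borel_measurable \<nu>" "f \<in> borel_measurable \<nu>"
    using sets f w by (simp_all cong: measurable_cong_sets)
  have total: "(LINT x|\<mu>. w x) = (LINT x|\<nu>. w x)"
  proof -
    have "complex_of_real (LINT x|\<mu>. w x) = complex_of_real (LINT x|\<nu>. w x)"
      using cf[of 0] by simp
    then show ?thesis using of_real_eq_iff by blast
  qed
  show ?thesis
  proof (cases "(LINT x|\<mu>. w x) > 0")
    case True
    obtain D where D: "real_distribution D"
      "\<And>s. char D s = (CLINT x|\<mu>. iexp (s * f x) * w x) / complex_of_real (LINT x|\<mu>. w x)"
      "measure D B = (LINT x|\<mu>. indicator B (f x) * w x) / (LINT x|\<mu>. w x)"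
      using main[OF assms(1) refl True] by blast
    obtain D' where D': "real_distribution D'"
      "\<And>s. char D' s = (CLINT x|\<nu>. iexp (s * f x) * w x) / complex_of_real (LINT x|\<nu>. w x)"
      "measure D' B = (LINT x|\<nu>. indicator B (f x) * w x) / (LINT x|\<nu>. w x)"
      using main[OF assms(2)] sets True total by metis
    have "D = D'"
      by (rule Levy_uniqueness[OF D(1) D'(1)], rule ext) (simp only: D(2) D'(2) cf total)
    then show ?thesis using D(3) D'(3) total True by simp
  next
    case False
    have zero: "(LINT x|M. indicator B (f x) * w x) = 0"
      if "finite_measure M" and s: "sets M = sets \<mu>" and le: "\<not> (LINT x|M. w x) > 0" for M
    proof -
      interpret M: finite_measure M by fact
      have [measurable]: "f \<in> borel_measurable M" "w \<in> borel_measurable M"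
        using s f w by (simp_all cong: measurable_cong_sets)
      have int_w: "integrable M w"
        by (rule M.integrable_const_bound[where B = 3]) (use w_bounds w0 in auto)
      have "(LINT x|M. indicator B (f x) * w x) \<le> (LINT x|M. w x)"
        using w0 by (intro integral_mono_AE' int_w) (auto simp: indicator_def)
      moreover have "0 \<le> (LINT x|M. indicator B (f x) * w x)"
        using w0 by (intro integral_nonneg_AE) auto
      ultimately show ?thesis using le by linarith
    qed
    show ?thesis using zero[OF assms(1)] zero[OF assms(2)] sets total False by metis
  qed
qed

lemma iexp_times_cos:
  "iexp u * complex_of_real (2 + cos y) = 2 * iexp u + (iexp (u + y) + iexp (u - y)) / 2" for u y :: real
proof -
  have "complex_of_real (cos y) = (iexp y + inverse (iexp y)) / 2"
    by (simp add: cos_of_real[symmetric] cos_exp_eq exp_minus)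
  moreover have "iexp (u + y) = iexp u * iexp y" "iexp (u - y) = iexp u * inverse (iexp y)"
    by (simp_all add: distrib_left right_diff_distrib exp_add exp_diff divide_inverse)
  ultimately show ?thesis by (simp add: algebra_simps add_divide_distrib)
qed

lemma iexp_times_sin:
  "iexp u * complex_of_real (2 + sin y) = 2 * iexp u + (iexp (u + y) - iexp (u - y)) / (2 * \<i>)" for u y :: real
proof -
  have "complex_of_real (sin y) = (iexp y - inverse (iexp y)) / (2 * \<i>)"
    by (simp add: sin_of_real[symmetric] sin_exp_eq exp_minus)
  moreover have "iexp (u + y) = iexp u * iexp y" "iexp (u - y) = iexp u * inverse (iexp y)"
    by (simp_all add: distrib_left right_diff_distrib exp_add exp_diff divide_inverse)
  moreover have "E * (2 + (v - w) / D) = 2 * E + (E * v - E * w) / D" for E v w D :: complex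
    by (simp add: algebra_simps diff_divide_distrib)
  ultimately show ?thesis by (simp only: of_real_add of_real_numeral)
qed

text \<open>
  This is the induction step for uniqueness in several dimensions. Weighting a law by \<open>2 + cos (L t x)\<close>
  or \<open>2 + sin (L t x)\<close> keeps it positive, and the characteristic function of the weighted first marginal
  is a combination of values of the joint characteristic function. Hence the first marginals of the
  weighted laws agree, that is, the integrals of \<open>iexp (L t x)\<close> over each slab \<open>B \<times> space N\<close> agree; by
  uniqueness on the second factor the laws agree on rectangles.
\<close>

lemma pair_char_unique:
  fixes N :: "'a measure" and L :: "'t \<Rightarrow> 'a \<Rightarrow> real"
  assumes fin: "finite_measure \<mu>" "finite_measure \<nu>"
    and sets: "sets \<mu> = sets (borel \<Otimes>\<^sub>M N)" "sets \<nu> = sets (borel \<Otimes>\<^sub>M N)"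
    and L[measurable]: "\<And>t. L t \<in> borel_measurable N"
    and zero: "\<And>x. L z x = 0"
    and unique: "\<And>\<mu>' \<nu>'. finite_measure \<mu>' \<Longrightarrow> finite_measure \<nu>' \<Longrightarrow> sets \<mu>' = sets N \<Longrightarrow>
      sets \<nu>' = sets N \<Longrightarrow> (\<And>t. (CLINT x|\<mu>'. iexp (L t x)) = (CLINT x|\<nu>'. iexp (L t x))) \<Longrightarrow> \<mu>' = \<nu>'"
    and cf: "\<And>s t. (CLINT x|\<mu>. iexp (s * fst x + L t (snd x)))
      = (CLINT x|\<nu>. iexp (s * fst x + L t (snd x)))"
  shows "\<mu> = \<nu>"
proof -
  interpret \<mu>: finite_measure \<mu> by fact
  interpret \<nu>: finite_measure \<nu> by fact
  note [measurable_cong] = sets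
  have space: "space \<mu> = UNIV \<times> space N" "space \<nu> = UNIV \<times> space N"
    using sets_eq_imp_space_eq[OF sets(1)] sets_eq_imp_space_eq[OF sets(2)]
    by (auto simp: space_pair_measure)
  have cfneg: "(CLINT x|\<mu>. iexp (s * fst x - L t (snd x))) = (CLINT x|\<nu>. iexp (s * fst x - L t (snd x)))"
    for s t
  proof -
    have "(CLINT x|M. iexp (s * fst x - L t (snd x))) = cnj (CLINT x|M. iexp ((-s) * fst x + L t (snd x)))"
      for M
      by (subst Bochner_Integration.integral_cnj[symmetric])
        (auto intro!: Bochner_Integration.integral_cong simp: exp_cnj algebra_simps)
    then show ?thesis using cf[of "-s" t] by simp
  qed
  have cf0: "(CLINT x|\<mu>. iexp (s * fst x)) = (CLINT x|\<nu>. iexp (s * fst x))" for s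
    using cf[of s z] by (simp add: zero)
  have int: "integrable M (\<lambda>x. iexp (s * fst x))" "integrable M (\<lambda>x. iexp (s * fst x + L t (snd x)))"
    "integrable M (\<lambda>x. iexp (s * fst x - L t (snd x)))"
    if "M = \<mu> \<or> M = \<nu>" for M s t
  proof -
    have fM: "finite_measure M" using that fin by auto
    have [measurable_cong]: "sets M = sets (borel \<Otimes>\<^sub>M N)" using that sets by auto
    show "integrable M (\<lambda>x. iexp (s * fst x))" "integrable M (\<lambda>x. iexp (s * fst x + L t (snd x)))"
      "integrable M (\<lambda>x. iexp (s * fst x - L t (snd x)))"
      by (rule integrable_iexp_finite[OF fM], measurable)+
  qed
  have cos_eq: "(CLINT x|M. iexp (s * fst x) * complex_of_real (2 + cos (L t (snd x)))) =
      2 * (CLINT x|M. iexp (s * fst x)) + ((CLINT x|M. iexp (s * fst x + L t (snd x)))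
        + (CLINT x|M. iexp (s * fst x - L t (snd x)))) / 2" if "M = \<mu> \<or> M = \<nu>" for M s t
  proof -
    have "(CLINT x|M. iexp (s * fst x) * complex_of_real (2 + cos (L t (snd x)))) =
      (CLINT x|M. 2 * iexp (s * fst x) + (iexp (s * fst x + L t (snd x))
        + iexp (s * fst x - L t (snd x))) / 2)"
      by (intro Bochner_Integration.integral_cong refl)
        (rule iexp_times_cos)
    also have "\<dots> = 2 * (CLINT x|M. iexp (s * fst x)) + ((CLINT x|M. iexp (s * fst x + L t (snd x)))
        + (CLINT x|M. iexp (s * fst x - L t (snd x)))) / 2"
      using int[OF that] by (simp del: of_real_add of_real_diff of_real_mult)
    finally show ?thesis .
  qed
  have sin_eq: "(CLINT x|M. iexp (s * fst x) * complex_of_real (2 + sin (L t (snd x)))) =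
      2 * (CLINT x|M. iexp (s * fst x)) + ((CLINT x|M. iexp (s * fst x + L t (snd x)))
        - (CLINT x|M. iexp (s * fst x - L t (snd x)))) / (2 * \<i>)" if "M = \<mu> \<or> M = \<nu>" for M s t
  proof -
    have "(CLINT x|M. iexp (s * fst x) * complex_of_real (2 + sin (L t (snd x)))) =
      (CLINT x|M. 2 * iexp (s * fst x) + (iexp (s * fst x + L t (snd x))
        - iexp (s * fst x - L t (snd x))) / (2 * \<i>))"
      by (intro Bochner_Integration.integral_cong refl)
        (rule iexp_times_sin)
    also have "\<dots> = 2 * (CLINT x|M. iexp (s * fst x)) + ((CLINT x|M. iexp (s * fst x + L t (snd x)))
        - (CLINT x|M. iexp (s * fst x - L t (snd x)))) / (2 * \<i>)"
      using int[OF that] by (simp del: of_real_add of_real_diff of_real_mult)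
    finally show ?thesis .
  qed
  have mono: "1 \<le> 2 + cos y" "2 + cos y \<le> 3" "1 \<le> 2 + sin y" "2 + sin y \<le> 3" for y :: real
    using cos_ge_minus_one[of y] cos_le_one[of y] sin_ge_minus_one[of y] sin_le_one[of y] by linarith+
  have split: "(CLINT x|M. indicator B (fst x) *\<^sub>R iexp (L t (snd x))) =
     complex_of_real ((LINT x|M. indicator B (fst x) * (2 + cos (L t (snd x)))) - 2 * (LINT x|M. indicator B (fst x) * 1))
     + \<i> * complex_of_real ((LINT x|M. indicator B (fst x) * (2 + sin (L t (snd x)))) - 2 * (LINT x|M. indicator B (fst x) * 1))"
    if M: "M = \<mu> \<or> M = \<nu>" and [measurable]: "B \<in> sets borel" for M B t
  proof -
    have fM: "finite_measure M" using M fin by auto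
    have [measurable_cong]: "sets M = sets (borel \<Otimes>\<^sub>M N)" using M sets by auto
    have i1: "integrable M (\<lambda>x. indicator B (fst x) * 1 :: real)"
      using M by (intro finite_measure.integrable_const_bound[OF fM, where B = 1]) auto
    have ic: "integrable M (\<lambda>x. indicator B (fst x) * cos (L t (snd x)) :: real)"
      using M by (intro finite_measure.integrable_const_bound[OF fM, where B = 1])
        (auto simp: indicator_def)
    have isn: "integrable M (\<lambda>x. indicator B (fst x) * sin (L t (snd x)) :: real)"
      using M by (intro finite_measure.integrable_const_bound[OF fM, where B = 1])
        (auto simp: indicator_def)
    have c: "(LINT x|M. indicator B (fst x) * (2 + cos (L t (snd x)))) - 2 * (LINT x|M. indicator B (fst x) * 1)
        = (LINT x|M. indicator B (fst x) * cos (L t (snd x)) :: real)"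
      using i1 ic by (simp add: distrib_left mult.commute)
    have s: "(LINT x|M. indicator B (fst x) * (2 + sin (L t (snd x)))) - 2 * (LINT x|M. indicator B (fst x) * 1)
        = (LINT x|M. indicator B (fst x) * sin (L t (snd x)) :: real)"
      using i1 isn by (simp add: distrib_left mult.commute)
    have "(CLINT x|M. indicator B (fst x) *\<^sub>R iexp (L t (snd x))) =
      (CLINT x|M. complex_of_real (indicator B (fst x) * cos (L t (snd x)))
        + \<i> * complex_of_real (indicator B (fst x) * sin (L t (snd x))))"
      by (intro Bochner_Integration.integral_cong refl)
        (simp add: exp_Euler scaleR_conv_of_real algebra_simps cos_of_real sin_of_real)
    also have "\<dots> = complex_of_real (LINT x|M. indicator B (fst x) * cos (L t (snd x)))
      + \<i> * complex_of_real (LINT x|M. indicator B (fst x) * sin (L t (snd x)))"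
      using ic isn by (simp del: of_real_mult)
    finally show ?thesis unfolding c s .
  qed
  have sl: "(CLINT x|\<mu>. indicator B (fst x) *\<^sub>R iexp (L t (snd x))) =
      (CLINT x|\<nu>. indicator B (fst x) *\<^sub>R iexp (L t (snd x)))" 
    if B[measurable]: "B \<in> sets borel" for B t
  proof -
    have "(LINT x|\<mu>. indicator B (fst x) * (2 + cos (L t (snd x)))) = (LINT x|\<nu>. indicator B (fst x) * (2 + cos (L t (snd x))))"
      using fin mono by (intro weighted_marginal_unique) (simp_all add: sets cos_eq cf cfneg cf0 del: of_real_add of_real_diff of_real_mult)
    moreover have "(LINT x|\<mu>. indicator B (fst x) * (2 + sin (L t (snd x)))) = (LINT x|\<nu>. indicator B (fst x) * (2 + sin (L t (snd x))))"
      using fin mono by (intro weighted_marginal_unique) (simp_all add: sets sin_eq cf cfneg cf0 del: of_real_add of_real_diff of_real_mult)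
    moreover have "(LINT x|\<mu>. indicator B (fst x) * (1::real)) = (LINT x|\<nu>. indicator B (fst x) * 1)"
      using fin by (intro weighted_marginal_unique) (simp_all add: sets cf0 del: of_real_mult)
    ultimately show ?thesis by (simp only: split[OF disjI1[OF refl] B] split[OF disjI2[OF refl] B])
  qed
  have rect: "emeasure \<mu> (B \<times> C) = emeasure \<nu> (B \<times> C)"
    if B[measurable]: "B \<in> sets borel" and C[measurable]: "C \<in> sets N" for B C
  proof -
    \<comment> \<open>Restriction to the slab over \<open>B\<close>, pushed to the second factor.\<close>
    define S where "S M = distr (density M (\<lambda>x. ennreal (indicator B (fst x)))) N snd" for M :: "(real \<times> 'a) measure"
    have S: "finite_measure (S M)" "sets (S M) = sets N"
      "(CLINT x|S M. iexp (L t x)) = (CLINT x|M. indicator B (fst x) *\<^sub>R iexp (L t (snd x)))"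
      "emeasure (S M) C = emeasure M (B \<times> C)"
      if M: "M = \<mu> \<or> M = \<nu>" for M t
    proof -
      interpret M: finite_measure M using M fin by auto
      have [measurable_cong]: "sets M = sets (borel \<Otimes>\<^sub>M N)" using M sets by auto
      have spM: "space M = UNIV \<times> space N" using M space by auto
      have "finite_measure (density M (\<lambda>x. ennreal (indicator B (fst x))))"
      proof (rule finite_measureI)
        have "emeasure (density M (\<lambda>x. ennreal (indicator B (fst x)))) (space M)
          = (\<integral>\<^sup>+x. ennreal (indicator B (fst x)) * indicator (space M) x \<partial>M)"
          by (rule emeasure_density) auto
        also have "\<dots> \<le> (\<integral>\<^sup>+x. 1 \<partial>M)"
          by (rule nn_integral_mono) (auto simp: indicator_def)
        finally show "emeasure (density M (\<lambda>x. ennreal (indicator B (fst x))))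
            (space (density M (\<lambda>x. ennreal (indicator B (fst x))))) \<noteq> \<infinity>"
          using M.emeasure_finite[of "space M"] by (auto simp: top_unique)
      qed
      then show "finite_measure (S M)"
        unfolding S_def by (rule finite_measure.finite_measure_distr) simp
      show "sets (S M) = sets N" by (simp add: S_def)
      show "(CLINT x|S M. iexp (L t x)) = (CLINT x|M. indicator B (fst x) *\<^sub>R iexp (L t (snd x)))"
        unfolding S_def by (subst integral_distr, simp, simp) (subst integral_density, auto)
      have "emeasure (S M) C = (\<integral>\<^sup>+x. ennreal (indicator B (fst x)) * indicator (snd -` C \<inter> space M) x \<partial>M)"
        unfolding S_def by (subst emeasure_distr, simp, simp) (subst emeasure_density, auto)
      also have "\<dots> = (\<integral>\<^sup>+x. indicator (B \<times> C) x \<partial>M)"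
        by (intro nn_integral_cong) (auto simp: indicator_def)
      also have "\<dots> = emeasure M (B \<times> C)" by simp
      finally show "emeasure (S M) C = emeasure M (B \<times> C)" .
    qed
    have "S \<mu> = S \<nu>"
      by (rule unique) (simp_all add: S sl del: of_real_mult)
    then show ?thesis using S(4)[of \<mu>] S(4)[of \<nu>] by simp
  qed
  show ?thesis
  proof (rule measure_eqI_generator_eq[OF Int_stable_pair_measure_generator[of borel N],
        where \<Omega> = "UNIV \<times> space N" and A = "\<lambda>_. UNIV \<times> space N"])
    show "{a \<times> b |a b. a \<in> sets borel \<and> b \<in> sets N} \<subseteq> Pow (UNIV \<times> space N)"
      using sets.sets_into_space by fastforce
    show "emeasure \<mu> X = emeasure \<nu> X" if "X \<in> {a \<times> b |a b. a \<in> sets borel \<and> b \<in> sets N}" for X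
      using that rect by auto
    show "sets \<mu> = sigma_sets (UNIV \<times> space N) {a \<times> b |a b. a \<in> sets borel \<and> b \<in> sets N}"
      "sets \<nu> = sigma_sets (UNIV \<times> space N) {a \<times> b |a b. a \<in> sets borel \<and> b \<in> sets N}"
      using sets by (simp_all add: sets_pair_measure)
    show "range (\<lambda>_::nat. UNIV \<times> space N) \<subseteq> {a \<times> b |a b. a \<in> sets borel \<and> b \<in> sets N}"
      by (intro image_subsetI CollectI exI[of _ UNIV] exI[of _ "space N"]) simp
  qed auto
qed

lemma euclid_char_unique:
  assumes "finite_measure \<mu>" "finite_measure \<nu>"
    and "sets \<mu> = sets (euclid m)" "sets \<nu> = sets (euclid m)"
    and "\<And>t :: nat \<Rightarrow> real. (CLINT x|\<mu>. iexp (\<Sum>j<m. t j * x j)) = (CLINT x|\<nu>. iexp (\<Sum>j<m. t j * x j))"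
  shows "\<mu> = \<nu>"
  using assms
proof (induction m arbitrary: \<mu> \<nu>)
  case 0
  have "complex_of_real (measure \<mu> (space \<mu>)) = complex_of_real (measure \<nu> (space \<nu>))"
    using "0.prems"(5)[of "\<lambda>_. 0"] by simp
  then have *: "emeasure \<mu> (space \<mu>) = emeasure \<nu> (space \<nu>)"
    using "0.prems"(1,2) by (simp add: finite_measure.emeasure_eq_measure)
  have sp: "space \<mu> = {\<lambda>_. undefined}" "space \<nu> = {\<lambda>_. undefined}"
    using "0.prems"(3,4)[THEN sets_eq_imp_space_eq] by (simp_all add: space_PiM)
  show ?case
  proof (rule measure_eqI)
    fix X assume "X \<in> sets \<mu>"
    then have "X = {} \<or> X = {\<lambda>_. undefined}" using "0.prems"(3) by (simp add: sets_PiM_empty)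
    then show "emeasure \<mu> X = emeasure \<nu> X" using * sp by auto
  qed (use "0.prems" in simp)
next
  case (Suc m)
  let ?P = "borel \<Otimes>\<^sub>M euclid m" and ?f = "\<lambda>x :: nat \<Rightarrow> real. (x m, restrict x {..<m})"
  have f: "?f \<in> measurable (euclid (Suc m)) ?P"
    by (intro measurable_Pair measurable_component_singleton measurable_restrict) auto
  have recover: "distr (distr M ?P ?f) (euclid (Suc m)) (\<lambda>y. (snd y)(m := fst y)) = M"
    if s: "sets M = sets (euclid (Suc m))" for M
  proof -
    have fM: "?f \<in> measurable M ?P" using f s by (simp cong: measurable_cong_sets)
    have sp: "space M = space (euclid (Suc m))" using s by (rule sets_eq_imp_space_eq)
    have u: "(\<lambda>y. (snd y)(m := fst y)) \<in> measurable ?P (euclid (Suc m))"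
      by (rule measurable_fun_upd[where J = "{..<m}"]) auto
    have "distr (distr M ?P ?f) (euclid (Suc m)) (\<lambda>y. (snd y)(m := fst y)) = distr M M (\<lambda>x. x)"
      unfolding distr_distr[OF u fM]
    proof (rule distr_cong)
      show "sets (euclid (Suc m)) = sets M" using s by simp
      fix x assume "x \<in> space M"
      then have "x \<in> extensional {..<Suc m}" by (simp add: sp space_PiM PiE_def)
      then show "((\<lambda>y. (snd y)(m := fst y)) \<circ> ?f) x = x"
        by (auto simp: fun_eq_iff extensional_def restrict_def)
    qed simp
    then show ?thesis by (simp add: distr_id)
  qed
  have fin: "finite_measure (distr M ?P ?f)" if "finite_measure M" "sets M = sets (euclid (Suc m))" for M
    using that f by (intro finite_measure.finite_measure_distr) (simp_all cong: measurable_cong_sets)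
  have cf: "(CLINT y|distr M ?P ?f. iexp (s * fst y + (\<Sum>j<m. t j * snd y j))) =
      (CLINT x|M. iexp (\<Sum>j<Suc m. (t(m := s)) j * x j))" if s: "sets M = sets (euclid (Suc m))" for M s t
  proof -
    have fM: "?f \<in> measurable M ?P" using f s by (simp cong: measurable_cong_sets)
    show ?thesis
      by (subst integral_distr[OF fM])
        (simp_all add: add.commute del: of_real_add of_real_sum of_real_mult)
  qed
  have "distr \<mu> ?P ?f = distr \<nu> ?P ?f"
  proof (rule pair_char_unique[where L = "\<lambda>t x. \<Sum>j<m. t j * x j" and z = "\<lambda>_. 0"])
    show "\<mu>' = \<nu>'" if "finite_measure \<mu>'" "finite_measure \<nu>'" "sets \<mu>' = sets (euclid m)"
      "sets \<nu>' = sets (euclid m)"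
      "\<And>t. (CLINT x|\<mu>'. iexp (\<Sum>j<m. t j * x j)) = (CLINT x|\<nu>'. iexp (\<Sum>j<m. t j * x j))" for \<mu>' \<nu>'
      using that by (rule Suc.IH)
    show "(CLINT x|distr \<mu> ?P ?f. iexp (s * fst x + (\<Sum>j<m. t j * snd x j))) =
      (CLINT x|distr \<nu> ?P ?f. iexp (s * fst x + (\<Sum>j<m. t j * snd x j)))" for s t
      by (simp only: cf[OF Suc.prems(3)] cf[OF Suc.prems(4)] Suc.prems(5))
  qed (use fin Suc.prems in auto)
  then show ?case using recover[OF Suc.prems(3)] recover[OF Suc.prems(4)] by metis
qed

lemma observation_char_unique:
  assumes "finite_measure \<mu>" "finite_measure \<nu>"
    and "sets \<mu> = sets (obs_space p)" "sets \<nu> = sets (obs_space p)"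
    and "\<And>s t. (CLINT z|\<mu>. iexp (s * fst z + (\<Sum>j<p. t j * snd z j)))
      = (CLINT z|\<nu>. iexp (s * fst z + (\<Sum>j<p. t j * snd z j)))"
  shows "\<mu> = \<nu>"
proof (rule pair_char_unique[where L = "\<lambda>t x. \<Sum>j<p. t j * x j" and z = "\<lambda>_. 0" and N = "euclid p"])
  show "\<mu>' = \<nu>'" if "finite_measure \<mu>'" "finite_measure \<nu>'" "sets \<mu>' = sets (euclid p)"
    "sets \<nu>' = sets (euclid p)"
    "\<And>t. (CLINT x|\<mu>'. iexp (\<Sum>j<p. t j * x j)) = (CLINT x|\<nu>'. iexp (\<Sum>j<p. t j * x j))" for \<mu>' \<nu>'
    using that by (rule euclid_char_unique)
qed (use assms in auto)

section \<open>Gaussian vectors with a rank-two correlation\<close>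

lemma std_gaussian_char:
  fixes u :: "nat \<Rightarrow> real"
  shows "(CLINT g|Pi\<^sub>M {..<d} (\<lambda>_. std_normal_distribution). iexp (\<Sum>j<d. u j * g j)) =
    complex_of_real (exp (- (\<Sum>j<d. (u j)\<^sup>2) / 2))"
proof -
  interpret S: prob_space std_normal_distribution
    using real_dist_normal_dist by (simp add: real_distribution_def)
  interpret product_sigma_finite "\<lambda>_ :: nat. std_normal_distribution"
    by unfold_locales
  have "(CLINT g|Pi\<^sub>M {..<d} (\<lambda>_. std_normal_distribution). iexp (\<Sum>j<d. u j * g j)) =
    (CLINT g|Pi\<^sub>M {..<d} (\<lambda>_. std_normal_distribution). \<Prod>j<d. iexp (u j * g j))"
    by (simp add: exp_sum sum_distrib_left)
  also have "\<dots> = (\<Prod>j<d. CLINT x|std_normal_distribution. iexp (u j * x))"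
    by (rule product_integral_prod)
      (auto intro!: integrable_iexp_finite simp: S.finite_measure_axioms simp del: of_real_mult)
  also have "\<dots> = (\<Prod>j<d. complex_of_real (exp (- (u j)\<^sup>2 / 2)))"
    by (simp add: char_std_normal_distribution[unfolded char_def fun_eq_iff, rule_format] del: of_real_mult)
  also have "\<dots> = complex_of_real (exp (- (\<Sum>j<d. (u j)\<^sup>2) / 2))"
    by (simp add: exp_sum[symmetric] sum_negf sum_divide_distrib flip: of_real_prod exp_sum)
  finally show ?thesis .
qed

text \<open>
  The characteristic function depends on the square root only through \<open>\<Sigma>\<close>, which makes the choice in
  the definition of \<open>mvn\<close> harmless; all later facts about \<open>mvn\<close> come from here.
\<close>

lemma mvn_char:
  assumes A: "\<exists>A \<in> carrier_mat d d. A * transpose_mat A = \<Sigma>"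
  shows "prob_space (mvn d \<Sigma>)" "sets (mvn d \<Sigma>) = sets (euclid d)"
    "(CLINT x|mvn d \<Sigma>. iexp (\<Sum>i<d. t i * x i)) =
      complex_of_real (exp (- (\<Sum>i<d. \<Sum>k<d. t i * t k * \<Sigma> $$ (i, k)) / 2))"
proof -
  define A where "A = (SOME A. A \<in> carrier_mat d d \<and> A * transpose_mat A = \<Sigma>)"
  have A: "A \<in> carrier_mat d d" "A * transpose_mat A = \<Sigma>"
    using someI_ex[of "\<lambda>A. A \<in> carrier_mat d d \<and> A * transpose_mat A = \<Sigma>"] A
    unfolding A_def by blast+
  let ?G = "Pi\<^sub>M {..<d} (\<lambda>_. std_normal_distribution)"
  let ?f = "\<lambda>g. \<lambda>i\<in>{..<d}. \<Sum>j<d. A $$ (i, j) * g j"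
  have mvn: "mvn d \<Sigma> = distr ?G (euclid d) ?f"
    by (simp add: mvn_def A_def Let_def)
  have f: "?f \<in> measurable ?G (euclid d)"
    by (intro measurable_restrict) auto
  interpret G: prob_space ?G
    using real_dist_normal_dist by (intro prob_space_PiM) (simp add: real_distribution_def)
  show "prob_space (mvn d \<Sigma>)" unfolding mvn by (rule G.prob_space_distr[OF f])
  show "sets (mvn d \<Sigma>) = sets (euclid d)" unfolding mvn by simp
  have entry: "\<Sigma> $$ (i, k) = (\<Sum>j<d. A $$ (i, j) * A $$ (k, j))" if "i < d" "k < d" for i k
    using A that by (auto simp: scalar_prod_def atLeast0LessThan)
  have "(CLINT x|mvn d \<Sigma>. iexp (\<Sum>i<d. t i * x i)) = (CLINT g|?G. iexp (\<Sum>j<d. (\<Sum>i<d. t i * A $$ (i, j)) * g j))"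
    unfolding mvn
  proof (subst integral_distr[OF f], force, rule Bochner_Integration.integral_cong[OF refl])
    fix g
    have "(\<Sum>i<d. t i * ?f g i) = (\<Sum>j<d. (\<Sum>i<d. t i * A $$ (i, j)) * g j)"
      by (simp add: sum_distrib_left sum_distrib_right mult.assoc) (rule sum.swap)
    then show "iexp (\<Sum>i<d. t i * ?f g i) = iexp (\<Sum>j<d. (\<Sum>i<d. t i * A $$ (i, j)) * g j)" by simp
  qed
  also have "\<dots> = complex_of_real (exp (- (\<Sum>j<d. (\<Sum>i<d. t i * A $$ (i, j))\<^sup>2) / 2))"
    by (rule std_gaussian_char)
  also have "(\<Sum>j<d. (\<Sum>i<d. t i * A $$ (i, j))\<^sup>2) = (\<Sum>i<d. \<Sum>k<d. t i * t k * \<Sigma> $$ (i, k))"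
  proof -
    have "(\<Sum>j<d. (\<Sum>i<d. t i * A $$ (i, j))\<^sup>2) =
      (\<Sum>j<d. \<Sum>i<d. \<Sum>k<d. t i * t k * (A $$ (i, j) * A $$ (k, j)))"
      by (simp add: power2_eq_square sum_product algebra_simps)
    also have "\<dots> = (\<Sum>i<d. \<Sum>k<d. \<Sum>j<d. t i * t k * (A $$ (i, j) * A $$ (k, j)))"
      by (subst sum.swap, rule sum.cong[OF refl], rule sum.swap)
    also have "\<dots> = (\<Sum>i<d. \<Sum>k<d. t i * t k * \<Sigma> $$ (i, k))"
      by (simp add: entry sum_distrib_left)
    finally show ?thesis .
  qed
  finally show "(CLINT x|mvn d \<Sigma>. iexp (\<Sum>i<d. t i * x i)) =
      complex_of_real (exp (- (\<Sum>i<d. \<Sum>k<d. t i * t k * \<Sigma> $$ (i, k)) / 2))" .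
qed

text \<open>
  The covariance matrices \<open>I + \<lambda> (v w\<^sup>T + w v\<^sup>T)\<close>. Under SCCA the vectors are the two directions padded
  with zeros, and the damped regression design has the same form.
\<close>

definition spiked :: "nat \<Rightarrow> real \<Rightarrow> (nat \<Rightarrow> real) \<Rightarrow> (nat \<Rightarrow> real) \<Rightarrow> real mat" where
  "spiked d lam v w =
     mat d d (\<lambda>(i, k). (if i = k then 1 else 0) + lam * (v i * w k + w i * v k))"

definition orthonormal_pair :: "nat \<Rightarrow> (nat \<Rightarrow> real) \<Rightarrow> (nat \<Rightarrow> real) \<Rightarrow> bool" where
  "orthonormal_pair d v w \<longleftrightarrow>
     (\<Sum>i<d. (v i)\<^sup>2) = 1 \<and> (\<Sum>i<d. (w i)\<^sup>2) = 1 \<and> (\<Sum>i<d. v i * w i) = 0"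

text \<open>
  Take \<open>A = I + w f\<^sup>T\<close> with \<open>f = \<lambda> v - \<epsilon> w\<close>. Then \<open>A A\<^sup>T\<close> exceeds the target by
  \<open>(\<lambda>\<^sup>2 + \<epsilon>\<^sup>2 - 2 \<epsilon>) w w\<^sup>T\<close>, and \<open>\<epsilon> = 1 - sqrt (1 - \<lambda>\<^sup>2)\<close> is a root of that quadratic.
\<close>

lemma spiked_root:
  assumes "orthonormal_pair d v w" "\<bar>lam\<bar> \<le> 1"
  shows "\<exists>A\<in>carrier_mat d d. A * transpose_mat A = spiked d lam v w"
proof -
  define \<epsilon> where "\<epsilon> = 1 - sqrt (1 - lam\<^sup>2)"
  define f where "f = (\<lambda>i. lam * v i - \<epsilon> * w i)"
  define A where "A = mat d d (\<lambda>(i, j). (if i = j then 1 else 0) + w i * f j)"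
  have "lam\<^sup>2 \<le> 1" using assms(2) by (simp add: abs_square_le_1)
  then have eps: "lam\<^sup>2 + \<epsilon>\<^sup>2 = 2 * \<epsilon>"
    by (simp add: \<epsilon>_def power2_diff)
  have ff: "(\<Sum>j<d. f j * f j) = 2 * \<epsilon>"
  proof -
    have "(\<Sum>j<d. f j * f j) = lam\<^sup>2 * (\<Sum>j<d. (v j)\<^sup>2) + \<epsilon>\<^sup>2 * (\<Sum>j<d. (w j)\<^sup>2)
        - 2 * lam * \<epsilon> * (\<Sum>j<d. v j * w j)"
      by (simp add: f_def power2_eq_square algebra_simps sum.distrib sum_subtractf sum_distrib_left)
    then show ?thesis using assms(1) eps by (simp add: orthonormal_pair_def)
  qed
  have "(A * transpose_mat A) $$ (i, k) = spiked d lam v w $$ (i, k)" if "i < d" "k < d" for i k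
  proof -
    have "(A * transpose_mat A) $$ (i, k) =
        (\<Sum>j<d. ((if i = j then 1 else 0) + w i * f j) * ((if k = j then 1 else 0) + w k * f j))"
      using that by (auto simp: A_def scalar_prod_def atLeast0LessThan)
    also have "\<dots> = (\<Sum>j<d. (if i = j then if k = j then 1 else 0 else 0) + (if i = j then w k * f j else 0)
        + (if k = j then w i * f j else 0) + w i * w k * (f j * f j))"
      by (rule sum.cong) (auto simp: algebra_simps)
    also have "\<dots> = (\<Sum>j<d. if i = j then if k = j then 1 else 0 else 0) + (\<Sum>j<d. if i = j then w k * f j else 0)
        + (\<Sum>j<d. if k = j then w i * f j else 0) + w i * w k * (\<Sum>j<d. f j * f j)"
      by (simp only: sum.distrib sum_distrib_left)
    also have "\<dots> = (if i = k then 1 else 0) + w k * f i + w i * f k + w i * w k * (2 * \<epsilon>)"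
      using that by (simp add: ff)
    also have "\<dots> = spiked d lam v w $$ (i, k)"
      using that by (simp add: spiked_def f_def algebra_simps)
    finally show ?thesis .
  qed
  then have "A * transpose_mat A = spiked d lam v w"
    by (intro eq_matI) (auto simp: A_def spiked_def)
  then show ?thesis by (intro bexI[of _ A]) (auto simp: A_def)
qed

lemma spiked_quadratic_form:
  "(\<Sum>i<d. \<Sum>k<d. t i * t k * spiked d lam v w $$ (i, k)) =
     (\<Sum>i<d. (t i)\<^sup>2) + 2 * lam * (\<Sum>i<d. v i * t i) * (\<Sum>i<d. w i * t i)"
proof -
  have "(\<Sum>i<d. \<Sum>k<d. t i * t k * spiked d lam v w $$ (i, k)) =
    (\<Sum>i<d. \<Sum>k<d. (if i = k then t i * t k else 0)
      + lam * ((v i * t i) * (w k * t k)) + lam * ((w i * t i) * (v k * t k)))"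
    by (intro sum.cong refl) (auto simp: spiked_def algebra_simps)
  also have "\<dots> = (\<Sum>i<d. (t i)\<^sup>2) + lam * ((\<Sum>i<d. v i * t i) * (\<Sum>i<d. w i * t i))
      + lam * ((\<Sum>i<d. w i * t i) * (\<Sum>i<d. v i * t i))"
    by (simp add: sum.distrib sum_product power2_eq_square flip: sum_distrib_left)
  finally show ?thesis by (simp add: algebra_simps)
qed

text \<open>
  Bessel's inequality for the two vectors, followed by \<open>2 \<bar>x y\<bar> \<le> x\<^sup>2 + y\<^sup>2\<close>.
\<close>

lemma two_projections_le:
  assumes "orthonormal_pair d v w"
  shows "2 * \<bar>(\<Sum>i<d. v i * t i) * (\<Sum>i<d. w i * t i)\<bar> \<le> (\<Sum>i<d. (t i)\<^sup>2)"
proof -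
  let ?x = "\<Sum>i<d. v i * t i" and ?y = "\<Sum>i<d. w i * t i"
  have "0 \<le> (\<Sum>i<d. (t i - ?x * v i - ?y * w i)\<^sup>2)" by (intro sum_nonneg) auto
  also have "\<dots> = (\<Sum>i<d. (t i)\<^sup>2 + ?x\<^sup>2 * (v i)\<^sup>2 + ?y\<^sup>2 * (w i)\<^sup>2 - 2 * ?x * (v i * t i) - 2 * ?y * (w i * t i)
      + 2 * ?x * ?y * (v i * w i))"
    by (rule sum.cong[OF refl]) (simp add: algebra_simps power2_eq_square)
  also have "\<dots> = (\<Sum>i<d. (t i)\<^sup>2) + ?x\<^sup>2 * (\<Sum>i<d. (v i)\<^sup>2) + ?y\<^sup>2 * (\<Sum>i<d. (w i)\<^sup>2)
      - 2 * ?x * ?x - 2 * ?y * ?y + 2 * ?x * ?y * (\<Sum>i<d. v i * w i)"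
    by (simp only: sum.distrib sum_subtractf sum_distrib_left[symmetric])
  also have "\<dots> = (\<Sum>i<d. (t i)\<^sup>2) - ?x\<^sup>2 - ?y\<^sup>2"
    using assms by (simp add: orthonormal_pair_def power2_eq_square)
  finally have "?x\<^sup>2 + ?y\<^sup>2 \<le> (\<Sum>i<d. (t i)\<^sup>2)" by linarith
  moreover have "2 * \<bar>?x * ?y\<bar> \<le> ?x\<^sup>2 + ?y\<^sup>2"
    using sum_squares_bound[of "\<bar>?x\<bar>" "\<bar>?y\<bar>"] by (simp add: abs_mult)
  ultimately show ?thesis by linarith
qed

lemma spiked_eigenvalue:
  assumes "orthonormal_pair d v w" and "eigenvalue (spiked d lam v w) e"
  shows "\<bar>e - 1\<bar> \<le> \<bar>lam\<bar>"
proof -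
  obtain x where x: "x \<in> carrier_vec d" "x \<noteq> 0\<^sub>v d" "spiked d lam v w *\<^sub>v x = e \<cdot>\<^sub>v x"
    using assms(2) by (auto simp: eigenvalue_def eigenvector_def spiked_def)
  let ?q = "\<Sum>i<d. (x $ i)\<^sup>2"
  have "(\<Sum>k<d. x $ i * x $ k * spiked d lam v w $$ (i, k)) = e * (x $ i)\<^sup>2" if "i < d" for i
  proof -
    have "(spiked d lam v w *\<^sub>v x) $ i = (\<Sum>k<d. spiked d lam v w $$ (i, k) * x $ k)"
      using that x(1) by (auto simp: spiked_def scalar_prod_def atLeast0LessThan)
    moreover have "(spiked d lam v w *\<^sub>v x) $ i = e * x $ i" using x that by simp
    ultimately have "x $ i * (\<Sum>k<d. spiked d lam v w $$ (i, k) * x $ k) = e * (x $ i)\<^sup>2"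
      by (simp add: power2_eq_square)
    then show ?thesis by (simp add: sum_distrib_left algebra_simps)
  qed
  then have "(\<Sum>i<d. \<Sum>k<d. x $ i * x $ k * spiked d lam v w $$ (i, k)) = e * ?q"
    by (simp add: sum_distrib_left)
  then have eq: "(e - 1) * ?q = lam * (2 * ((\<Sum>i<d. v i * x $ i) * (\<Sum>i<d. w i * x $ i)))"
    unfolding spiked_quadratic_form[of "\<lambda>i. x $ i"] by (simp add: algebra_simps)
  have q: "?q > 0"
  proof -
    obtain i where "i < d" "x $ i \<noteq> 0" using x(1,2) by (metis eq_vecI carrier_vecD index_zero_vec)
    then show ?thesis by (intro sum_pos2[of _ i]) auto
  qed
  have "\<bar>e - 1\<bar> * ?q = \<bar>(e - 1) * ?q\<bar>" using q by (simp add: abs_mult)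
  also have "\<dots> = \<bar>lam\<bar> * (2 * \<bar>(\<Sum>i<d. v i * x $ i) * (\<Sum>i<d. w i * x $ i)\<bar>)"
    unfolding eq by (simp add: abs_mult)
  also have "\<dots> \<le> \<bar>lam\<bar> * ?q"
    by (intro mult_left_mono two_projections_le assms(1)) auto
  finally show ?thesis using q by simp
qed

text \<open>
  The extreme eigenvalues are taken over a set that must be known to be nonempty; the eigenvector
  \<open>v + w\<close> with eigenvalue \<open>1 + \<lambda>\<close> provides an element.
\<close>

lemma spiked_spectrum:
  assumes orth: "orthonormal_pair d v w"
  shows "1 - \<bar>lam\<bar> \<le> lambda_min (spiked d lam v w)"
    "lambda_min (spiked d lam v w) \<le> lambda_max (spiked d lam v w)"
    "lambda_max (spiked d lam v w) \<le> 1 + \<bar>lam\<bar>"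
proof -
  let ?S = "spiked d lam v w"
  have carrier: "?S \<in> carrier_mat d d" by (simp add: spiked_def)
  have fin: "finite (spectrum ?S)" using card_finite_spectrum[OF carrier] by simp
  define x where "x = vec d (\<lambda>i. v i + w i)"
  have "?S *\<^sub>v x = (1 + lam) \<cdot>\<^sub>v x"
  proof (rule eq_vecI)
    fix i assume "i < dim_vec ((1 + lam) \<cdot>\<^sub>v x)"
    then have i: "i < d" by (simp add: x_def)
    have "(?S *\<^sub>v x) $ i = (\<Sum>k<d. ?S $$ (i, k) * (v k + w k))"
      using i by (auto simp: spiked_def scalar_prod_def atLeast0LessThan x_def)
    also have "\<dots> = (\<Sum>k<d. (if i = k then v k + w k else 0) + lam * v i * (v k * w k) + lam * v i * (w k)\<^sup>2
        + lam * w i * (v k)\<^sup>2 + lam * w i * (v k * w k))"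
      using i by (intro sum.cong refl) (auto simp: spiked_def algebra_simps power2_eq_square)
    also have "\<dots> = v i + w i + lam * v i * (\<Sum>k<d. v k * w k) + lam * v i * (\<Sum>k<d. (w k)\<^sup>2)
        + lam * w i * (\<Sum>k<d. (v k)\<^sup>2) + lam * w i * (\<Sum>k<d. v k * w k)"
      using i by (simp add: sum.distrib flip: sum_distrib_left)
    also have "\<dots> = (1 + lam) * (v i + w i)"
      using orth by (simp add: orthonormal_pair_def algebra_simps)
    finally show "(?S *\<^sub>v x) $ i = ((1 + lam) \<cdot>\<^sub>v x) $ i" using i by (simp add: x_def)
  qed (simp add: x_def spiked_def)
  moreover have "x \<noteq> 0\<^sub>v d"
  proof
    assume "x = 0\<^sub>v d"
    then have z: "v i + w i = 0" if "i < d" for i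
      using that by (metis index_vec index_zero_vec(1) x_def)
    have "(\<Sum>i<d. (v i + w i) * v i) = (\<Sum>i<d. (v i)\<^sup>2) + (\<Sum>i<d. v i * w i)"
      by (simp add: sum.distrib algebra_simps power2_eq_square)
    then show False using z orth by (simp add: orthonormal_pair_def)
  qed
  ultimately have "eigenvalue ?S (1 + lam)"
    by (auto simp: eigenvalue_def eigenvector_def x_def spiked_def intro!: exI[of _ x])
  then have ne: "spectrum ?S \<noteq> {}" by (auto simp: spectrum_def)
  have bound: "\<bar>e - 1\<bar> \<le> \<bar>lam\<bar>" if "e \<in> spectrum ?S" for e
    using that spiked_eigenvalue[OF orth] by (auto simp: spectrum_def)
  have "lambda_min ?S \<in> spectrum ?S" "lambda_max ?S \<in> spectrum ?S"
    using fin ne by (auto simp: lambda_min_def lambda_max_def)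
  then show "1 - \<bar>lam\<bar> \<le> lambda_min ?S" "lambda_max ?S \<le> 1 + \<bar>lam\<bar>"
    using bound by (fastforce simp: abs_le_iff)+
  show "lambda_min ?S \<le> lambda_max ?S"
    using fin ne by (simp add: lambda_min_def lambda_max_def)
qed

lemma normal_char:
  assumes "\<sigma> > 0"
  shows "(CLINT x|density lborel (normal_density 0 \<sigma>). iexp (s * x)) = complex_of_real (exp (- (\<sigma>\<^sup>2 * s\<^sup>2) / 2))"
proof -
  have nd: "\<sigma> * normal_density 0 \<sigma> (\<sigma> * x) = std_normal_density x" for x
    using assms by (simp add: normal_density_def power_mult_distrib real_sqrt_mult)
  have "(CLINT x|density lborel (normal_density 0 \<sigma>). iexp (s * x)) =
      (CLINT x|lborel. normal_density 0 \<sigma> x *\<^sub>R iexp (s * x))"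
    by (subst integral_density) auto
  also have "\<dots> = \<bar>\<sigma>\<bar> *\<^sub>R (CLINT x|lborel. normal_density 0 \<sigma> (0 + \<sigma> * x) *\<^sub>R iexp (s * (0 + \<sigma> * x)))"
    using assms by (intro lborel_integral_real_affine) auto
  also have "\<dots> = (CLINT x|lborel. std_normal_density x *\<^sub>R iexp (s * \<sigma> * x))"
    using assms by (subst integral_scaleR_right[symmetric])
      (simp add: nd[symmetric] mult.assoc)
  also have "\<dots> = char std_normal_distribution (s * \<sigma>)"
    unfolding char_def by (subst integral_density) auto
  also have "\<dots> = complex_of_real (exp (- (\<sigma>\<^sup>2 * s\<^sup>2) / 2))"
    by (simp add: char_std_normal_distribution power_mult_distrib mult.commute)
  finally show ?thesis .
qed

lemma iexp_pair_integral:
  fixes f :: "'a \<Rightarrow> real" and g :: "'b \<Rightarrow> real"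
  assumes "prob_space M" "prob_space N"
    and [measurable]: "f \<in> borel_measurable M" "g \<in> borel_measurable N"
  shows "(CLINT z|M \<Otimes>\<^sub>M N. iexp (f (fst z) + g (snd z))) = (CLINT x|M. iexp (f x)) * (CLINT y|N. iexp (g y))"
proof -
  interpret M: prob_space M by fact
  interpret N: prob_space N by fact
  interpret P: pair_prob_space M N by unfold_locales
  have "integrable (M \<Otimes>\<^sub>M N) (\<lambda>z. iexp (f (fst z) + g (snd z)))"
    by (rule integrable_iexp_finite) (auto intro: P.finite_measure_axioms)
  then have "(CLINT z|M \<Otimes>\<^sub>M N. iexp (f (fst z) + g (snd z))) = (CLINT x|M. CLINT y|N. iexp (f x + g y))"
    by (subst P.integral_fst'[symmetric]) auto
  also have "\<dots> = (CLINT x|M. CLINT y|N. iexp (f x) * iexp (g y))"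
    by (simp add: distrib_left exp_add)
  finally show ?thesis by simp
qed

section \<open>From a pair of samples to a regression observation\<close>

text \<open>
  A pair of samples becomes one observation. The first \<open>q\<close> covariates are the rotated combination
  \<open>a u + b u'\<close>, the remaining ones are copied from \<open>u\<close>. The response collects the orthogonal
  combination \<open>b u - a u'\<close>, plus a multiple \<open>\<kappa>\<close> of the first covariate that shifts its coefficient.
\<close>

definition pair_to_observation ::
  "nat \<Rightarrow> nat \<Rightarrow> real \<Rightarrow> real \<Rightarrow> real \<Rightarrow> real \<Rightarrow> (nat \<Rightarrow> real) \<times> (nat \<Rightarrow> real) \<Rightarrow> real \<times> (nat \<Rightarrow> real)" where
  "pair_to_observation q p a b w \<kappa> = (\<lambda>(u, u').
     ((\<Sum>j<q. w * (b * u j - a * u' j)) + \<kappa> * (a * u 0 + b * u' 0),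
      \<lambda>j\<in>{..<p}. if j < q then a * u j + b * u' j else u j))"

lemma sum_lessThan_guarded:
  fixes f :: "nat \<Rightarrow> 'a::comm_monoid_add"
  assumes "q \<le> p"
  shows "(\<Sum>j<p. if j < q then f j else 0) = (\<Sum>j<q. f j)"
proof -
  have "(\<Sum>j<q. f j) = (\<Sum>j<p. if j \<in> {..<q} then f j else 0)"
    using assms by (subst sum.inter_restrict[symmetric]) (auto intro!: sum.cong)
  then show ?thesis by simp
qed

lemma measurable_pair_to_observation:
  assumes "0 < q" "q \<le> p"
  shows "pair_to_observation q p a b w \<kappa> \<in> measurable (euclid p \<Otimes>\<^sub>M euclid p) (obs_space p)"
proof -
  have [measurable]: "(\<lambda>z. fst z j) \<in> borel_measurable (euclid p \<Otimes>\<^sub>M euclid p)"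
    "(\<lambda>z. snd z j) \<in> borel_measurable (euclid p \<Otimes>\<^sub>M euclid p)" if "j < p" for j
    using that
    by (auto intro!: measurable_compose[OF measurable_fst measurable_component_singleton]
      measurable_compose[OF measurable_snd measurable_component_singleton])
  have p: "0 < p" using assms by simp
  show ?thesis
    unfolding pair_to_observation_def case_prod_beta using assms p
    by (intro measurable_Pair measurable_restrict borel_measurable_add borel_measurable_sum
      borel_measurable_times borel_measurable_diff measurable_If) (auto intro!: borel_measurable_add)
qed

text \<open>
  Both sides are images of Gaussian vectors, so their characteristic functions are exponentials of
  quadratic forms, and the claim is an identity of quadratic forms in \<open>(s, t)\<close>. Here \<open>s\<close> is the
  frequency of the response. The value of \<open>y\<close> is the solution of the normal equations: the response
  is uncorrelated with the first block of covariates apart from \<open>\<kappa>\<close> and has covariance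
  \<open>b \<lambda> w (\<Sum>j<q. v j) v'\<close> with the second block; \<open>\<sigma>\<^sup>2\<close> is the residual variance.
\<close>

lemma pair_to_observation_law:
  fixes a b w \<kappa> lam :: real and v v' :: "nat \<Rightarrow> real" and p q :: nat
  defines "\<mu> \<equiv> a * lam"
  defines "y \<equiv> b * lam * w * (\<Sum>j<q. v j) / (1 - \<mu>\<^sup>2)"
  defines "\<beta> \<equiv> vec p (\<lambda>j. (if j = 0 then \<kappa> else 0) - \<mu> * y * v j + y * v' j)"
  assumes q: "0 < q" "q \<le> p"
    and orth: "orthonormal_pair p v v'"
    and supp: "\<And>j. q \<le> j \<Longrightarrow> v j = 0" "\<And>j. j < q \<Longrightarrow> v' j = 0"
    and ab: "a\<^sup>2 + b\<^sup>2 = 1" and lam: "\<bar>lam\<bar> < 1"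
    and \<sigma>: "\<sigma> > 0" "\<sigma>\<^sup>2 = w\<^sup>2 * q - y\<^sup>2 * (1 - \<mu>\<^sup>2)"
  shows "distr (mvn p (spiked p lam v v') \<Otimes>\<^sub>M mvn p (spiked p lam v v')) (obs_space p)
      (pair_to_observation q p a b w \<kappa>) =
    distr (mvn p (spiked p \<mu> v v') \<Otimes>\<^sub>M density lborel (normal_density 0 \<sigma>)) (obs_space p)
      (\<lambda>(x, e). ((\<Sum>j<p. x j * \<beta> $ j) + e, x))"
proof -
  let ?M = "mvn p (spiked p lam v v')" and ?M' = "mvn p (spiked p \<mu> v v')"
  let ?N = "density lborel (normal_density 0 \<sigma>)"
  let ?h = "\<lambda>(x :: nat \<Rightarrow> real, e :: real). ((\<Sum>j<p. x j * \<beta> $ j) + e, x)"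
  have "a\<^sup>2 \<le> 1" using ab by (smt (verit) zero_le_power2)
  then have a1: "\<bar>a\<bar> \<le> 1" by (simp add: abs_square_le_1)
  have \<mu>: "\<bar>\<mu>\<bar> < 1"
    using a1 lam mult_left_le_one_le[of "\<bar>lam\<bar>" "\<bar>a\<bar>"] by (simp add: \<mu>_def abs_mult)
  then have \<mu>2: "1 - \<mu>\<^sup>2 > 0" by (simp add: abs_square_less_1)
  have y: "y * (1 - \<mu>\<^sup>2) = b * lam * w * (\<Sum>j<q. v j)" using \<mu>2 by (simp add: y_def)
  note M = mvn_char[OF spiked_root[OF orth less_imp_le[OF lam]]]
  note M' = mvn_char[OF spiked_root[OF orth less_imp_le[OF \<mu>]]]
  note [measurable_cong] = M(2) M'(2)
  interpret M: prob_space ?M by (rule M(1))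
  interpret M': prob_space ?M' by (rule M'(1))
  interpret N: prob_space ?N using \<sigma>(1) by (rule prob_space_normal_density)
  interpret MM: pair_prob_space ?M ?M by unfold_locales
  interpret MN: pair_prob_space ?M' ?N by unfold_locales
  have sets_MM: "sets (?M \<Otimes>\<^sub>M ?M) = sets (euclid p \<Otimes>\<^sub>M euclid p)"
    by (intro sets_pair_measure_cong M(2))
  have r: "pair_to_observation q p a b w \<kappa> \<in> measurable (?M \<Otimes>\<^sub>M ?M) (obs_space p)"
    using measurable_pair_to_observation[OF q] sets_MM by (simp cong: measurable_cong_sets)
  have h: "?h \<in> measurable (?M' \<Otimes>\<^sub>M ?N) (obs_space p)"
    unfolding case_prod_beta by measurable
  show ?thesis
  proof (rule observation_char_unique)
    show "finite_measure (distr (?M \<Otimes>\<^sub>M ?M) (obs_space p) (pair_to_observation q p a b w \<kappa>))"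
      by (rule MM.finite_measure_distr[OF r])
    show "finite_measure (distr (?M' \<Otimes>\<^sub>M ?N) (obs_space p) ?h)"
      by (rule MN.finite_measure_distr[OF h])
    fix s :: real and t :: "nat \<Rightarrow> real"
    \<comment> \<open>\<open>T\<close> absorbs the shift by \<open>\<kappa>\<close> into the frequency of the first covariate; \<open>c\<close> and \<open>c'\<close> are the frequencies seen by the two samples, \<open>r\<close> the one seen by the regression design.\<close>
    define T where "T j = t j + (if j = 0 then s * \<kappa> else 0)" for j
    define c where "c j = (if j < q then s * w * b + a * T j else T j)" for j
    define c' where "c' j = (if j < q then b * T j - s * w * a else 0)" for j
    define r where "r j = T j - s * \<mu> * y * v j + s * y * v' j" for j
    define S where "S = (\<Sum>j<p. v j * T j)"
    define S' where "S' = (\<Sum>j<p. v' j * T j)"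
    note low = sum_lessThan_guarded[OF q(2), where 'a = real]
    have lhs: "(CLINT z|distr (?M \<Otimes>\<^sub>M ?M) (obs_space p) (pair_to_observation q p a b w \<kappa>).
        iexp (s * fst z + (\<Sum>j<p. t j * snd z j))) =
      complex_of_real (exp (- ((\<Sum>i<p. (c i)\<^sup>2) + 2 * lam * (\<Sum>i<p. v i * c i) * (\<Sum>i<p. v' i * c i)
        + (\<Sum>i<p. (c' i)\<^sup>2) + 2 * lam * (\<Sum>i<p. v i * c' i) * (\<Sum>i<p. v' i * c' i)) / 2))"
    proof -
      have lin: "s * fst (pair_to_observation q p a b w \<kappa> z) + (\<Sum>j<p. t j * snd (pair_to_observation q p a b w \<kappa> z) j)
          = (\<Sum>j<p. c j * fst z j) + (\<Sum>j<p. c' j * snd z j)" for z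
      proof -
        have first: "s * (\<kappa> * (a * fst z 0 + b * snd z 0)) =
          (\<Sum>j<p. if j = 0 then s * \<kappa> * (a * fst z j + b * snd z j) else 0)"
          using q by (simp add: sum.delta)
        have "s * fst (pair_to_observation q p a b w \<kappa> z) + (\<Sum>j<p. t j * snd (pair_to_observation q p a b w \<kappa> z) j)
          = (\<Sum>j<p. if j < q then s * (w * (b * fst z j - a * snd z j)) else 0)
            + (\<Sum>j<p. if j = 0 then s * \<kappa> * (a * fst z j + b * snd z j) else 0)
            + (\<Sum>j<p. t j * (if j < q then a * fst z j + b * snd z j else fst z j))"
          unfolding low first[symmetric]
          by (simp add: pair_to_observation_def case_prod_beta distrib_left sum_distrib_left)
        also have "\<dots> = (\<Sum>j<p. c j * fst z j + c' j * snd z j)"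
          unfolding sum.distrib[symmetric] using q
          by (intro sum.cong refl) (auto simp: c_def c'_def T_def algebra_simps)
        finally show ?thesis by (simp add: sum.distrib)
      qed
      have "(CLINT z|distr (?M \<Otimes>\<^sub>M ?M) (obs_space p) (pair_to_observation q p a b w \<kappa>).
        iexp (s * fst z + (\<Sum>j<p. t j * snd z j))) =
        (CLINT z|?M \<Otimes>\<^sub>M ?M. iexp ((\<Sum>j<p. c j * fst z j) + (\<Sum>j<p. c' j * snd z j)))"
        by (subst integral_distr[OF r], measurable) (simp only: lin)
      also have "\<dots> = (CLINT x|?M. iexp (\<Sum>j<p. c j * x j)) * (CLINT x|?M. iexp (\<Sum>j<p. c' j * x j))"
        by (rule iexp_pair_integral[OF M(1) M(1)]) measurable
      finally show ?thesis
        unfolding M(3) spiked_quadratic_form of_real_mult[symmetric] exp_add[symmetric]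
        by (simp only: add_divide_distrib[symmetric] minus_add_distrib[symmetric] add.assoc)
    qed
    have rhs: "(CLINT z|distr (?M' \<Otimes>\<^sub>M ?N) (obs_space p) ?h.
        iexp (s * fst z + (\<Sum>j<p. t j * snd z j))) =
      complex_of_real (exp (- ((\<Sum>i<p. (r i)\<^sup>2) + 2 * \<mu> * (\<Sum>i<p. v i * r i) * (\<Sum>i<p. v' i * r i)
        + \<sigma>\<^sup>2 * s\<^sup>2) / 2))"
    proof -
      have lin: "s * fst (?h z) + (\<Sum>j<p. t j * snd (?h z) j) = (\<Sum>j<p. r j * fst z j) + s * snd z" for z
      proof -
        have "s * fst (?h z) + (\<Sum>j<p. t j * snd (?h z) j) = (\<Sum>j<p. s * (fst z j * \<beta> $ j) + t j * fst z j) + s * snd z"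
          by (simp add: case_prod_beta sum.distrib distrib_left sum_distrib_left)
        also have "(\<Sum>j<p. s * (fst z j * \<beta> $ j) + t j * fst z j) = (\<Sum>j<p. r j * fst z j)"
          by (intro sum.cong refl) (auto simp: r_def T_def \<beta>_def algebra_simps)
        finally show ?thesis .
      qed
      have "(CLINT z|distr (?M' \<Otimes>\<^sub>M ?N) (obs_space p) ?h. iexp (s * fst z + (\<Sum>j<p. t j * snd z j))) =
        (CLINT z|?M' \<Otimes>\<^sub>M ?N. iexp ((\<Sum>j<p. r j * fst z j) + s * snd z))"
        by (subst integral_distr[OF h], measurable) (simp only: lin)
      also have "\<dots> = (CLINT x|?M'. iexp (\<Sum>j<p. r j * x j)) * (CLINT x|?N. iexp (s * x))"
        by (rule iexp_pair_integral[OF M'(1) N.prob_space_axioms]) measurable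
      finally show ?thesis
        unfolding M'(3) spiked_quadratic_form normal_char[OF \<sigma>(1)] of_real_mult[symmetric] exp_add[symmetric]
        by (simp only: add_divide_distrib[symmetric] minus_add_distrib[symmetric] add.assoc)
    qed
    have cc: "(\<Sum>i<p. (c i)\<^sup>2) + (\<Sum>i<p. (c' i)\<^sup>2) = (\<Sum>i<p. (T i)\<^sup>2) + s\<^sup>2 * w\<^sup>2 * q"
    proof -
      have "(s * w * b + a * T i)\<^sup>2 + (b * T i - s * w * a)\<^sup>2 = (a\<^sup>2 + b\<^sup>2) * ((T i)\<^sup>2 + s\<^sup>2 * w\<^sup>2)" for i
        by (simp add: algebra_simps power2_eq_square)
      then have "(\<Sum>i<p. (c i)\<^sup>2 + (c' i)\<^sup>2) = (\<Sum>i<p. (T i)\<^sup>2 + (if i < q then s\<^sup>2 * w\<^sup>2 else 0))"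
        by (intro sum.cong refl) (auto simp: c_def c'_def ab)
      also have "\<dots> = (\<Sum>i<p. (T i)\<^sup>2) + s\<^sup>2 * w\<^sup>2 * q"
        by (simp only: sum.distrib low) simp
      finally show ?thesis by (simp add: sum.distrib)
    qed
    have vc: "(\<Sum>i<p. v i * c i) = s * w * b * (\<Sum>j<q. v j) + a * S"
    proof -
      have "(\<Sum>i<p. v i * c i) = (\<Sum>i<p. s * w * b * (if i < q then v i else 0) + a * (v i * T i))"
        using supp(1) by (intro sum.cong refl) (auto simp: c_def algebra_simps)
      also have "\<dots> = s * w * b * (\<Sum>j<q. v j) + a * S"
        unfolding S_def by (simp only: sum.distrib sum_distrib_left[symmetric] low)
      finally show ?thesis .
    qed
    have v'c: "(\<Sum>i<p. v' i * c i) = S'" "(\<Sum>i<p. v' i * c' i) = 0"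
      unfolding S'_def using supp(2) by (auto simp: c_def c'_def intro!: sum.cong sum.neutral)
    have o: "(\<Sum>i<p. (v i)\<^sup>2) = 1" "(\<Sum>i<p. (v' i)\<^sup>2) = 1" "(\<Sum>i<p. v i * v' i) = 0"
      using orth by (auto simp: orthonormal_pair_def)
    have rr: "(\<Sum>i<p. (r i)\<^sup>2) = (\<Sum>i<p. (T i)\<^sup>2) + s\<^sup>2 * \<mu>\<^sup>2 * y\<^sup>2 + s\<^sup>2 * y\<^sup>2 - 2 * s * \<mu> * y * S + 2 * s * y * S'"
    proof -
      have "(\<Sum>i<p. (r i)\<^sup>2) = (\<Sum>i<p. (T i)\<^sup>2 + s\<^sup>2 * \<mu>\<^sup>2 * y\<^sup>2 * (v i)\<^sup>2 + s\<^sup>2 * y\<^sup>2 * (v' i)\<^sup>2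
        - 2 * s * \<mu> * y * (v i * T i) + 2 * s * y * (v' i * T i) - 2 * s\<^sup>2 * \<mu> * y\<^sup>2 * (v i * v' i))"
        unfolding r_def by (rule sum.cong[OF refl]) (simp add: algebra_simps power2_eq_square)
      also have "\<dots> = (\<Sum>i<p. (T i)\<^sup>2) + s\<^sup>2 * \<mu>\<^sup>2 * y\<^sup>2 * (\<Sum>i<p. (v i)\<^sup>2) + s\<^sup>2 * y\<^sup>2 * (\<Sum>i<p. (v' i)\<^sup>2)
        - 2 * s * \<mu> * y * S + 2 * s * y * S' - 2 * s\<^sup>2 * \<mu> * y\<^sup>2 * (\<Sum>i<p. v i * v' i)"
        unfolding S_def S'_def by (simp only: sum.distrib sum_subtractf sum_distrib_left[symmetric])
      finally show ?thesis by (simp add: o)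
    qed
    have vr: "(\<Sum>i<p. v i * r i) = S - s * \<mu> * y"
    proof -
      have "(\<Sum>i<p. v i * r i) = (\<Sum>i<p. v i * T i - s * \<mu> * y * (v i)\<^sup>2 + s * y * (v i * v' i))"
        unfolding r_def by (rule sum.cong[OF refl]) (simp add: algebra_simps power2_eq_square)
      also have "\<dots> = S - s * \<mu> * y * (\<Sum>i<p. (v i)\<^sup>2) + s * y * (\<Sum>i<p. v i * v' i)"
        unfolding S_def by (simp only: sum.distrib sum_subtractf sum_distrib_left[symmetric])
      finally show ?thesis by (simp add: o)
    qed
    have v'r: "(\<Sum>i<p. v' i * r i) = S' + s * y"
    proof -
      have "(\<Sum>i<p. v' i * r i) = (\<Sum>i<p. v' i * T i - s * \<mu> * y * (v i * v' i) + s * y * (v' i)\<^sup>2)"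
        unfolding r_def by (rule sum.cong[OF refl]) (simp add: algebra_simps power2_eq_square)
      also have "\<dots> = S' - s * \<mu> * y * (\<Sum>i<p. v i * v' i) + s * y * (\<Sum>i<p. (v' i)\<^sup>2)"
        unfolding S'_def by (simp only: sum.distrib sum_subtractf sum_distrib_left[symmetric])
      finally show ?thesis by (simp add: o)
    qed
    have "(\<Sum>i<p. (c i)\<^sup>2) + 2 * lam * (\<Sum>i<p. v i * c i) * (\<Sum>i<p. v' i * c i)
        + (\<Sum>i<p. (c' i)\<^sup>2) + 2 * lam * (\<Sum>i<p. v i * c' i) * (\<Sum>i<p. v' i * c' i)
      = (\<Sum>i<p. (T i)\<^sup>2) + s\<^sup>2 * w\<^sup>2 * q + 2 * s * (b * lam * w * (\<Sum>j<q. v j)) * S' + 2 * \<mu> * S * S'"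
      unfolding vc v'c \<mu>_def using cc by (simp add: algebra_simps)
    also have "\<dots> = (\<Sum>i<p. (r i)\<^sup>2) + 2 * \<mu> * (\<Sum>i<p. v i * r i) * (\<Sum>i<p. v' i * r i) + \<sigma>\<^sup>2 * s\<^sup>2"
      unfolding rr vr v'r y[symmetric] \<sigma>(2) by (simp add: algebra_simps power2_eq_square)
    finally show "(CLINT z|distr (?M \<Otimes>\<^sub>M ?M) (obs_space p) (pair_to_observation q p a b w \<kappa>).
        iexp (s * fst z + (\<Sum>j<p. t j * snd z j))) =
      (CLINT z|distr (?M' \<Otimes>\<^sub>M ?N) (obs_space p) ?h. iexp (s * fst z + (\<Sum>j<p. t j * snd z j)))"
      unfolding lhs rhs by simp
  qed simp_all
qed

section \<open>Independent pairs and error probabilities\<close>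

lemma distr_two_coordinates:
  assumes M: "prob_space M" and "finite I" "i \<in> I" "k \<in> I" "i \<noteq> k"
  shows "distr (Pi\<^sub>M I (\<lambda>_. M)) (M \<Otimes>\<^sub>M M) (\<lambda>z. (z i, z k)) = M \<Otimes>\<^sub>M M"
proof (rule pair_measure_eqI[symmetric])
  interpret M: prob_space M by fact
  interpret P: product_prob_space "\<lambda>_. M" I by unfold_locales
  show "sigma_finite_measure M" "sigma_finite_measure M" by unfold_locales
  fix A B assume A[measurable]: "A \<in> sets M" and B[measurable]: "B \<in> sets M"
  have "emeasure (distr (Pi\<^sub>M I (\<lambda>_. M)) (M \<Otimes>\<^sub>M M) (\<lambda>z. (z i, z k))) (A \<times> B) =
      emeasure (Pi\<^sub>M I (\<lambda>_. M)) {z \<in> space (Pi\<^sub>M I (\<lambda>_. M)). \<forall>j\<in>{i, k}. z j \<in> (if j = i then A else B)}"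
    using assms by (subst emeasure_distr) (auto intro!: arg_cong2[where f = emeasure])
  also have "\<dots> = emeasure M A * emeasure M B"
    using assms by (subst P.emeasure_PiM_Collect) auto
  finally show "emeasure M A * emeasure M B =
      emeasure (distr (Pi\<^sub>M I (\<lambda>_. M)) (M \<Otimes>\<^sub>M M) (\<lambda>z. (z i, z k))) (A \<times> B)" by simp
qed simp

text \<open>
  The pairs \<open>(i, n + i)\<close> occupy disjoint sets of coordinates, so the transformed pairs are again
  independent and identically distributed.
\<close>

lemma distr_paired_samples:
  fixes n :: nat
  assumes M: "prob_space M" and r[measurable]: "r \<in> measurable (M \<Otimes>\<^sub>M M) N" and n: "0 < n"
  shows "distr (Pi\<^sub>M {..<2 * n} (\<lambda>_. M)) (Pi\<^sub>M {..<n} (\<lambda>_. N)) (\<lambda>z. \<lambda>i\<in>{..<n}. r (z i, z (n + i))) =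
    Pi\<^sub>M {..<n} (\<lambda>_. distr (M \<Otimes>\<^sub>M M) N r)"
proof -
  let ?P = "Pi\<^sub>M {..<2 * n} (\<lambda>_. M)"
  interpret P: prob_space ?P using M by (intro prob_space_PiM)
  have comp: "(\<lambda>z. z i) \<in> measurable ?P M" if "i < 2 * n" for i
    using that by (intro measurable_component_singleton) auto
  have pair: "(\<lambda>z. (z i, z (n + i))) \<in> measurable ?P (M \<Otimes>\<^sub>M M)" if "i < n" for i
    using that by (intro measurable_Pair comp) auto
  have "P.indep_vars (\<lambda>_. M) (\<lambda>i z. z i) {..<2 * n}"
  proof (subst P.indep_vars_iff_distr_eq_PiM')
    have "distr ?P ?P (\<lambda>x. \<lambda>i\<in>{..<2 * n}. x i) = distr ?P ?P (\<lambda>x. x)"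
      by (intro distr_cong refl) (auto simp: space_PiM PiE_def extensional_def restrict_def fun_eq_iff)
    also have "\<dots> = (\<Pi>\<^sub>M i\<in>{..<2 * n}. distr ?P M (\<lambda>x. x i))"
      using M by (auto simp: distr_id distr_PiM_component[where M = "\<lambda>_. M"] intro!: PiM_cong)
    finally show "distr ?P ?P (\<lambda>x. \<lambda>i\<in>{..<2 * n}. x i) = (\<Pi>\<^sub>M i\<in>{..<2 * n}. distr ?P M (\<lambda>x. x i))" .
  qed (use n comp in \<open>auto simp: lessThan_empty_iff bot_nat_def\<close>)
  then have "P.indep_vars (\<lambda>j. Pi\<^sub>M {j, n + j} (\<lambda>_. M)) (\<lambda>j z. \<lambda>i\<in>{j, n + j}. z i) {..<n}"
    by (rule P.indep_vars_restrict) (auto simp: disjoint_family_on_def)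
  then have "P.indep_vars (\<lambda>_. N) (\<lambda>j z. r ((\<lambda>i\<in>{j, n + j}. z i) j, (\<lambda>i\<in>{j, n + j}. z i) (n + j))) {..<n}"
  proof (rule P.indep_vars_compose2)
    show "(\<lambda>x. r (x j, x (n + j))) \<in> measurable (Pi\<^sub>M {j, n + j} (\<lambda>_. M)) N" for j
      by (rule measurable_compose[OF _ r]) (intro measurable_Pair measurable_component_singleton, auto)
  qed
  then have ind: "P.indep_vars (\<lambda>_. N) (\<lambda>j z. r (z j, z (n + j))) {..<n}" by simp
  have "distr ?P (Pi\<^sub>M {..<n} (\<lambda>_. N)) (\<lambda>z. \<lambda>i\<in>{..<n}. r (z i, z (n + i))) =
      (\<Pi>\<^sub>M i\<in>{..<n}. distr ?P N (\<lambda>z. r (z i, z (n + i))))"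
    using n by (intro P.indep_vars_iff_distr_eq_PiM'[THEN iffD1, OF _ _ ind])
      (auto intro!: measurable_compose[OF pair r])
  also have "\<dots> = Pi\<^sub>M {..<n} (\<lambda>_. distr (M \<Otimes>\<^sub>M M) N r)"
  proof (rule PiM_cong[OF refl])
    fix i assume "i \<in> {..<n}"
    then have i: "i < n" by simp
    have "distr (M \<Otimes>\<^sub>M M) N r = distr (distr ?P (M \<Otimes>\<^sub>M M) (\<lambda>z. (z i, z (n + i)))) N r"
      using M i n by (subst distr_two_coordinates) auto
    also have "\<dots> = distr ?P N (\<lambda>z. r (z i, z (n + i)))"
      using pair[OF i] by (subst distr_distr) (auto simp: comp_def)
    finally show "distr ?P N (\<lambda>z. r (z i, z (n + i))) = distr (M \<Otimes>\<^sub>M M) N r" by simp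
  qed
  finally show ?thesis .
qed

lemma prob_space_tape_law: "prob_space tape_law"
  unfolding tape_law_def
  by (intro prob_space_PiM prob_space_uniform_measure) auto

lemma emeasure_pullback_tape:
  assumes P: "prob_space P" and R: "R \<in> measurable P S"
    and \<phi>: "Measurable.pred (S \<Otimes>\<^sub>M tape_law) \<phi>"
  shows "emeasure (P \<Otimes>\<^sub>M tape_law) {x \<in> space (P \<Otimes>\<^sub>M tape_law). \<phi> (R (fst x), snd x)} =
    emeasure (distr P S R \<Otimes>\<^sub>M tape_law) {x \<in> space (distr P S R \<Otimes>\<^sub>M tape_law). \<phi> x}"
proof -
  interpret P: prob_space P by fact
  interpret T: prob_space tape_law by (rule prob_space_tape_law)
  let ?f = "\<lambda>(x, y). (R x, y)"
  have eq: "distr P S R \<Otimes>\<^sub>M tape_law = distr (P \<Otimes>\<^sub>M tape_law) (S \<Otimes>\<^sub>M tape_law) ?f"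
    using pair_measure_distr[OF R measurable_ident_sets[OF refl], of tape_law]
    by (simp add: distr_id T.sigma_finite_measure_axioms)
  have f: "?f \<in> measurable (P \<Otimes>\<^sub>M tape_law) (S \<Otimes>\<^sub>M tape_law)"
    using R by measurable
  have m: "{x \<in> space (S \<Otimes>\<^sub>M tape_law). \<phi> x} \<in> sets (S \<Otimes>\<^sub>M tape_law)"
    using \<phi> by measurable
  show ?thesis
    unfolding eq using f m
    by (subst emeasure_distr[OF f])
      (auto intro!: arg_cong2[where f = emeasure] dest: measurable_space[OF f] simp: case_prod_beta)
qed

text \<open>
  An error bound that holds for every component of a mixture holds for the mixture.
\<close>

lemma emeasure_bind_tape_le:
  assumes U: "prob_space U" and K: "K \<in> measurable U (subprob_algebra N)"
    and A: "A \<in> sets (N \<Otimes>\<^sub>M tape_law)"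
    and le: "\<And>x. x \<in> space U \<Longrightarrow> emeasure (K x \<Otimes>\<^sub>M tape_law) A \<le> e"
  shows "emeasure ((U \<bind> K) \<Otimes>\<^sub>M tape_law) A \<le> e"
proof -
  interpret U: prob_space U by fact
  interpret T: prob_space tape_law by (rule prob_space_tape_law)
  have sK: "sets (K x) = sets N" if "x \<in> space U" for x
    using K that by (rule sets_kernel)
  have sb: "sets (U \<bind> K) = sets N"
    using sK U.not_empty by (rule sets_bind)
  have m: "(\<lambda>x. emeasure tape_law (Pair x -` A)) \<in> borel_measurable N"
    using A by (rule T.measurable_emeasure_Pair)
  have "A \<in> sets ((U \<bind> K) \<Otimes>\<^sub>M tape_law)"
    using A sets_pair_measure_cong[OF sb refl] by metis
  then have "emeasure ((U \<bind> K) \<Otimes>\<^sub>M tape_law) A = (\<integral>\<^sup>+x. emeasure tape_law (Pair x -` A) \<partial>(U \<bind> K))"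
    by (rule T.emeasure_pair_measure_alt)
  also have "\<dots> = (\<integral>\<^sup>+u. \<integral>\<^sup>+x. emeasure tape_law (Pair x -` A) \<partial>K u \<partial>U)"
    using m K by (rule nn_integral_bind)
  also have "\<dots> = (\<integral>\<^sup>+u. emeasure (K u \<Otimes>\<^sub>M tape_law) A \<partial>U)"
  proof (rule nn_integral_cong)
    fix u assume "u \<in> space U"
    then have "A \<in> sets (K u \<Otimes>\<^sub>M tape_law)"
      using A sets_pair_measure_cong[OF sK refl] by metis
    then show "(\<integral>\<^sup>+x. emeasure tape_law (Pair x -` A) \<partial>K u) = emeasure (K u \<Otimes>\<^sub>M tape_law) A"
      by (simp add: T.emeasure_pair_measure_alt)
  qed
  also have "\<dots> \<le> (\<integral>\<^sup>+u. e \<partial>U)" using le by (rule nn_integral_mono)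
  also have "\<dots> = e" by (simp add: U.emeasure_space_1)
  finally show ?thesis .
qed

section \<open>Regression parameters of the transformed samples\<close>

definition embed_left :: "nat \<Rightarrow> real vec \<Rightarrow> nat \<Rightarrow> real" where
  "embed_left q \<delta> j = (if j < q then \<delta> $ j else 0)"

definition embed_right :: "nat \<Rightarrow> real vec \<Rightarrow> nat \<Rightarrow> real" where
  "embed_right q \<delta> j = (if j < q then 0 else \<delta> $ (j - q))"

lemma cca_cov_spiked:
  assumes "\<delta>\<^sub>1 \<in> carrier_vec q" "\<delta>\<^sub>2 \<in> carrier_vec r"
  shows "cca_cov q r lam (\<delta>\<^sub>1, \<delta>\<^sub>2) = spiked (q + r) lam (embed_left q \<delta>\<^sub>1) (embed_right q \<delta>\<^sub>2)"
  using assms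
  by (intro eq_matI) (auto simp: cca_cov_def spiked_def outer_def embed_left_def embed_right_def)

lemma flat_sparse_finite: "finite (flat_sparse s q)"
proof -
  have "flat_sparse s q \<subseteq> (\<lambda>f. vec q f) ` ({..<q} \<rightarrow>\<^sub>E {0, 1 / sqrt (real s)})"
  proof
    fix \<delta> assume d: "\<delta> \<in> flat_sparse s q"
    then have "\<delta> = vec q (restrict (\<lambda>i. \<delta> $ i) {..<q})"
      by (intro eq_vecI) (auto simp: flat_sparse_def)
    moreover have "restrict (\<lambda>i. \<delta> $ i) {..<q} \<in> {..<q} \<rightarrow>\<^sub>E {0, 1 / sqrt (real s)}"
      using d by (auto simp: flat_sparse_def)
    ultimately show "\<delta> \<in> (\<lambda>f. vec q f) ` ({..<q} \<rightarrow>\<^sub>E {0, 1 / sqrt (real s)})" by blast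
  qed
  then show ?thesis by (rule finite_subset) (intro finite_imageI finite_PiE, auto)
qed

lemma flat_sparse_nonempty:
  assumes "s \<le> q" "0 < s"
  shows "flat_sparse s q \<noteq> {}"
proof -
  have "{i. i < dim_vec (vec q (\<lambda>i. if i < s then 1 / sqrt (real s) else 0)) \<and>
      vec q (\<lambda>i. if i < s then 1 / sqrt (real s) else 0) $ i \<noteq> 0} = {..<s}"
    using assms by (auto split: if_splits)
  then have "vec q (\<lambda>i. if i < s then 1 / sqrt (real s) else 0) \<in> flat_sparse s q"
    by (auto simp: flat_sparse_def l0_def)
  then show ?thesis by blast
qed

lemma flat_sparse_sums:
  assumes "\<delta> \<in> flat_sparse s q" "0 < s"
  shows "(\<Sum>i<q. (\<delta> $ i)\<^sup>2) = 1" "(\<Sum>i<q. \<delta> $ i) = sqrt s" "card {i. i < q \<and> \<delta> $ i \<noteq> 0} = s"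
proof -
  let ?S = "{i. i < q \<and> \<delta> $ i \<noteq> 0}"
  show card: "card ?S = s" using assms by (auto simp: flat_sparse_def l0_def)
  have val: "\<delta> $ i = 1 / sqrt s" if "i < q \<and> \<delta> $ i \<noteq> 0" for i
    using that assms by (auto simp: flat_sparse_def)
  have "(\<Sum>i<q. (\<delta> $ i)\<^sup>2) = (\<Sum>i\<in>?S. (\<delta> $ i)\<^sup>2)"
    by (rule sum.mono_neutral_right) auto
  also have "\<dots> = (\<Sum>i\<in>?S. 1 / s)" by (intro sum.cong refl) (subst val, auto simp: power_divide)
  finally show "(\<Sum>i<q. (\<delta> $ i)\<^sup>2) = 1" using card assms(2) by simp
  have "(\<Sum>i<q. \<delta> $ i) = (\<Sum>i\<in>?S. \<delta> $ i)"
    by (rule sum.mono_neutral_right) auto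
  also have "\<dots> = (\<Sum>i\<in>?S. 1 / sqrt s)" using val by (intro sum.cong refl) auto
  finally show "(\<Sum>i<q. \<delta> $ i) = sqrt s" using card assms(2) by (simp add: real_div_sqrt)
qed

lemma sum_embed:
  fixes f :: "nat \<Rightarrow> real \<Rightarrow> real"
  assumes "\<And>j. f j 0 = 0"
  shows "(\<Sum>j<q + r. f j (embed_left q \<delta> j)) = (\<Sum>j<q. f j (\<delta> $ j))"
    "(\<Sum>j<q + r. f j (embed_right q \<delta> j)) = (\<Sum>j<r. f (q + j) (\<delta> $ j))"
proof -
  have split: "(\<Sum>j<q + r. g j) = (\<Sum>j<q. g j) + (\<Sum>j<r. g (q + j))" for g :: "nat \<Rightarrow> real"
    by (induction r) auto
  show "(\<Sum>j<q + r. f j (embed_left q \<delta> j)) = (\<Sum>j<q. f j (\<delta> $ j))"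
    "(\<Sum>j<q + r. f j (embed_right q \<delta> j)) = (\<Sum>j<r. f (q + j) (\<delta> $ j))"
    by (simp_all add: split embed_left_def embed_right_def assms)
qed

lemma embed_orthonormal:
  assumes "\<delta>\<^sub>1 \<in> flat_sparse s q" "\<delta>\<^sub>2 \<in> flat_sparse s r" "0 < s"
  shows "orthonormal_pair (q + r) (embed_left q \<delta>\<^sub>1) (embed_right q \<delta>\<^sub>2)"
proof -
  have "(\<Sum>i<q + r. (embed_left q \<delta>\<^sub>1 i)\<^sup>2) = 1" "(\<Sum>i<q + r. (embed_right q \<delta>\<^sub>2 i)\<^sup>2) = 1"
    using assms by (simp_all only: sum_embed[where f = "\<lambda>_ x. x\<^sup>2"] flat_sparse_sums(1) zero_power2)
  moreover have "(\<Sum>i<q + r. embed_left q \<delta>\<^sub>1 i * embed_right q \<delta>\<^sub>2 i) = 0"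
    by (intro sum.neutral) (auto simp: embed_left_def embed_right_def)
  ultimately show ?thesis by (simp add: orthonormal_pair_def)
qed

text \<open>
  One problem of the sequence. Here \<open>q\<close> is the support size of the loading vector, \<open>s\<close> the sparsity of
  each direction.
\<close>

locale reduction =
  fixes M1 M2 t0 \<rho> :: real and n k\<^sub>u k q p s :: nat
  assumes M1: "1 < M1" and M2: "0 < M2" and n: "0 < n" and s: "0 < s" "s \<le> q" "q + s \<le> p"
    and sparsity: "2 * s + 1 \<le> k\<^sub>u" "1 \<le> k" and \<rho>: "0 < \<rho>" "\<rho> < 1"
begin

text \<open>
  The damping \<open>a\<close> leaves \<open>1 - a \<rho> \<ge> 1 / M1\<close>, and also \<open>1 + a \<rho> \<le> M1\<close> because \<open>M1 + 1 / M1 \<ge> 2\<close>. The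
  standard deviation of \<open>w \<Sum>\<^sub>j (b U\<^sub>1 - a U\<^sub>1')\<^sub>j\<close> is \<open>w sqrt q = M2\<close>, the largest noise level permitted. The
  shift cancels the contribution of the directions to the functional when the correlation is \<open>\<rho>\<close>.
\<close>

definition a :: real where "a = 1 - 1 / M1"
definition b :: real where "b = sqrt (1 - a\<^sup>2)"
definition w :: real where "w = M2 / sqrt q"
definition shift :: real where "shift = a * b * w * \<rho>\<^sup>2 * s / (1 - (a * \<rho>)\<^sup>2)"

text \<open>
  The parameters of the regression law that arises from correlation \<open>lam\<close>. Only the values \<open>lam = \<rho>\<close>
  and \<open>lam = 0\<close> matter; in the latter case the coefficients do not involve the directions.
\<close>

definition y :: "real \<Rightarrow> real" where
  "y lam = b * lam * w * sqrt s / (1 - (a * lam)\<^sup>2)"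

definition coef :: "real \<Rightarrow> real vec \<times> real vec \<Rightarrow> real vec" where
  "coef lam \<delta> = vec p (\<lambda>j. (if j = 0 then t0 + shift else 0)
     - a * lam * y lam * embed_left q (fst \<delta>) j + y lam * embed_right q (snd \<delta>) j)"

definition noise :: "real \<Rightarrow> real" where
  "noise lam = sqrt (w\<^sup>2 * q - (y lam)\<^sup>2 * (1 - (a * lam)\<^sup>2))"

definition param_of :: "real \<Rightarrow> real vec \<times> real vec \<Rightarrow> param" where
  "param_of lam \<delta> = (coef lam \<delta>,
     spiked p (a * lam) (embed_left q (fst \<delta>)) (embed_right q (snd \<delta>)), noise lam)"

definition regress :: "(nat \<Rightarrow> nat \<Rightarrow> real) \<Rightarrow> nat \<Rightarrow> real \<times> (nat \<Rightarrow> real)" where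
  "regress z = (\<lambda>i\<in>{..<n}. pair_to_observation q p a b w (t0 + shift) (z i, z (n + i)))"

lemma q: "0 < q" "q \<le> p" using s by linarith+

lemma a: "0 < a" "a < 1" using M1 by (auto simp: a_def)

lemma b: "0 < b" "a\<^sup>2 + b\<^sup>2 = 1"
proof -
  have "a\<^sup>2 < 1" using a by (simp add: abs_square_less_1)
  then show "0 < b" "a\<^sup>2 + b\<^sup>2 = 1" by (simp_all add: b_def)
qed

lemma w: "0 < w" "w\<^sup>2 * q = M2\<^sup>2"
  using M2 q(1) by (simp_all add: w_def power_divide)

lemma damped_correlation:
  assumes "\<bar>lam\<bar> \<le> \<rho>"
  shows "\<bar>lam\<bar> < 1" "\<bar>a * lam\<bar> \<le> 1 - 1 / M1" "(a * lam)\<^sup>2 < 1"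
proof -
  show l: "\<bar>lam\<bar> < 1" using assms \<rho> by linarith
  have "\<bar>a * lam\<bar> \<le> a" using a l by (simp add: abs_mult mult_left_le)
  then show "\<bar>a * lam\<bar> \<le> 1 - 1 / M1" "(a * lam)\<^sup>2 < 1"
    using a by (simp_all add: a_def[symmetric] abs_square_less_1)
qed

text \<open>
  Positivity of the residual variance comes down to \<open>(b \<lambda>)\<^sup>2 + (a \<lambda>)\<^sup>2 = \<lambda>\<^sup>2 < 1\<close> together with \<open>s \<le> q\<close>.
\<close>

lemma noise:
  assumes "\<bar>lam\<bar> \<le> \<rho>"
  shows "0 < noise lam" "noise lam \<le> M2"
    "(noise lam)\<^sup>2 = w\<^sup>2 * q - (y lam)\<^sup>2 * (1 - (a * lam)\<^sup>2)"
proof -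
  note lam = damped_correlation[OF assms]
  have pos: "1 - (a * lam)\<^sup>2 > 0" using lam(3) by simp
  have "(y lam)\<^sup>2 * (1 - (a * lam)\<^sup>2) = (b * lam)\<^sup>2 * (w\<^sup>2 * s) / (1 - (a * lam)\<^sup>2)"
  proof -
    have "(B / D)\<^sup>2 * D = B\<^sup>2 / D" if "D > 0" for B D :: real
      using that by (simp add: power_divide power2_eq_square)
    from this[OF pos, of "b * lam * w * sqrt s"] show ?thesis
      by (simp add: y_def power_mult_distrib mult.assoc)
  qed
  also have "\<dots> \<le> (b * lam)\<^sup>2 * M2\<^sup>2 / (1 - (a * lam)\<^sup>2)"
    unfolding w(2)[symmetric] using pos s(2)
    by (intro divide_right_mono mult_left_mono) auto
  also have "\<dots> < M2\<^sup>2"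
  proof -
    have "(b * lam)\<^sup>2 + (a * lam)\<^sup>2 = lam\<^sup>2" using b(2) by (simp add: power_mult_distrib flip: distrib_right)
    moreover have "lam\<^sup>2 < 1" using lam(1) by (simp add: abs_square_less_1)
    ultimately have "(b * lam)\<^sup>2 < 1 - (a * lam)\<^sup>2" by linarith
    then show ?thesis using pos M2 by (simp add: divide_less_eq mult.commute)
  qed
  finally have less: "(y lam)\<^sup>2 * (1 - (a * lam)\<^sup>2) < M2\<^sup>2" .
  then show "0 < noise lam" by (simp add: noise_def w(2))
  show "(noise lam)\<^sup>2 = w\<^sup>2 * q - (y lam)\<^sup>2 * (1 - (a * lam)\<^sup>2)"
    using less by (simp add: noise_def w(2))
  have "noise lam \<le> sqrt (M2\<^sup>2)"
    unfolding noise_def w(2) using pos by (intro real_sqrt_le_mono) simp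
  then show "noise lam \<le> M2" using M2 by simp
qed

definition directions :: "(real vec \<times> real vec) set" where
  "directions = flat_sparse s q \<times> flat_sparse s (p - q)"

lemma directions:
  assumes "\<delta> \<in> directions"
  shows "orthonormal_pair p (embed_left q (fst \<delta>)) (embed_right q (snd \<delta>))"
    "(\<Sum>j<q. embed_left q (fst \<delta>) j) = sqrt s"
    "cca_cov q (p - q) lam \<delta> = spiked p lam (embed_left q (fst \<delta>)) (embed_right q (snd \<delta>))"
    "card {j. j < p \<and> embed_left q (fst \<delta>) j \<noteq> 0} = s"
    "card {j. j < p \<and> embed_right q (snd \<delta>) j \<noteq> 0} = s"
proof -
  have d: "fst \<delta> \<in> flat_sparse s q" "snd \<delta> \<in> flat_sparse s (p - q)"
    using assms by (auto simp: directions_def)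
  have qp: "q + (p - q) = p" using q by simp
  show "orthonormal_pair p (embed_left q (fst \<delta>)) (embed_right q (snd \<delta>))"
    using embed_orthonormal[OF d s(1)] by (simp only: qp)
  show "(\<Sum>j<q. embed_left q (fst \<delta>) j) = sqrt s"
    using flat_sparse_sums(2)[OF d(1) s(1)] by (simp add: embed_left_def)
  have "fst \<delta> \<in> carrier_vec q" "snd \<delta> \<in> carrier_vec (p - q)" using d by (auto simp: flat_sparse_def)
  from cca_cov_spiked[OF this, of lam]
  show "cca_cov q (p - q) lam \<delta> = spiked p lam (embed_left q (fst \<delta>)) (embed_right q (snd \<delta>))"
    by (simp only: qp prod.collapse)
  have "{j. j < p \<and> embed_left q (fst \<delta>) j \<noteq> 0} = {j. j < q \<and> fst \<delta> $ j \<noteq> 0}"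
    using q by (auto simp: embed_left_def)
  then show "card {j. j < p \<and> embed_left q (fst \<delta>) j \<noteq> 0} = s"
    using flat_sparse_sums(3)[OF d(1) s(1)] by simp
  have "{j. j < p \<and> embed_right q (snd \<delta>) j \<noteq> 0} = (+) q ` {j. j < p - q \<and> snd \<delta> $ j \<noteq> 0}"
  proof (rule Set.set_eqI, rule iffI)
    fix j assume "j \<in> {j. j < p \<and> embed_right q (snd \<delta>) j \<noteq> 0}"
    then have "j = q + (j - q)" "j - q \<in> {j. j < p - q \<and> snd \<delta> $ j \<noteq> 0}"
      by (auto simp: embed_right_def split: if_splits)
    then show "j \<in> (+) q ` {j. j < p - q \<and> snd \<delta> $ j \<noteq> 0}" by blast
  qed (auto simp: embed_right_def)
  then show "card {j. j < p \<and> embed_right q (snd \<delta>) j \<noteq> 0} = s"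
    using flat_sparse_sums(3)[OF d(2) s(1)] by (simp add: card_image)
qed

lemma coef_sparsity:
  assumes "\<delta> \<in> directions"
  shows "l0 (coef lam \<delta>) \<le> 2 * s + 1" "l0 (coef 0 \<delta>) \<le> 1"
proof -
  let ?L = "{j. j < p \<and> embed_left q (fst \<delta>) j \<noteq> 0}" and ?R = "{j. j < p \<and> embed_right q (snd \<delta>) j \<noteq> 0}"
  have "l0 (coef lam \<delta>) \<le> card ({0} \<union> ?L \<union> ?R)"
    unfolding l0_def by (rule card_mono) (auto simp: coef_def split: if_splits)
  also have "\<dots> \<le> card ({0} \<union> ?L) + card ?R" by (rule card_Un_le)
  also have "card ({0} \<union> ?L) \<le> card {0::nat} + card ?L" by (rule card_Un_le)
  finally show "l0 (coef lam \<delta>) \<le> 2 * s + 1" using directions(4,5)[OF assms] by simp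
  have "l0 (coef 0 \<delta>) \<le> card {0::nat}"
    unfolding l0_def by (rule card_mono) (auto simp: coef_def y_def split: if_splits)
  then show "l0 (coef 0 \<delta>) \<le> 1" by simp
qed

text \<open>
  The value of the functional is the same for all directions, since the entries of each first
  direction sum to \<open>sqrt s\<close>. This is what lets one offset work for the whole mixture.
\<close>

lemma functional_coef:
  assumes "\<delta> \<in> directions"
  shows "loading p q \<bullet> coef lam \<delta> = t0 + shift - a * b * w * lam\<^sup>2 * s / (1 - (a * lam)\<^sup>2)"
proof -
  have "loading p q \<bullet> coef lam \<delta> = (\<Sum>j<p. if j < q then coef lam \<delta> $ j else 0)"
  proof -
    have "dim_vec (coef lam \<delta>) = p" by (simp add: coef_def)
    then show ?thesis
      unfolding scalar_prod_def loading_def atLeast0LessThan by (intro sum.cong) auto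
  qed
  also have "\<dots> = (\<Sum>j<q. coef lam \<delta> $ j)" by (rule sum_lessThan_guarded[OF q(2)])
  also have "\<dots> = (\<Sum>j<q. (if j = 0 then t0 + shift else 0) - a * lam * y lam * embed_left q (fst \<delta>) j)"
    using q by (intro sum.cong refl) (auto simp: coef_def embed_right_def)
  also have "\<dots> = (\<Sum>j<q. if j = 0 then t0 + shift else 0) - a * lam * y lam * (\<Sum>j<q. embed_left q (fst \<delta>) j)"
    by (simp only: sum_subtractf sum_distrib_left)
  also have "\<dots> = t0 + shift - a * lam * y lam * sqrt s"
    using q by (simp add: directions(2)[OF assms])
  also have "a * lam * y lam * sqrt s = a * b * w * lam\<^sup>2 * s / (1 - (a * lam)\<^sup>2)"
    by (simp add: y_def power2_eq_square mult.assoc mult.left_commute)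
  finally show ?thesis .
qed

lemma param_in_Theta:
  assumes \<delta>: "\<delta> \<in> directions" and lam: "\<bar>lam\<bar> \<le> \<rho>" and "l0 (coef lam \<delta>) \<le> m"
  shows "param_of lam \<delta> \<in> Theta M1 M2 p m"
proof -
  let ?S = "spiked p (a * lam) (embed_left q (fst \<delta>)) (embed_right q (snd \<delta>))"
  note spec = spiked_spectrum[OF directions(1)[OF \<delta>], of "a * lam"]
  have "1 / M1 \<le> lambda_min ?S" using spec(1) damped_correlation(2)[OF lam] by linarith
  moreover have "lambda_max ?S \<le> M1"
  proof -
    have "1 + (1 - 1 / M1) \<le> M1" using M1 by (simp add: field_simps) (use sum_squares_bound[of M1 1] in \<open>simp add: power2_eq_square\<close>)
    then show ?thesis using spec(3) damped_correlation(2)[OF lam] by linarith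
  qed
  moreover have "transpose_mat ?S = ?S"
    by (intro eq_matI) (auto simp: spiked_def)
  ultimately show ?thesis
    using spec(2) noise[OF lam] assms(3)
    by (auto simp: Theta_def param_of_def coef_def spiked_def)
qed

lemma param_null:
  assumes "\<delta> \<in> directions"
  shows "param_of \<rho> \<delta> \<in> Theta_null M1 M2 p k\<^sub>u (loading p q) t0"
proof -
  have "param_of \<rho> \<delta> \<in> Theta M1 M2 p k\<^sub>u"
    using assms coef_sparsity(1)[OF assms, of \<rho>] sparsity(1) \<rho> by (intro param_in_Theta) auto
  moreover have "loading p q \<bullet> coef \<rho> \<delta> = t0"
    by (simp add: functional_coef[OF assms] shift_def)
  ultimately show ?thesis by (simp add: Theta_null_def param_of_def)
qed

lemma param_alt:
  assumes "\<delta> \<in> directions" "\<tau> \<le> shift"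
  shows "param_of 0 \<delta> \<in> Theta_alt M1 M2 p k (loading p q) t0 \<tau>"
proof -
  have "param_of 0 \<delta> \<in> Theta M1 M2 p k"
    using assms coef_sparsity(2)[OF assms(1)] sparsity(2) \<rho> by (intro param_in_Theta) auto
  moreover have "loading p q \<bullet> coef 0 \<delta> = t0 + shift"
    by (simp add: functional_coef[OF assms(1)])
  ultimately show ?thesis using assms(2) by (simp add: Theta_alt_def param_of_def)
qed

abbreviation scca_space :: "(nat \<Rightarrow> nat \<Rightarrow> real) measure" where
  "scca_space \<equiv> Pi\<^sub>M {..<2 * n} (\<lambda>_. euclid p)"

abbreviation lt_space :: "(nat \<Rightarrow> real \<times> (nat \<Rightarrow> real)) measure" where
  "lt_space \<equiv> Pi\<^sub>M {..<n} (\<lambda>_. obs_space p)"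

lemma measurable_regress: "regress \<in> measurable scca_space lt_space"
proof -
  have "(\<lambda>z. pair_to_observation q p a b w (t0 + shift) (z i, z (n + i))) \<in> measurable scca_space (obs_space p)"
    if "i < n" for i
    using that
    by (intro measurable_compose[OF _ measurable_pair_to_observation[OF q]] measurable_Pair measurable_component_singleton) auto
  then show ?thesis unfolding regress_def by (intro measurable_restrict) auto
qed

lemma mvn_cca:
  assumes "\<delta> \<in> directions" "\<bar>lam\<bar> \<le> \<rho>"
  shows "prob_space (mvn p (cca_cov q (p - q) lam \<delta>))" "sets (mvn p (cca_cov q (p - q) lam \<delta>)) = sets (euclid p)"
  using mvn_char(1,2)[OF spiked_root[OF directions(1)[OF assms(1)] less_imp_le[OF damped_correlation(1)[OF assms(2)]]]]
  by (simp_all add: directions(3)[OF assms(1)])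

lemma regress_law:
  assumes \<delta>: "\<delta> \<in> directions" and lam: "\<bar>lam\<bar> \<le> \<rho>"
  shows "distr (Pi\<^sub>M {..<2 * n} (\<lambda>_. mvn p (cca_cov q (p - q) lam \<delta>))) lt_space regress =
    regression_law n p (param_of lam \<delta>)"
proof -
  let ?M = "mvn p (cca_cov q (p - q) lam \<delta>)"
  have r: "pair_to_observation q p a b w (t0 + shift) \<in> measurable (?M \<Otimes>\<^sub>M ?M) (obs_space p)"
    using measurable_pair_to_observation[OF q]
      sets_pair_measure_cong[OF mvn_cca(2)[OF assms] mvn_cca(2)[OF assms]]
    by (simp cong: measurable_cong_sets)
  have y: "b * lam * w * (\<Sum>j<q. embed_left q (fst \<delta>) j) / (1 - (a * lam)\<^sup>2) = y lam"
    by (simp add: directions(2)[OF \<delta>] y_def)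
  have "distr (?M \<Otimes>\<^sub>M ?M) (obs_space p) (pair_to_observation q p a b w (t0 + shift)) =
    distr (mvn p (spiked p (a * lam) (embed_left q (fst \<delta>)) (embed_right q (snd \<delta>)))
        \<Otimes>\<^sub>M density lborel (normal_density 0 (noise lam))) (obs_space p)
      (\<lambda>(x, e). ((\<Sum>j<p. x j * coef lam \<delta> $ j) + e, x))"
    unfolding directions(3)[OF \<delta>]
    using pair_to_observation_law[OF q directions(1)[OF \<delta>] _ _ b(2) damped_correlation(1)[OF lam] noise(1)[OF lam],
        where w = w and \<kappa> = "t0 + shift", unfolded y] noise(3)[OF lam]
    by (simp add: embed_left_def embed_right_def coef_def)
  then show ?thesis
    using distr_paired_samples[OF mvn_cca(1)[OF assms] r n]
    by (simp add: regress_def[abs_def] regression_law_def param_of_def)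
qed

lemma one_mat_cca:
  assumes "\<delta> \<in> directions"
  shows "cca_cov q (p - q) 0 \<delta> = 1\<^sub>m p"
  unfolding directions(3)[OF assms] by (intro eq_matI) (auto simp: spiked_def)

text \<open>
  The SCCA null, seen as correlation \<open>0\<close> with arbitrary directions, lands in the regression
  alternative, and the components of the SCCA mixture land in the regression null. Negating the
  verdict therefore exchanges the two error terms.
\<close>

lemma total_error_reduction:
  assumes \<phi>: "Measurable.pred (lt_space \<Otimes>\<^sub>M tape_law) \<phi>" and \<tau>: "\<tau> \<le> shift"
  shows "Measurable.pred (scca_space \<Otimes>\<^sub>M tape_law) (\<lambda>(z, \<omega>). \<not> \<phi> (regress z, \<omega>))"
    "total_error (SCCA_problem (2 * n) s q (p - q) \<rho>) (\<lambda>(z, \<omega>). \<not> \<phi> (regress z, \<omega>))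
      \<le> total_error (LT_problem M1 M2 t0 n k\<^sub>u k q p \<tau>) \<phi>"
proof -
  let ?L = "LT_problem M1 M2 t0 n k\<^sub>u k q p \<tau>"
  let ?\<phi>' = "\<lambda>(z, \<omega>). \<not> \<phi> (regress z, \<omega>)"
  let ?law = "\<lambda>lam \<delta>. Pi\<^sub>M {..<2 * n} (\<lambda>_. mvn p (cca_cov q (p - q) lam \<delta>))"
  have [measurable]: "regress \<in> measurable scca_space lt_space" by (rule measurable_regress)
  have "(\<lambda>x. (regress (fst x), snd x)) \<in> measurable (scca_space \<Otimes>\<^sub>M tape_law) (lt_space \<Otimes>\<^sub>M tape_law)"
    by measurable
  from measurable_compose[OF this \<phi>]
  show pred: "Measurable.pred (scca_space \<Otimes>\<^sub>M tape_law) ?\<phi>'"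
    by (simp add: case_prod_beta)
  have qp: "q + (p - q) = p" using q by simp
  have law: "prob_space (?law lam \<delta>)" "sets (?law lam \<delta>) = sets scca_space"
    if "\<delta> \<in> directions" "\<bar>lam\<bar> \<le> \<rho>" for lam \<delta>
    using mvn_cca[OF that] by (auto intro!: prob_space_PiM sets_PiM_cong)
  have pull: "emeasure (?law lam \<delta> \<Otimes>\<^sub>M tape_law) {x \<in> space (scca_space \<Otimes>\<^sub>M tape_law). \<psi> (regress (fst x), snd x)}
      = emeasure (regression_law n p (param_of lam \<delta>) \<Otimes>\<^sub>M tape_law)
          {x \<in> space (regression_law n p (param_of lam \<delta>) \<Otimes>\<^sub>M tape_law). \<psi> x}"
    if "\<delta> \<in> directions" "\<bar>lam\<bar> \<le> \<rho>" "Measurable.pred (lt_space \<Otimes>\<^sub>M tape_law) \<psi>" for lam \<delta> \<psi>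
  proof -
    have "regress \<in> measurable (?law lam \<delta>) lt_space"
      using measurable_regress law(2)[OF that(1,2)] by (simp cong: measurable_cong_sets)
    moreover have "space (?law lam \<delta> \<Otimes>\<^sub>M tape_law) = space (scca_space \<Otimes>\<^sub>M tape_law)"
      using law(2)[OF that(1,2), THEN sets_eq_imp_space_eq] by (simp add: space_pair_measure)
    ultimately show ?thesis
      using emeasure_pullback_tape[OF law(1)[OF that(1,2)] _ that(3)]
      by (simp only: regress_law[OF that(1,2)])
  qed
  have ne: "directions \<noteq> {}"
    using flat_sparse_nonempty s by (auto simp: directions_def)
  then obtain \<delta>\<^sub>0 where \<delta>\<^sub>0: "\<delta>\<^sub>0 \<in> directions" by blast
  have "emeasure (?law 0 \<delta>\<^sub>0 \<Otimes>\<^sub>M tape_law) {x \<in> space (?law 0 \<delta>\<^sub>0 \<Otimes>\<^sub>M tape_law). ?\<phi>' x} \<le>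
    (SUP P\<in>alt ?L. emeasure (P \<Otimes>\<^sub>M tape_law) {x \<in> space (P \<Otimes>\<^sub>M tape_law). \<not> \<phi> x})"
  proof -
    have "space (?law 0 \<delta>\<^sub>0 \<Otimes>\<^sub>M tape_law) = space (scca_space \<Otimes>\<^sub>M tape_law)"
      using law(2)[OF \<delta>\<^sub>0, of 0, THEN sets_eq_imp_space_eq] \<rho> by (simp add: space_pair_measure)
    then have eq: "emeasure (?law 0 \<delta>\<^sub>0 \<Otimes>\<^sub>M tape_law) {x \<in> space (?law 0 \<delta>\<^sub>0 \<Otimes>\<^sub>M tape_law). ?\<phi>' x} =
      emeasure (regression_law n p (param_of 0 \<delta>\<^sub>0) \<Otimes>\<^sub>M tape_law)
          {x \<in> space (regression_law n p (param_of 0 \<delta>\<^sub>0) \<Otimes>\<^sub>M tape_law). \<not> \<phi> x}"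
      using pull[OF \<delta>\<^sub>0, of 0 "\<lambda>x. \<not> \<phi> x"] \<phi> \<rho> by (simp add: case_prod_beta)
    have "regression_law n p (param_of 0 \<delta>\<^sub>0) \<in> alt ?L"
      using param_alt[OF \<delta>\<^sub>0 \<tau>] by (simp add: LT_problem_def)
    then show ?thesis unfolding eq by (rule SUP_upper)
  qed
  then have I: "(SUP P\<in>null (SCCA_problem (2 * n) s q (p - q) \<rho>).
      emeasure (P \<Otimes>\<^sub>M tape_law) {x \<in> space (P \<Otimes>\<^sub>M tape_law). ?\<phi>' x}) \<le>
    (SUP P\<in>alt ?L. emeasure (P \<Otimes>\<^sub>M tape_law) {x \<in> space (P \<Otimes>\<^sub>M tape_law). \<not> \<phi> x})"
    by (simp add: SCCA_problem_def qp one_mat_cca[OF \<delta>\<^sub>0])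
  let ?U = "uniform_count_measure directions"
  let ?A = "{x \<in> space (scca_space \<Otimes>\<^sub>M tape_law). \<not> ?\<phi>' x}"
  have fin: "finite directions" by (simp add: directions_def flat_sparse_finite)
  have U: "prob_space ?U" using fin ne by (rule prob_space_uniform_count_measure)
  have mix: "cca_mixture (2 * n) s q (p - q) \<rho> = ?U \<bind> ?law \<rho>"
    by (simp add: cca_mixture_def directions_def qp)
  have K: "?law \<rho> \<in> measurable ?U (subprob_algebra scca_space)"
  proof -
    have "?law \<rho> \<in> measurable (count_space directions) (subprob_algebra scca_space)"
      using law \<rho> by (auto simp: space_subprob_algebra prob_space_imp_subprob_space)
    then show ?thesis
      by (subst measurable_cong_sets[OF sets_uniform_count_measure_count_space refl])
  qed
  have A: "?A \<in> sets (scca_space \<Otimes>\<^sub>M tape_law)" using pred by measurable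
  have "emeasure (cca_mixture (2 * n) s q (p - q) \<rho> \<Otimes>\<^sub>M tape_law) ?A \<le>
    (SUP P\<in>null ?L. emeasure (P \<Otimes>\<^sub>M tape_law) {x \<in> space (P \<Otimes>\<^sub>M tape_law). \<phi> x})"
    unfolding mix
  proof (rule emeasure_bind_tape_le[OF U K A])
    fix \<delta> assume "\<delta> \<in> space ?U"
    then have \<delta>: "\<delta> \<in> directions" by (simp add: space_uniform_count_measure)
    have eq: "emeasure (?law \<rho> \<delta> \<Otimes>\<^sub>M tape_law) ?A =
      emeasure (regression_law n p (param_of \<rho> \<delta>) \<Otimes>\<^sub>M tape_law)
          {x \<in> space (regression_law n p (param_of \<rho> \<delta>) \<Otimes>\<^sub>M tape_law). \<phi> x}"
      using pull[OF \<delta>, of \<rho> \<phi>] \<phi> \<rho> by (simp add: case_prod_beta)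
    have "regression_law n p (param_of \<rho> \<delta>) \<in> null ?L"
      using param_null[OF \<delta>] by (simp add: LT_problem_def)
    then show "emeasure (?law \<rho> \<delta> \<Otimes>\<^sub>M tape_law) ?A \<le>
      (SUP P\<in>null ?L. emeasure (P \<Otimes>\<^sub>M tape_law) {x \<in> space (P \<Otimes>\<^sub>M tape_law). \<phi> x})"
      unfolding eq by (rule SUP_upper)
  qed
  moreover have "space (cca_mixture (2 * n) s q (p - q) \<rho> \<Otimes>\<^sub>M tape_law) = space (scca_space \<Otimes>\<^sub>M tape_law)"
  proof -
    have "sets (?U \<bind> ?law \<rho>) = sets scca_space"
      by (rule sets_bind_measurable[OF K]) (use ne in \<open>simp add: space_uniform_count_measure\<close>)
    from sets_eq_imp_space_eq[OF this] show ?thesis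
      unfolding mix by (simp only: space_pair_measure)
  qed
  ultimately have II: "(SUP P\<in>alt (SCCA_problem (2 * n) s q (p - q) \<rho>).
      emeasure (P \<Otimes>\<^sub>M tape_law) {x \<in> space (P \<Otimes>\<^sub>M tape_law). \<not> ?\<phi>' x}) \<le>
    (SUP P\<in>null ?L. emeasure (P \<Otimes>\<^sub>M tape_law) {x \<in> space (P \<Otimes>\<^sub>M tape_law). \<phi> x})"
    by (simp add: SCCA_problem_def)
  show "total_error (SCCA_problem (2 * n) s q (p - q) \<rho>) ?\<phi>' \<le> total_error ?L \<phi>"
    unfolding total_error_def by (subst (2) add.commute) (rule add_mono[OF I II])
qed

end

section \<open>Terminating runs with time bounds\<close>

definition runs :: "prog \<Rightarrow> machine \<Rightarrow> nat \<Rightarrow> (machine \<Rightarrow> bool) \<Rightarrow> bool" where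
  "runs \<pi> s T Q \<longleftrightarrow> (\<exists>t s'. exec \<pi> s t s' \<and> t \<le> T \<and> Q s')"

lemma runs_weaken:
  assumes "runs \<pi> s T Q" "T \<le> T'" "\<And>s'. Q s' \<Longrightarrow> Q' s'"
  shows "runs \<pi> s T' Q'"
  using assms unfolding runs_def by (meson order_trans)

lemma runs_Seq:
  assumes "runs \<pi> s T Q" "\<And>s'. Q s' \<Longrightarrow> runs \<pi>' s' T' R"
  shows "runs (Seq \<pi> \<pi>') s (T + T') R"
  using assms unfolding runs_def by (meson add_mono exec.Seq)

fun block :: "instr list \<Rightarrow> prog" where
  "block [] = Skip"
| "block (c # cs) = Seq (Do c) (block cs)"

declare block.simps [simp del]

lemma exec_block: "exec (block cs) s (Suc (length cs)) (fold exec_instr cs s)"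
proof (induction cs arbitrary: s)
  case (Cons c cs)
  show ?case using exec.Seq[OF exec.Do Cons, of c s] by (simp add: block.simps)
qed (use exec.Skip in \<open>simp add: block.simps\<close>)

lemma runs_block: "Q (fold exec_instr cs s) \<Longrightarrow> length cs < T \<Longrightarrow> runs (block cs) s T Q"
  unfolding runs_def using exec_block Suc_leI by blast

text \<open>
  The invariant is indexed by the number of completed iterations, and the index \<open>m\<close> at which the guard
  fails is known in advance. All loops below count down or subtract a fixed amount.
\<close>

lemma runs_Loop:
  assumes step: "\<And>j s. j < m \<Longrightarrow> I j s \<Longrightarrow> holds g s \<and> runs \<pi> s T (I (Suc j))"
    and exit: "\<And>s. I m s \<Longrightarrow> \<not> holds g s"
    and start: "I 0 s"
  shows "runs (Loop g \<pi>) s (m * Suc T + 1) (I m)"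
proof -
  have "runs (Loop g \<pi>) s ((m - j) * Suc T + 1) (I m)" if "j \<le> m" "I j s" for j s
    using that
  proof (induction "m - j" arbitrary: j s)
    case 0
    then have "j = m" by simp
    with 0 exit[of s] show ?case unfolding runs_def by (auto intro!: exI[of _ s] exec.LoopFalse)
  next
    case (Suc d)
    then have j: "j < m" by simp
    obtain t s' where s': "exec \<pi> s t s'" "t \<le> T" "I (Suc j) s'"
      using step[OF j Suc.prems(2)] unfolding runs_def by blast
    have "d = m - Suc j" "Suc j \<le> m" using Suc.hyps(2) by simp_all
    then obtain t' s'' where s'': "exec (Loop g \<pi>) s' t' s''" "t' \<le> d * Suc T + 1" "I m s''"
      using Suc.hyps(1)[of "Suc j" s'] s'(3) unfolding runs_def by auto
    have "exec (Loop g \<pi>) s (Suc (t + t')) s''"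
      using step[OF j Suc.prems(2)] s' s'' by (intro exec.LoopTrue) auto
    moreover have "Suc (t + t') \<le> (m - j) * Suc T + 1"
      using s'(2) s''(2) Suc.hyps(2)[symmetric] by simp
    ultimately show ?case using s''(3) unfolding runs_def by blast
  qed
  from this[of 0 s] start show ?thesis by simp
qed

definition mem_of :: "real list \<Rightarrow> nat \<Rightarrow> real" where
  "mem_of xs = (\<lambda>j. if j < length xs then xs ! j else 0)"

lemma mem_of_snoc: "(mem_of xs)(length xs := v) = mem_of (xs @ [v])"
  by (auto simp: mem_of_def fun_eq_iff nth_append)

lemma mem_of_append: "j < length xs \<Longrightarrow> mem_of (xs @ ys) j = xs ! j"
  by (simp add: mem_of_def nth_append)

lemma mem_of_snoc_append [simp]:
  "(mem_of (xs @ ys))(length xs + length ys := v) = mem_of (xs @ ys @ [v])"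
  using mem_of_snoc[of "xs @ ys" v] by simp

section \<open>A program for the transformation\<close>

text \<open>
  Register conventions. Integer registers 0 to 5 hold \<open>0\<close>, \<open>1\<close>, \<open>n\<close>, \<open>q\<close>, \<open>p\<close>, \<open>n p\<close>; register 6 points
  to the cell being read in sample \<open>i\<close>, and adding \<open>n p\<close> to it gives the corresponding cell of sample
  \<open>n + i\<close>; register 7 points to the next free cell behind the input; registers 8 and 9 count down the
  outer and inner loop. Real registers 2 to 5 hold \<open>a\<close>, \<open>b\<close>, \<open>w\<close>, \<open>\<kappa>\<close>; register 6 accumulates the
  response.
\<close>

definition noise_prog :: prog where
  "noise_prog = Loop (ILe 1 9) (block
     [RLoad 7 6, IAdd 10 6 5, RLoad 8 10, RMul 7 3 7, RMul 8 2 8, RSub 7 7 8, RMul 7 4 7, RAdd 6 6 7,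
      IAdd 6 6 1, ISub 9 9 1])"

definition blend_prog :: prog where
  "blend_prog = Loop (ILe 1 9) (block
     [RLoad 7 6, IAdd 10 6 5, RLoad 8 10, RMul 7 2 7, RMul 8 3 8, RAdd 7 7 8, RStore 7 7,
      IAdd 7 7 1, IAdd 6 6 1, ISub 9 9 1])"

definition copy_prog :: prog where
  "copy_prog = Loop (ILe 1 9) (block [RLoad 7 6, RStore 7 7, IAdd 7 7 1, IAdd 6 6 1, ISub 9 9 1])"

text \<open>
  The response precedes the covariates in the encoding, so the block of length \<open>q\<close> is read twice: once
  to form the response, once more to write the blended covariates.
\<close>

definition row_prog :: prog where
  "row_prog =
     Seq (block [RConst 6 0, IAdd 9 3 0])
    (Seq noise_prog
    (Seq (block [ISub 6 6 3, RLoad 7 6, IAdd 10 6 5, RLoad 8 10, RMul 7 2 7, RMul 8 3 8, RAdd 7 7 8,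
       RMul 7 5 7, RAdd 6 6 7, RStore 7 6, IAdd 7 7 1, IAdd 9 3 0])
    (Seq blend_prog
    (Seq (block [ISub 9 4 3])
    (Seq copy_prog
         (block [ISub 8 8 1]))))))"

definition rows_prog :: prog where
  "rows_prog = Loop (ILe 1 8) row_prog"

text \<open>
  Moves the memory from cell \<open>2\<close> on down by the length \<open>2 n p\<close> of the input samples. The cells behind the output are
  zero, so letting the move run over the lengths of both also erases the remains.
\<close>

definition shift_prog :: prog where
  "shift_prog = Seq (block [IConst 10 2, ISub 8 7 10, IAdd 6 5 5, IAdd 6 6 10, IAdd 7 10 0])
     (Loop (ILe 1 8) (block [RLoad 7 6, RStore 7 7, IAdd 6 6 1, IAdd 7 7 1, ISub 8 8 1]))"

definition reset_prog :: prog where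
  "reset_prog = block (map (\<lambda>d. IConst d 0) [0..<20] @ map (\<lambda>d. RConst d 0) [0..<20])"

text \<open>
  The constant \<open>h\<close> will be \<open>M2 / c\<close>, and \<open>w\<close> is computed as \<open>h \<tau> / (\<rho>\<^sup>2 k\<^sub>u)\<close>: since
  \<open>\<tau> = c \<rho>\<^sup>2 k\<^sub>u / sqrt q\<close>, this equals \<open>M2 / sqrt q\<close> without taking a root. Multiplication
  \<open>n p\<close> and division \<open>k\<^sub>u div 4\<close> of integers are done by repeated addition and subtraction.
\<close>

definition setup_prog :: "real \<Rightarrow> real \<Rightarrow> real \<Rightarrow> real \<Rightarrow> prog" where
  "setup_prog a b h t0 =
     Seq (block [IConst 1 1, ILoad 2 0, ILoad 12 1, ILoad 13 1, IConst 10 3, ILoad 3 10, IConst 10 4, ILoad 4 10,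
       IAdd 8 2 0])
    (Seq (Loop (ILe 1 8) (block [IAdd 5 5 4, ISub 8 8 1]))
    (Seq (Loop (ILe 10 12) (block [ISub 12 12 10, IAdd 11 11 1]))
    (Seq (block [RLoad 0 0, RLoad 1 1, RConst 2 a, RConst 3 b,
       RConst 6 h, RMul 6 6 1, RMul 7 0 0, RNat 8 13, RMul 8 7 8, RDiv 4 6 8])
    (Seq (block [RMul 6 2 3, RMul 6 6 4, RMul 6 6 7, RNat 8 11, RMul 6 6 8,
       RMul 8 2 0, RMul 8 8 8, RConst 9 1, RSub 8 9 8, RDiv 6 6 8, RConst 7 t0, RAdd 5 7 6])
         (block [IConst 6 2, IAdd 7 5 5, IAdd 7 7 6, IAdd 8 2 0])))))"

text \<open>
  The input consists of two real parameters followed by the entries of \<open>2 n\<close> samples of length \<open>p\<close>.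
\<close>

locale conversion =
  fixes n q p :: nat and a b w \<kappa> :: real and mi :: "nat \<Rightarrow> nat" and \<omega> :: "nat \<Rightarrow> real"
    and inp :: "real list" and z :: "nat \<Rightarrow> nat \<Rightarrow> real"
  assumes q: "0 < q" "q \<le> p"
    and length_inp: "length inp = 2 + 2 * n * p"
    and inp_nth: "\<And>i j. i < 2 * n \<Longrightarrow> j < p \<Longrightarrow> inp ! (2 + i * p + j) = z i j"
begin

definition frame :: "machine \<Rightarrow> bool" where
  "frame s \<longleftrightarrow> ireg s 0 = 0 \<and> ireg s 1 = 1 \<and> ireg s 2 = n \<and> ireg s 3 = q \<and> ireg s 4 = p \<and>
     ireg s 5 = n * p \<and> rreg s 2 = a \<and> rreg s 3 = b \<and> rreg s 4 = w \<and> rreg s 5 = \<kappa> \<and>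
     (\<forall>x\<ge>20. ireg s x = 0) \<and> (\<forall>x\<ge>20. rreg s x = 0) \<and> imem s = mi \<and> tape s = \<omega>"


definition obs :: "nat \<Rightarrow> real \<times> (nat \<Rightarrow> real)" where
  "obs i = pair_to_observation q p a b w \<kappa> (z i, z (n + i))"

definition row :: "nat \<Rightarrow> real list" where
  "row i = fst (obs i) # map (snd (obs i)) [0..<p]"

text \<open>
  The situation in which \<open>out\<close> has been appended to the input, reading has reached entry \<open>j\<close> of sample
  \<open>i\<close>, and \<open>c\<close>, \<open>d\<close> are the remaining inner and outer iterations.
\<close>

definition state :: "machine \<Rightarrow> real list \<Rightarrow> nat \<Rightarrow> nat \<Rightarrow> nat \<Rightarrow> nat \<Rightarrow> bool" where
  "state s out i j c d \<longleftrightarrow> frame s \<and> rmem s = mem_of (inp @ out) \<and> ireg s 7 = length (inp @ out) \<and>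
     ireg s 6 = 2 + i * p + j \<and> ireg s 9 = c \<and> ireg s 8 = d"

lemma stateD:
  assumes "state s out i j c d"
  shows "ireg s 0 = 0" "ireg s 1 = 1" "ireg s (Suc 0) = 1" "ireg s 2 = n" "ireg s 3 = q" "ireg s 4 = p"
    "ireg s 5 = n * p" "rreg s 2 = a" "rreg s 3 = b" "rreg s 4 = w" "rreg s 5 = \<kappa>"
    "rmem s = mem_of (inp @ out)" "ireg s 7 = length (inp @ out)"
    "ireg s 6 = 2 + i * p + j" "ireg s 9 = c" "ireg s 8 = d"
  using assms by (auto simp: state_def frame_def)

lemma input_cells:
  assumes "i < n" "j < p"
  shows "mem_of (inp @ out) (2 + i * p + j) = z i j"
    "mem_of (inp @ out) (2 + i * p + j + n * p) = z (n + i) j"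
proof -
  have lt: "k * p + j < 2 * n * p" if "k < 2 * n" for k
  proof -
    have "k * p + j < Suc k * p" using assms(2) by simp
    also have "\<dots> \<le> 2 * n * p" using that by (intro mult_right_mono) auto
    finally show ?thesis .
  qed
  show "mem_of (inp @ out) (2 + i * p + j) = z i j"
    using assms lt[of i] inp_nth[of i j] by (subst mem_of_append) (auto simp: length_inp)
  have eq: "2 + i * p + j + n * p = 2 + (n + i) * p + j" by (simp add: algebra_simps)
  show "mem_of (inp @ out) (2 + i * p + j + n * p) = z (n + i) j"
    unfolding eq using assms lt[of "n + i"] inp_nth[of "n + i" j]
    by (subst mem_of_append) (auto simp: length_inp)
qed

lemma noise_prog_runs:
  assumes i: "i < n" and s: "state s out i 0 q d" "rreg s 6 = 0"
  shows "runs noise_prog s (q * 12 + 1)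
    (\<lambda>s. state s out i q 0 d \<and> rreg s 6 = (\<Sum>j<q. w * (b * z i j - a * z (n + i) j)))"
proof -
  let ?I = "\<lambda>j s. state s out i j (q - j) d \<and> rreg s 6 = (\<Sum>j<j. w * (b * z i j - a * z (n + i) j))"
  have "runs noise_prog s (q * Suc 11 + 1) (?I q)"
    unfolding noise_prog_def
  proof (rule runs_Loop[where I = ?I])
    fix j s assume j: "j < q" and I: "?I j s"
    note [simp] = stateD[OF I[THEN conjunct1]]
    have jp: "j < p" using j q by simp
    note [simp] = input_cells[OF i jp, simplified]
    let ?cs = "[RLoad 7 6, IAdd 10 6 5, RLoad 8 10, RMul 7 3 7, RMul 8 2 8, RSub 7 7 8, RMul 7 4 7, RAdd 6 6 7,
      IAdd 6 6 1, ISub 9 9 1]"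
    have "runs (block ?cs) s 11 (?I (Suc j))"
      using I j by (intro runs_block) (auto simp: state_def frame_def)
    then show "holds (ILe 1 9) s \<and> runs (block ?cs) s 11 (?I (Suc j))"
      using j by simp
  next
    fix s assume "?I q s"
    from stateD[OF this[THEN conjunct1]] show "\<not> holds (ILe 1 9) s" by simp
  next
    show "?I 0 s" using s by simp
  qed
  then show ?thesis by simp
qed

lemma obs_simps:
  "fst (obs i) = (\<Sum>j<q. w * (b * z i j - a * z (n + i) j)) + \<kappa> * (a * z i 0 + b * z (n + i) 0)"
  "j < q \<Longrightarrow> snd (obs i) j = a * z i j + b * z (n + i) j"
  "q \<le> j \<Longrightarrow> j < p \<Longrightarrow> snd (obs i) j = z i j"
  using q by (auto simp: obs_def pair_to_observation_def)

lemma response_runs: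
  assumes i: "i < n" and s: "state s out i q 0 d"
    and acc: "rreg s 6 = (\<Sum>j<q. w * (b * z i j - a * z (n + i) j))"
  shows "runs (block [ISub 6 6 3, RLoad 7 6, IAdd 10 6 5, RLoad 8 10, RMul 7 2 7, RMul 8 3 8, RAdd 7 7 8,
       RMul 7 5 7, RAdd 6 6 7, RStore 7 6, IAdd 7 7 1, IAdd 9 3 0]) s 13
    (\<lambda>s. state s (out @ [fst (obs i)]) i 0 q d)"
proof -
  note [simp] = stateD[OF s]
  have p: "0 < p" using q by simp
  note [simp] = input_cells[OF i p, simplified]
  let ?cs = "[ISub 6 6 3, RLoad 7 6, IAdd 10 6 5, RLoad 8 10, RMul 7 2 7, RMul 8 3 8, RAdd 7 7 8,
       RMul 7 5 7, RAdd 6 6 7, RStore 7 6, IAdd 7 7 1, IAdd 9 3 0]"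
  have "runs (block ?cs) s 13 (\<lambda>s. state s (out @ [fst (obs i)]) i 0 q d)"
    using s acc by (intro runs_block) (auto simp: state_def frame_def obs_simps)
  then show ?thesis by simp
qed

lemma blend_prog_runs:
  assumes i: "i < n" and s: "state s out i 0 q d"
  shows "runs blend_prog s (q * 12 + 1) (\<lambda>s. state s (out @ map (snd (obs i)) [0..<q]) i q 0 d)"
proof -
  let ?I = "\<lambda>j s. state s (out @ map (snd (obs i)) [0..<j]) i j (q - j) d"
  have "runs blend_prog s (q * Suc 11 + 1) (?I q)"
    unfolding blend_prog_def
  proof (rule runs_Loop[where I = ?I])
    fix j s assume j: "j < q" and I: "?I j s"
    define pre where "pre = out @ map (snd (obs i)) [0..<j]"
    have I: "state s pre i j (q - j) d" using I by (simp add: pre_def)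
    note [simp] = stateD[OF I]
    have jp: "j < p" using j q by simp
    note [simp] = input_cells[OF i jp, simplified]
    let ?cs = "[RLoad 7 6, IAdd 10 6 5, RLoad 8 10, RMul 7 2 7, RMul 8 3 8, RAdd 7 7 8, RStore 7 7,
      IAdd 7 7 1, IAdd 6 6 1, ISub 9 9 1]"
    have "runs (block ?cs) s 11
        (\<lambda>s. state s (pre @ [snd (obs i) j]) i (Suc j) (q - Suc j) d)"
      using I j by (intro runs_block) (auto simp: state_def frame_def obs_simps)
    then show "holds (ILe 1 9) s \<and> runs (block ?cs) s 11 (?I (Suc j))"
      using j by (simp add: pre_def)
  next
    fix s assume "?I q s"
    from stateD[OF this] show "\<not> holds (ILe 1 9) s" by simp
  next
    show "?I 0 s" using s by simp
  qed
  then show ?thesis by simp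
qed

lemma copy_prog_runs:
  assumes i: "i < n" and s: "state s out i q (p - q) d"
  shows "runs copy_prog s ((p - q) * 7 + 1) (\<lambda>s. state s (out @ map (snd (obs i)) [q..<p]) i p 0 d)"
proof -
  let ?I = "\<lambda>j s. state s (out @ map (snd (obs i)) [q..<q + j]) i (q + j) (p - q - j) d"
  have "runs copy_prog s ((p - q) * Suc 6 + 1) (?I (p - q))"
    unfolding copy_prog_def
  proof (rule runs_Loop[where I = ?I])
    fix j s assume j: "j < p - q" and I: "?I j s"
    define pre where "pre = out @ map (snd (obs i)) [q..<q + j]"
    have I: "state s pre i (q + j) (p - q - j) d" using I by (simp add: pre_def)
    note [simp] = stateD[OF I]
    have jp: "q + j < p" using j by simp
    note [simp] = input_cells[OF i jp, simplified]
    let ?cs = "[RLoad 7 6, RStore 7 7, IAdd 7 7 1, IAdd 6 6 1, ISub 9 9 1]"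
    have "runs (block ?cs) s 6
        (\<lambda>s. state s (pre @ [snd (obs i) (q + j)]) i (q + Suc j) (p - q - Suc j) d)"
      using I j by (intro runs_block) (auto simp: state_def frame_def obs_simps)
    then show "holds (ILe 1 9) s \<and> runs (block ?cs) s 6 (?I (Suc j))"
      using j by (simp add: pre_def)
  next
    fix s assume "?I (p - q) s"
    from stateD[OF this] show "\<not> holds (ILe 1 9) s" by simp
  next
    show "?I 0 s" using s by simp
  qed
  then show ?thesis using q by simp
qed

lemma row_prog_runs:
  assumes i: "i < n" and s: "state s out i 0 c d"
  shows "runs row_prog s (24 * p + 30) (\<lambda>s. state s (out @ row i) (Suc i) 0 0 (d - 1))"
proof -
  have 1: "runs (block [RConst 6 0, IAdd 9 3 0]) s 3 (\<lambda>s. state s out i 0 q d \<and> rreg s 6 = 0)"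
  proof -
    note [simp] = stateD[OF s]
    have "runs (block [RConst 6 0, IAdd 9 3 0]) s 3
        (\<lambda>s. state s out i 0 q d \<and> rreg s 6 = 0)"
      using s by (intro runs_block) (auto simp: state_def frame_def)
    then show ?thesis by simp
  qed
  have 5: "runs (block [ISub 9 4 3]) s 2 (\<lambda>s. state s out' i q (p - q) d)" if s: "state s out' i q 0 d" for s out'
  proof -
    note [simp] = stateD[OF s]
    have "runs (block [ISub 9 4 3]) s 2 (\<lambda>s. state s out' i q (p - q) d)"
      using s by (intro runs_block) (auto simp: state_def frame_def)
    then show ?thesis by simp
  qed
  have 7: "runs (block [ISub 8 8 1]) s 2 (\<lambda>s. state s out' (Suc i) 0 0 (d - 1))" if s: "state s out' i p 0 d" for s out'
  proof -
    note [simp] = stateD[OF s]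
    have "runs (block [ISub 8 8 1]) s 2 (\<lambda>s. state s out' (Suc i) 0 0 (d - 1))"
      using s by (intro runs_block) (auto simp: state_def frame_def)
    then show ?thesis by simp
  qed
  have row: "out @ row i = ((out @ [fst (obs i)]) @ map (snd (obs i)) [0..<q]) @ map (snd (obs i)) [q..<p]"
    using upt_add_eq_append[of 0 q "p - q"] q by (simp add: row_def flip: map_append)
  have "runs row_prog s (3 + ((q * 12 + 1) + (13 + ((q * 12 + 1) + (2 + (((p - q) * 7 + 1) + 2))))))
      (\<lambda>s. state s (out @ row i) (Suc i) 0 0 (d - 1))"
    unfolding row_prog_def row
    by (intro runs_Seq[OF 1] runs_Seq[OF noise_prog_runs[OF i]] runs_Seq[OF response_runs[OF i]]
      runs_Seq[OF blend_prog_runs[OF i]] runs_Seq[OF 5] runs_Seq[OF copy_prog_runs[OF i]] 7) auto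
  then show ?thesis by (rule runs_weaken) (use q in auto)
qed

lemma rows_prog_runs:
  assumes s: "state s [] 0 0 c n"
  shows "runs rows_prog s (n * (24 * p + 31) + 1)
    (\<lambda>s. \<exists>c. state s (concat (map row [0..<n])) n 0 c 0)"
proof -
  let ?I = "\<lambda>i s. \<exists>c. state s (concat (map row [0..<i])) i 0 c (n - i)"
  have "runs rows_prog s (n * Suc (24 * p + 30) + 1) (?I n)"
    unfolding rows_prog_def
  proof (rule runs_Loop[where I = ?I])
    fix i s assume i: "i < n" and "?I i s"
    then obtain c where I: "state s (concat (map row [0..<i])) i 0 c (n - i)" by blast
    have "runs row_prog s (24 * p + 30) (?I (Suc i))"
      by (rule runs_weaken[OF row_prog_runs[OF i I]]) auto
    then show "holds (ILe 1 8) s \<and> runs row_prog s (24 * p + 30) (?I (Suc i))"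
      using i stateD[OF I] by simp
  next
    fix s assume "?I n s"
    then obtain c where "state s (concat (map row [0..<n])) n 0 c (n - n)" by blast
    from stateD[OF this] show "\<not> holds (ILe 1 8) s" by simp
  next
    show "?I 0 s" using s by auto
  qed
  then show ?thesis by (simp add: add.commute)
qed

lemma length_rows: "length (concat (map row [0..<m])) = m * (p + 1)"
  by (induction m) (auto simp: row_def)

text \<open>
  The move reads \<open>2 n p\<close> cells ahead of where it writes, so it never reads a cell that it has already
  changed.
\<close>

lemma shift_prog_runs:
  assumes s: "state s out n 0 c 0"
  shows "runs shift_prog s (6 + ((2 * n * p + length out) * 7 + 1))
    (\<lambda>s. frame s \<and> rmem s = mem_of (take 2 inp @ out))"
proof -
  let ?M = "mem_of (inp @ out)" and ?L = "2 * n * p + length out"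
  let ?I = "\<lambda>j s. frame s \<and> rmem s = (\<lambda>x. if 2 \<le> x \<and> x < 2 + j then ?M (x + 2 * n * p) else ?M x) \<and>
    ireg s 6 = 2 + 2 * n * p + j \<and> ireg s 7 = 2 + j \<and> ireg s 8 = ?L - j"
  have 1: "runs (block [IConst 10 2, ISub 8 7 10, IAdd 6 5 5, IAdd 6 6 10, IAdd 7 10 0]) s 6 (?I 0)"
  proof -
    note [simp] = stateD[OF s]
    let ?cs = "[IConst 10 2, ISub 8 7 10, IAdd 6 5 5, IAdd 6 6 10, IAdd 7 10 0]"
    have "runs (block ?cs) s 6 (?I 0)"
      using s by (intro runs_block) (auto simp: state_def frame_def length_inp)
    then show ?thesis by simp
  qed
  have 2: "runs (Loop (ILe 1 8) (block [RLoad 7 6, RStore 7 7, IAdd 6 6 1, IAdd 7 7 1, ISub 8 8 1])) s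
      (?L * Suc 6 + 1) (?I ?L)" if "?I 0 s" for s
  proof (rule runs_Loop[where I = ?I])
    fix j s assume j: "j < ?L" and I: "?I j s"
    have fr: "ireg s 1 = 1" "ireg s (Suc 0) = 1" "ireg s 0 = 0" using I by (auto simp: frame_def)
    let ?cs = "[RLoad 7 6, RStore 7 7, IAdd 6 6 1, IAdd 7 7 1, ISub 8 8 1]"
    have "runs (block ?cs) s 6 (?I (Suc j))"
      using I j fr by (intro runs_block) (auto simp: frame_def fun_eq_iff less_Suc_eq algebra_simps)
    then show "holds (ILe 1 8) s \<and> runs (block ?cs) s 6 (?I (Suc j))"
      using j I fr by simp
  next
    fix s assume "?I ?L s"
    then show "\<not> holds (ILe 1 8) s" by (auto simp: frame_def)
  next
    show "?I 0 s" by fact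
  qed
  have fin: "(\<lambda>x. if 2 \<le> x \<and> x < 2 + ?L then ?M (x + 2 * n * p) else ?M x) = mem_of (take 2 inp @ out)"
    by (auto simp: fun_eq_iff mem_of_def nth_append length_inp numeral_2_eq_2)
  have "runs shift_prog s (6 + (?L * Suc 6 + 1)) (?I ?L)"
    unfolding shift_prog_def by (rule runs_Seq[OF 1 2])
  then show ?thesis
    by (rule runs_weaken) (simp, elim conjE, intro conjI, assumption, simp only: fin)
qed

lemma fold_clear_ireg:
  "fold exec_instr (map (\<lambda>d. IConst d 0) [0..<m]) s = s\<lparr>ireg := (\<lambda>x. if x < m then 0 else ireg s x)\<rparr>"
  by (induction m) (auto simp: fun_eq_iff less_Suc_eq)

lemma fold_clear_rreg:
  "fold exec_instr (map (\<lambda>d. RConst d 0) [0..<m]) s = s\<lparr>rreg := (\<lambda>x. if x < m then 0 else rreg s x)\<rparr>"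
  by (induction m) (auto simp: fun_eq_iff less_Suc_eq)

lemma reset_prog_runs:
  assumes "frame s"
  shows "runs reset_prog s 41 (\<lambda>s'. s' = \<lparr>ireg = (\<lambda>_. 0), imem = mi, rreg = (\<lambda>_. 0), rmem = rmem s, tape = \<omega>\<rparr>)"
proof -
  let ?cs = "map (\<lambda>d. IConst d 0) [0..<20] @ map (\<lambda>d. RConst d 0) [0..<20]"
  have "runs reset_prog s 41
      (\<lambda>s'. s' = \<lparr>ireg = (\<lambda>_. 0), imem = mi, rreg = (\<lambda>_. 0), rmem = rmem s, tape = \<omega>\<rparr>)"
    unfolding reset_prog_def
    by (rule runs_block, subst fold_append, unfold comp_def fold_clear_ireg fold_clear_rreg)
      (use assms in \<open>auto simp: frame_def fun_eq_iff\<close>)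
  then show ?thesis by simp
qed

end

definition convert_prog :: "real \<Rightarrow> real \<Rightarrow> real \<Rightarrow> real \<Rightarrow> prog" where
  "convert_prog a b h t0 = Seq (setup_prog a b h t0) (Seq rows_prog (Seq shift_prog reset_prog))"

definition negate_prog :: prog where
  "negate_prog = block [IConst 1 1, ISub 0 1 0]"

context conversion
begin

lemma setup_prog_runs:
  fixes k\<^sub>u :: nat and h \<rho> \<tau> t0 :: real
  assumes mi: "mi 0 = n" "mi 1 = k\<^sub>u" "mi 3 = q" "mi 4 = p"
    and inp: "inp ! 0 = \<rho>" "inp ! 1 = \<tau>"
    and w: "w = h * \<tau> / (\<rho> * \<rho> * k\<^sub>u)"
    and \<kappa>: "\<kappa> = t0 + a * b * w * (\<rho> * \<rho>) * real (k\<^sub>u div 4) / (1 - a * \<rho> * (a * \<rho>))"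
  shows "runs (setup_prog a b h t0)
      \<lparr>ireg = (\<lambda>_. 0), imem = mi, rreg = (\<lambda>_. 0), rmem = mem_of inp, tape = \<omega>\<rparr>
      (4 * n + 4 * k\<^sub>u + 41) (\<lambda>s. state s [] 0 0 0 n)"
    (is "runs _ ?s0 _ _")
proof -
  define pre where "pre s u5 u8 u11 u12 \<longleftrightarrow>
      ireg s = (\<lambda>_. 0)(1 := 1, 2 := n, 3 := q, 4 := p, 5 := u5, 8 := u8, 10 := 4, 11 := u11, 12 := u12, 13 := k\<^sub>u) \<and>
      rreg s = (\<lambda>_. 0) \<and> rmem s = mem_of inp \<and> imem s = mi \<and> tape s = \<omega>" for s :: machine and u5 u8 u11 u12
  have cells: "mem_of inp 0 = \<rho>" "mem_of inp (Suc 0) = \<tau>"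
    using inp by (simp_all add: mem_of_def length_inp)
  have 1: "runs (block [IConst 1 1, ILoad 2 0, ILoad 12 1, ILoad 13 1, IConst 10 3, ILoad 3 10, IConst 10 4,
      ILoad 4 10, IAdd 8 2 0]) ?s0 10 (\<lambda>s. pre s 0 n 0 k\<^sub>u)"
    using mi by (intro runs_block) (auto simp: pre_def fun_eq_iff)
  have 2: "runs (Loop (ILe 1 8) (block [IAdd 5 5 4, ISub 8 8 1])) s (n * Suc 3 + 1) (\<lambda>s. pre s (n * p) 0 0 k\<^sub>u)"
    if s: "pre s 0 n 0 k\<^sub>u" for s
  proof -
    have "runs (Loop (ILe 1 8) (block [IAdd 5 5 4, ISub 8 8 1])) s (n * Suc 3 + 1) (\<lambda>s. pre s (n * p) (n - n) 0 k\<^sub>u)"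
    proof (rule runs_Loop[where I = "\<lambda>i s. pre s (i * p) (n - i) 0 k\<^sub>u"])
      fix i s assume "i < n" "pre s (i * p) (n - i) 0 k\<^sub>u"
      then show "holds (ILe 1 8) s \<and> runs (block [IAdd 5 5 4, ISub 8 8 1]) s 3 (\<lambda>s. pre s (Suc i * p) (n - Suc i) 0 k\<^sub>u)"
        by (auto simp: pre_def fun_eq_iff intro!: runs_block)
    qed (use s in \<open>auto simp: pre_def\<close>)
    then show ?thesis by simp
  qed
  have 3: "runs (Loop (ILe 10 12) (block [ISub 12 12 10, IAdd 11 11 1])) s ((k\<^sub>u div 4) * Suc 3 + 1)
      (\<lambda>s. pre s (n * p) 0 (k\<^sub>u div 4) (k\<^sub>u - 4 * (k\<^sub>u div 4)))"
    if s: "pre s (n * p) 0 0 k\<^sub>u" for s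
  proof (rule runs_Loop[where I = "\<lambda>i s. pre s (n * p) 0 i (k\<^sub>u - 4 * i)"])
    fix i s assume i: "i < k\<^sub>u div 4" and "pre s (n * p) 0 i (k\<^sub>u - 4 * i)"
    moreover have "4 \<le> k\<^sub>u - 4 * i" using i by linarith
    ultimately show "holds (ILe 10 12) s \<and>
        runs (block [ISub 12 12 10, IAdd 11 11 1]) s 3 (\<lambda>s. pre s (n * p) 0 (Suc i) (k\<^sub>u - 4 * Suc i))"
      by (auto simp: pre_def fun_eq_iff intro!: runs_block)
  qed (use s in \<open>auto simp: pre_def\<close>)
  have 4: "runs (block [RLoad 0 0, RLoad 1 1, RConst 2 a, RConst 3 b,
      RConst 6 h, RMul 6 6 1, RMul 7 0 0, RNat 8 13, RMul 8 7 8, RDiv 4 6 8]) s 11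
      (\<lambda>s'. ireg s' = ireg s \<and> rmem s' = rmem s \<and> imem s' = imem s \<and> tape s' = tape s \<and>
        rreg s' 0 = \<rho> \<and> rreg s' 2 = a \<and> rreg s' 3 = b \<and> rreg s' 4 = w \<and> rreg s' 7 = \<rho> * \<rho> \<and> (\<forall>x\<ge>20. rreg s' x = 0))"
    if s: "pre s (n * p) 0 (k\<^sub>u div 4) r" for s r
    using s by (intro runs_block) (auto simp: pre_def cells w)
  have 5: "runs (block [RMul 6 2 3, RMul 6 6 4, RMul 6 6 7, RNat 8 11, RMul 6 6 8,
       RMul 8 2 0, RMul 8 8 8, RConst 9 1, RSub 8 9 8, RDiv 6 6 8, RConst 7 t0, RAdd 5 7 6]) s 13
      (\<lambda>s'. ireg s' = ireg s \<and> rmem s' = rmem s \<and> imem s' = imem s \<and> tape s' = tape s \<and>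
        rreg s' 2 = a \<and> rreg s' 3 = b \<and> rreg s' 4 = w \<and> rreg s' 5 = \<kappa> \<and> (\<forall>x\<ge>20. rreg s' x = 0))"
    if s: "ireg s 11 = k\<^sub>u div 4" "rreg s 0 = \<rho>" "rreg s 2 = a" "rreg s 3 = b" "rreg s 4 = w"
      "rreg s 7 = \<rho> * \<rho>" "\<forall>x\<ge>20. rreg s x = 0" for s
    using s by (intro runs_block) (auto simp: \<kappa>)
  have 45: "runs (Seq (block [RLoad 0 0, RLoad 1 1, RConst 2 a, RConst 3 b,
      RConst 6 h, RMul 6 6 1, RMul 7 0 0, RNat 8 13, RMul 8 7 8, RDiv 4 6 8])
      (Seq (block [RMul 6 2 3, RMul 6 6 4, RMul 6 6 7, RNat 8 11, RMul 6 6 8,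
       RMul 8 2 0, RMul 8 8 8, RConst 9 1, RSub 8 9 8, RDiv 6 6 8, RConst 7 t0, RAdd 5 7 6])
      (block [IConst 6 2, IAdd 7 5 5, IAdd 7 7 6, IAdd 8 2 0]))) s (11 + (13 + 5)) (\<lambda>s. state s [] 0 0 0 n)"
    if s: "pre s (n * p) 0 (k\<^sub>u div 4) r" for s r
  proof (rule runs_Seq[OF 4[OF s]], rule runs_Seq[OF 5])
    fix s1 s2 :: machine
    assume s1: "ireg s1 = ireg s \<and> rmem s1 = rmem s \<and> imem s1 = imem s \<and> tape s1 = tape s \<and>
        rreg s1 0 = \<rho> \<and> rreg s1 2 = a \<and> rreg s1 3 = b \<and> rreg s1 4 = w \<and> rreg s1 7 = \<rho> * \<rho> \<and> (\<forall>x\<ge>20. rreg s1 x = 0)"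
      and s2: "ireg s2 = ireg s1 \<and> rmem s2 = rmem s1 \<and> imem s2 = imem s1 \<and> tape s2 = tape s1 \<and>
        rreg s2 2 = a \<and> rreg s2 3 = b \<and> rreg s2 4 = w \<and> rreg s2 5 = \<kappa> \<and> (\<forall>x\<ge>20. rreg s2 x = 0)"
    show "runs (block [IConst 6 2, IAdd 7 5 5, IAdd 7 7 6, IAdd 8 2 0]) s2 5 (\<lambda>s. state s [] 0 0 0 n)"
      using s s1 s2 by (intro runs_block) (auto simp: pre_def state_def frame_def length_inp)
  qed (use s in \<open>auto simp: pre_def\<close>)
  have "runs (setup_prog a b h t0) ?s0
      (10 + ((n * Suc 3 + 1) + (((k\<^sub>u div 4) * Suc 3 + 1) + (11 + (13 + 5))))) (\<lambda>s. state s [] 0 0 0 n)"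
    unfolding setup_prog_def
    by (rule runs_Seq[OF 1], rule runs_Seq[OF 2], assumption, rule runs_Seq[OF 3], assumption, rule 45)
  then show ?thesis by (rule runs_weaken) auto
qed

text \<open>
  The final configuration is the initial one for the transformed sample, register by register and
  cell by cell. This matters because the behaviour of an arbitrary program afterwards may depend on
  every register and every cell.
\<close>

lemma convert_prog_runs:
  fixes k\<^sub>u :: nat and h \<rho> \<tau> t0 :: real
  assumes mi: "mi 0 = n" "mi 1 = k\<^sub>u" "mi 3 = q" "mi 4 = p"
    and inp: "inp ! 0 = \<rho>" "inp ! 1 = \<tau>"
    and w: "w = h * \<tau> / (\<rho> * \<rho> * k\<^sub>u)"
    and \<kappa>: "\<kappa> = t0 + a * b * w * (\<rho> * \<rho>) * real (k\<^sub>u div 4) / (1 - a * \<rho> * (a * \<rho>))"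
    and le: "k\<^sub>u \<le> p" "1 \<le> n"
  shows "runs (convert_prog a b h t0)
      \<lparr>ireg = (\<lambda>_. 0), imem = mi, rreg = (\<lambda>_. 0), rmem = mem_of inp, tape = \<omega>\<rparr>
      (200 * (n * p))
      (\<lambda>s. s = \<lparr>ireg = (\<lambda>_. 0), imem = mi, rreg = (\<lambda>_. 0),
        rmem = mem_of (take 2 inp @ concat (map row [0..<n])), tape = \<omega>\<rparr>)"
proof -
  let ?out = "concat (map row [0..<n])"
  let ?s0 = "\<lparr>ireg = (\<lambda>_. 0), imem = mi, rreg = (\<lambda>_. 0), rmem = mem_of inp, tape = \<omega>\<rparr>"
  let ?Q = "\<lambda>s. s = \<lparr>ireg = (\<lambda>_. 0), imem = mi, rreg = (\<lambda>_. 0), rmem = mem_of (take 2 inp @ ?out), tape = \<omega>\<rparr>"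
  let ?T3 = "6 + ((2 * n * p + length ?out) * 7 + 1)"
  have 3: "runs shift_prog s ?T3 (\<lambda>s. frame s \<and> rmem s = mem_of (take 2 inp @ ?out))"
    if "\<exists>c. state s ?out n 0 c 0" for s
    using that shift_prog_runs by blast
  have 4: "runs reset_prog s 41 ?Q" if "frame s \<and> rmem s = mem_of (take 2 inp @ ?out)" for s
    by (rule runs_weaken[OF reset_prog_runs]) (use that in auto)
  have "runs (convert_prog a b h t0) ?s0
      ((4 * n + 4 * k\<^sub>u + 41) + ((n * (24 * p + 31) + 1) + (?T3 + 41))) ?Q"
    unfolding convert_prog_def
    by (rule runs_Seq[OF setup_prog_runs[OF mi inp w \<kappa>]], rule runs_Seq[OF rows_prog_runs], assumption,
        rule runs_Seq[OF 3], assumption, rule 4)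
  moreover have "(4 * n + 4 * k\<^sub>u + 41) + ((n * (24 * p + 31) + 1) + (?T3 + 41)) \<le> 200 * (n * p)"
  proof -
    have "1 \<le> p" using q by simp
    then have "n \<le> n * p" "p \<le> n * p" "1 \<le> n * p" using le(2) by simp_all
    moreover have "n * (24 * p + 31) = 24 * (n * p) + 31 * n" "n * (p + 1) = n * p + n"
      "2 * n * p = 2 * (n * p)" by (simp_all add: algebra_simps)
    moreover have "4 * n + 4 * k\<^sub>u + 41 + (24 * X + 31 * n + 1 + (6 + ((2 * X + (X + n)) * 7 + 1) + 41)) \<le> 200 * X"
      if "n \<le> X" "k\<^sub>u \<le> X" "1 \<le> X" for X
      using that by simp
    ultimately show ?thesis using le(1) by (simp only: length_rows)
  qed
  ultimately show ?thesis by (rule runs_weaken) auto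
qed

end

lemma runs_then_negated:
  assumes "runs \<pi>\<^sub>1 s T (\<lambda>s'. s' = s1)" and "exec \<pi>\<^sub>2 s1 t s2"
  shows "\<exists>t' s'. exec (Seq \<pi>\<^sub>1 (Seq \<pi>\<^sub>2 negate_prog)) s t' s' \<and> t' \<le> T + t + 3 \<and>
    (ireg s' 0 \<noteq> 0 \<longleftrightarrow> ireg s2 0 = 0)"
proof -
  obtain t1 where t1: "exec \<pi>\<^sub>1 s t1 s1" "t1 \<le> T" using assms(1) by (auto simp: runs_def)
  have "exec negate_prog s2 3 (fold exec_instr [IConst 1 1, ISub 0 1 0] s2)"
    using exec_block[of "[IConst 1 1, ISub 0 1 0]" s2] by (simp add: negate_prog_def numeral_3_eq_3)
  then have "exec (Seq \<pi>\<^sub>1 (Seq \<pi>\<^sub>2 negate_prog)) s (t1 + (t + 3)) (fold exec_instr [IConst 1 1, ISub 0 1 0] s2)"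
    using t1(1) assms(2) by (intro exec.Seq)
  moreover have "ireg (fold exec_instr [IConst 1 1, ISub 0 1 0] s2) 0 \<noteq> 0 \<longleftrightarrow> ireg s2 0 = 0"
    by auto
  ultimately show ?thesis using t1(2) by fastforce
qed

lemma nth_concat_uniform:
  assumes "\<And>xs. xs \<in> set xss \<Longrightarrow> length xs = m" "i < length xss" "j < m"
  shows "concat xss ! (i * m + j) = xss ! i ! j"
  using assms
proof (induction xss arbitrary: i)
  case (Cons xs xss)
  show ?case
  proof (cases i)
    case (Suc l)
    have "concat xss ! (l * m + j) = xss ! l ! j" using Cons Suc by simp
    then show ?thesis using Cons.prems(1)[of xs] Suc by (simp add: nth_append)
  qed (use Cons.prems in \<open>simp add: nth_append\<close>)
qed simp

section \<open>The reduction along the sequence\<close>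

text \<open>
  From \<open>sqrt n \<lless> k\<^sub>u ln p\<close> and \<open>k\<^sub>u \<lesssim> p\<^sup>\<gamma>\<close> one gets \<open>k\<^sub>\<xi> \<lesssim> n / ln p \<lesssim> p powr (2 \<gamma>) * ln p\<close>, which is
  \<open>o(p)\<close> because \<open>\<gamma> < 1 / 2\<close>. So both blocks of coordinates eventually have room for directions of
  sparsity \<open>k\<^sub>u div 4\<close>.
\<close>

lemma eventually_sparse_regime:
  fixes n p k\<^sub>u k\<^sub>\<xi> :: "nat \<Rightarrow> nat" and \<gamma> :: real
  assumes \<gamma>: "\<gamma> < 1 / 2"
    and n: "filterlim n at_top sequentially" and p: "filterlim p at_top sequentially"
    and ku: "filterlim k\<^sub>u at_top sequentially"
    and ku_p: "asymp_le (\<lambda>i. real (k\<^sub>u i)) (\<lambda>i. real (p i) powr \<gamma>)"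
    and n_ku: "asymp_less (\<lambda>i. sqrt (real (n i)) / ln (real (p i))) (\<lambda>i. real (k\<^sub>u i))"
    and ku_k\<xi>: "asymp_less (\<lambda>i. real (k\<^sub>u i)) (\<lambda>i. real (k\<^sub>\<xi> i))"
    and k\<xi>_n: "asymp_le (\<lambda>i. real (k\<^sub>\<xi> i)) (\<lambda>i. real (n i) / ln (real (p i)))"
    and k\<xi>: "filterlim k\<^sub>\<xi> at_top sequentially"
  shows "\<forall>\<^sub>F i in sequentially. 0 < n i \<and> 4 \<le> k\<^sub>u i \<and> k\<^sub>u i \<le> k\<^sub>\<xi> i \<and> k\<^sub>\<xi> i + k\<^sub>u i \<le> p i"
proof -
  obtain C1 where C1: "C1 > 0" "\<forall>\<^sub>F i in sequentially. real (k\<^sub>u i) \<le> C1 * real (p i) powr \<gamma>"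
    using ku_p by (auto simp: asymp_le_def)
  obtain C2 where C2: "C2 > 0" "\<forall>\<^sub>F i in sequentially. real (k\<^sub>\<xi> i) \<le> C2 * (real (n i) / ln (real (p i)))"
    using k\<xi>_n by (auto simp: asymp_le_def)
  have "((\<lambda>x::real. C2 * (C1\<^sup>2 * (x powr (2 * \<gamma>) * ln x)) / x) \<longlongrightarrow> 0) at_top"
    using \<gamma> by real_asymp
  then have lim1: "\<forall>\<^sub>F x in at_top. C2 * (C1\<^sup>2 * (x powr (2 * \<gamma>) * ln x)) / x < 1 / 2"
    by (rule order_tendstoD) simp
  have "((\<lambda>x::real. C1 * x powr \<gamma> / x) \<longlongrightarrow> 0) at_top"
    using \<gamma> by real_asymp
  then have lim2: "\<forall>\<^sub>F x in at_top. C1 * x powr \<gamma> / x < 1 / 2"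
    by (rule order_tendstoD) simp
  have pr: "filterlim (\<lambda>i. real (p i)) at_top sequentially"
    using p by (rule filterlim_compose[OF filterlim_real_sequentially])
  have ev: "\<forall>\<^sub>F i in sequentially. sqrt (real (n i)) / ln (real (p i)) / real (k\<^sub>u i) < 1"
    using n_ku unfolding asymp_less_def by (rule order_tendstoD) simp
  have ev': "\<forall>\<^sub>F i in sequentially. real (k\<^sub>u i) / real (k\<^sub>\<xi> i) < 1"
    using ku_k\<xi> unfolding asymp_less_def by (rule order_tendstoD) simp
  have large: "\<forall>\<^sub>F i in sequentially. 1 \<le> n i" "\<forall>\<^sub>F i in sequentially. 4 \<le> k\<^sub>u i"
    "\<forall>\<^sub>F i in sequentially. 1 \<le> k\<^sub>\<xi> i" "\<forall>\<^sub>F i in sequentially. 2 \<le> p i"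
    using n p ku k\<xi> by (auto simp: filterlim_at_top)
  show ?thesis
    using C1(2) C2(2) eventually_compose_filterlim[OF lim1 pr] eventually_compose_filterlim[OF lim2 pr] ev ev' large
  proof eventually_elim
    case (elim i)
    define P where "P = real (p i)"
    have P: "P > 0" and lnP: "ln P > 0" using elim by (simp_all add: P_def)
    have "sqrt (real (n i)) \<le> real (k\<^sub>u i) * ln P"
      using elim lnP by (simp add: P_def field_simps)
    then have "real (n i) \<le> (real (k\<^sub>u i) * ln P)\<^sup>2"
      by (simp add: sqrt_le_D)
    also have "\<dots> \<le> (C1 * P powr \<gamma> * ln P)\<^sup>2"
      using elim lnP by (intro power_mono mult_right_mono) (auto simp: P_def)
    also have "\<dots> = C1\<^sup>2 * (P powr (2 * \<gamma>) * ln P) * ln P"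
      using P by (simp add: power_mult_distrib power2_eq_square powr_add[symmetric] mult.assoc)
    finally have "real (n i) / ln P \<le> C1\<^sup>2 * (P powr (2 * \<gamma>) * ln P)"
      using lnP by (simp add: divide_le_eq)
    then have "real (k\<^sub>\<xi> i) \<le> C2 * (C1\<^sup>2 * (P powr (2 * \<gamma>) * ln P))"
      using elim C2(1) by (fold P_def) (meson mult_left_mono order_trans less_imp_le)
    also have "\<dots> < P / 2" using elim(3) P by (fold P_def) (simp add: divide_less_eq)
    finally have 1: "real (k\<^sub>\<xi> i) < P / 2" .
    have "real (k\<^sub>u i) < P / 2"
      using elim(1,4) P by (fold P_def) (simp add: divide_less_eq)
    with 1 have "real (k\<^sub>\<xi> i + k\<^sub>u i) \<le> real (p i)" by (simp add: P_def)
    moreover have "real (k\<^sub>u i) < real (k\<^sub>\<xi> i)" using elim by (simp add: divide_less_eq)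
    ultimately show ?case using elim by simp
  qed
qed

context reduction
begin

text \<open>
  The denominator \<open>1 - (a \<rho>)\<^sup>2\<close> only helps. The hypothesis \<open>k\<^sub>u \<le> 8 s\<close> is how \<open>s = k\<^sub>u div 4\<close> enters:
  rounding costs at most a factor \<open>2\<close> once \<open>k\<^sub>u \<ge> 4\<close>. This is the origin of \<open>a b M2 / 8\<close>.
\<close>

lemma shift_lower_bound:
  assumes "0 < c" "c \<le> a * b * M2 / 8" "k\<^sub>u \<le> 8 * s" "\<tau> = c * \<rho>\<^sup>2 * real k\<^sub>u / sqrt (real q)"
  shows "\<tau> \<le> shift"
proof -
  have pos: "0 < 1 - (a * \<rho>)\<^sup>2" "1 - (a * \<rho>)\<^sup>2 \<le> 1" using damped_correlation(3)[of \<rho>] \<rho> by simp_all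
  have "c * real k\<^sub>u \<le> (a * b * M2 / 8) * (8 * real s)"
    using assms(1-3) by (intro mult_mono) auto
  then have "\<tau> \<le> a * b * w * \<rho>\<^sup>2 * s"
    using q \<rho> unfolding assms(4) w_def
    by (simp add: field_simps)
  also have "\<dots> \<le> shift"
    unfolding shift_def using pos a b w by (simp add: le_divide_eq mult_left_le)
  finally show ?thesis .
qed

lemma run_reduction:
  assumes c: "0 < c" and s: "s = k\<^sub>u div 4" and kp: "k\<^sub>u \<le> p" "0 < k\<^sub>u"
    and \<tau>: "\<tau> = c * \<rho>\<^sup>2 * real k\<^sub>u / sqrt (real q)"
    and run: "exec \<pi> (initial [n, k\<^sub>u, k, q, p]
      ([\<rho>, \<tau>] @ encode (LT_problem M1 M2 t0 n k\<^sub>u k q p \<tau>) (regress z)) \<omega>) t st"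
  shows "\<exists>t' st'. exec (Seq (convert_prog a b (M2 / c) t0) (Seq \<pi> negate_prog))
      (initial [n, k\<^sub>u, k, q, p] ([\<rho>, \<tau>] @ encode (SCCA_problem (2 * n) s q (p - q) \<rho>) z) \<omega>) t' st' \<and>
    t' \<le> 200 * (n * p) + t + 3 \<and> (ireg st' 0 \<noteq> 0 \<longleftrightarrow> ireg st 0 = 0)"
proof -
  define inp where "inp = [\<rho>, \<tau>] @ encode (SCCA_problem (2 * n) s q (p - q) \<rho>) z"
  define mi where "mi j = (if j < length [n, k\<^sub>u, k, q, p] then [n, k\<^sub>u, k, q, p] ! j else 0)" for j
  have enc: "encode (SCCA_problem (2 * n) s q (p - q) \<rho>) z = concat (map (\<lambda>i. map (z i) [0..<p]) [0..<2 * n])"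
    using q by (simp add: SCCA_problem_def)
  interpret conversion n q p a b w "t0 + shift" mi \<omega> inp z
  proof
    show "0 < q" "q \<le> p" by (rule q)+
    have "length (concat (map (\<lambda>i. map (z i) [0..<p]) [0..<m])) = m * p" for m
      by (induction m) auto
    then show "length inp = 2 + 2 * n * p" by (simp add: inp_def enc)
    fix i j assume ij: "i < 2 * n" "j < p"
    have "concat (map (\<lambda>i. map (z i) [0..<p]) [0..<2 * n]) ! (i * p + j) = map (\<lambda>i. map (z i) [0..<p]) [0..<2 * n] ! i ! j"
      using ij by (intro nth_concat_uniform) auto
    then show "inp ! (2 + i * p + j) = z i j"
      using ij by (simp add: inp_def enc)
  qed
  have rows: "encode (LT_problem M1 M2 t0 n k\<^sub>u k q p \<tau>) (regress z) = concat (map row [0..<n])"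
    unfolding LT_problem_def
    by (simp, intro arg_cong[where f = concat] map_cong refl) (simp add: row_def obs_def regress_def)
  have w': "w = M2 / c * \<tau> / (\<rho> * \<rho> * real k\<^sub>u)"
    using c \<rho> kp q unfolding \<tau> w_def by (simp add: power2_eq_square field_simps)
  have \<kappa>': "t0 + shift = t0 + a * b * w * (\<rho> * \<rho>) * real (k\<^sub>u div 4) / (1 - a * \<rho> * (a * \<rho>))"
    by (simp only: shift_def power2_eq_square s[symmetric])
  have "runs (convert_prog a b (M2 / c) t0)
      \<lparr>ireg = (\<lambda>_. 0), imem = mi, rreg = (\<lambda>_. 0), rmem = mem_of inp, tape = \<omega>\<rparr> (200 * (n * p))
      (\<lambda>s. s = \<lparr>ireg = (\<lambda>_. 0), imem = mi, rreg = (\<lambda>_. 0),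
        rmem = mem_of (take 2 inp @ concat (map row [0..<n])), tape = \<omega>\<rparr>)"
    by (rule convert_prog_runs[OF _ _ _ _ _ _ w' \<kappa>' kp(1)]) (use n in \<open>auto simp: mi_def inp_def\<close>)
  moreover have "initial [n, k\<^sub>u, k, q, p] inp \<omega> =
      \<lparr>ireg = (\<lambda>_. 0), imem = mi, rreg = (\<lambda>_. 0), rmem = mem_of inp, tape = \<omega>\<rparr>"
    by (simp add: initial_def mem_of_def mi_def fun_eq_iff)
  moreover have "initial [n, k\<^sub>u, k, q, p] ([\<rho>, \<tau>] @ concat (map row [0..<n])) \<omega> =
      \<lparr>ireg = (\<lambda>_. 0), imem = mi, rreg = (\<lambda>_. 0),
        rmem = mem_of (take 2 inp @ concat (map row [0..<n])), tape = \<omega>\<rparr>"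
    by (simp add: initial_def mem_of_def mi_def fun_eq_iff inp_def)
  ultimately show ?thesis
    using runs_then_negated[OF _ run, unfolded rows] unfolding inp_def[symmetric] rows by metis
qed

end

theorem theorem3:
  fixes M1 M2 t0 \<alpha> \<eta> \<gamma> :: real
  assumes "M1 > 1" and "M2 > 0"
    and "0 < \<alpha>" and "\<alpha> < 1" and "0 < \<eta>" and "\<eta> < 1"
    and "0 \<le> \<gamma>" and "\<gamma> < 1 / 2"
  shows "\<exists>c\<^sub>0>0. \<forall>c. 0 < c \<and> c \<le> c\<^sub>0 \<longrightarrow>
    (\<forall>(n :: nat \<Rightarrow> nat) (p :: nat \<Rightarrow> nat) (k\<^sub>u :: nat \<Rightarrow> nat) (k :: nat \<Rightarrow> nat)
       (k\<^sub>\<xi> :: nat \<Rightarrow> nat) (\<rho> :: nat \<Rightarrow> real) (\<tau> :: nat \<Rightarrow> real)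
       (ns :: nat \<Rightarrow> nat list) (xs :: nat \<Rightarrow> real list).
       filterlim n at_top sequentially \<longrightarrow>
       filterlim p at_top sequentially \<longrightarrow>
       filterlim k\<^sub>u at_top sequentially \<longrightarrow>
       filterlim k\<^sub>\<xi> at_top sequentially \<longrightarrow>
       (\<forall>\<^sub>F i in sequentially. k\<^sub>\<xi> i \<le> p i) \<longrightarrow>
       (\<lambda>i. real (k\<^sub>u i)) \<lesssim> (\<lambda>i. real (p i) powr \<gamma>) \<longrightarrow>
       (\<lambda>i. sqrt (real (n i)) / ln (real (p i))) \<lless> (\<lambda>i. real (k\<^sub>u i)) \<longrightarrow>
       (\<lambda>i. real (k\<^sub>u i)) \<lless> (\<lambda>i. real (k\<^sub>\<xi> i)) \<longrightarrow>
       (\<lambda>i. real (k\<^sub>\<xi> i)) \<lesssim> (\<lambda>i. real (n i) / ln (real (p i))) \<longrightarrow>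
       (\<forall>\<^sub>F i in sequentially. 1 \<le> k i \<and> k i \<le> k\<^sub>u i) \<longrightarrow>
       (\<forall>\<^sub>F i in sequentially. 0 < \<rho> i \<and> \<rho> i < 1 / 2) \<longrightarrow>
       (\<forall>i. \<tau> i = c * (\<rho> i)\<^sup>2 * real (k\<^sub>u i) / sqrt (real (k\<^sub>\<xi> i))) \<longrightarrow>
       (\<forall>i. ns i = [n i, k\<^sub>u i, k i, k\<^sub>\<xi> i, p i]) \<longrightarrow>
       (\<forall>i. xs i = [\<rho> i, \<tau> i]) \<longrightarrow>
       poly_time_solvable (ennreal (\<alpha> + \<eta>)) ns xs
         (\<lambda>i. LT_problem M1 M2 t0 (n i) (k\<^sub>u i) (k i) (k\<^sub>\<xi> i) (p i) (\<tau> i)) \<longrightarrow>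
       poly_time_solvable (ennreal (\<alpha> + \<eta>)) ns xs
         (\<lambda>i. SCCA_problem (2 * n i) (k\<^sub>u i div 4) (k\<^sub>\<xi> i) (p i - k\<^sub>\<xi> i) (\<rho> i)))"
proof -
  define a where "a = 1 - 1 / M1"
  define b where "b = sqrt (1 - a\<^sup>2)"
  have a: "0 < a" "a < 1" using assms(1) by (auto simp: a_def)
  then have "a\<^sup>2 < 1" by (simp add: abs_square_less_1)
  then have "0 < a * b * M2 / 8" using a assms(2) by (simp add: b_def)
  moreover have "poly_time_solvable (ennreal (\<alpha> + \<eta>)) ns xs
         (\<lambda>i. SCCA_problem (2 * n i) (k\<^sub>u i div 4) (k\<^sub>\<xi> i) (p i - k\<^sub>\<xi> i) (\<rho> i))"
    if c: "0 < c" "c \<le> a * b * M2 / 8"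
      and lim: "filterlim n at_top sequentially" "filterlim p at_top sequentially"
        "filterlim k\<^sub>u at_top sequentially" "filterlim k\<^sub>\<xi> at_top sequentially"
      and regime: "asymp_le (\<lambda>i. real (k\<^sub>u i)) (\<lambda>i. real (p i) powr \<gamma>)"
        "asymp_less (\<lambda>i. sqrt (real (n i)) / ln (real (p i))) (\<lambda>i. real (k\<^sub>u i))"
        "asymp_less (\<lambda>i. real (k\<^sub>u i)) (\<lambda>i. real (k\<^sub>\<xi> i))"
        "asymp_le (\<lambda>i. real (k\<^sub>\<xi> i)) (\<lambda>i. real (n i) / ln (real (p i)))"
      and k: "\<forall>\<^sub>F i in sequentially. 1 \<le> k i \<and> k i \<le> k\<^sub>u i"
      and \<rho>: "\<forall>\<^sub>F i in sequentially. 0 < \<rho> i \<and> \<rho> i < 1 / 2"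
      and \<tau>: "\<forall>i. \<tau> i = c * (\<rho> i)\<^sup>2 * real (k\<^sub>u i) / sqrt (real (k\<^sub>\<xi> i))"
      and ns: "\<forall>i. ns i = [n i, k\<^sub>u i, k i, k\<^sub>\<xi> i, p i]" and xs: "\<forall>i. xs i = [\<rho> i, \<tau> i]"
      and LT: "poly_time_solvable (ennreal (\<alpha> + \<eta>)) ns xs
         (\<lambda>i. LT_problem M1 M2 t0 (n i) (k\<^sub>u i) (k i) (k\<^sub>\<xi> i) (p i) (\<tau> i))"
    for c and n p k\<^sub>u k k\<^sub>\<xi> :: "nat \<Rightarrow> nat" and \<rho> \<tau> :: "nat \<Rightarrow> real" and ns xs
  proof -
    obtain \<pi> K d where solver: "\<forall>\<^sub>F i in sequentially. \<exists>\<phi>.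
        Measurable.pred (samples (LT_problem M1 M2 t0 (n i) (k\<^sub>u i) (k i) (k\<^sub>\<xi> i) (p i) (\<tau> i)) \<Otimes>\<^sub>M tape_law) \<phi> \<and>
        total_error (LT_problem M1 M2 t0 (n i) (k\<^sub>u i) (k i) (k\<^sub>\<xi> i) (p i) (\<tau> i)) \<phi> \<le> ennreal (\<alpha> + \<eta>) \<and>
        (\<forall>z\<in>space (samples (LT_problem M1 M2 t0 (n i) (k\<^sub>u i) (k i) (k\<^sub>\<xi> i) (p i) (\<tau> i))).
          \<forall>\<omega>\<in>space tape_law. \<exists>t s.
           exec \<pi> (initial (ns i) (xs i @ encode (LT_problem M1 M2 t0 (n i) (k\<^sub>u i) (k i) (k\<^sub>\<xi> i) (p i) (\<tau> i)) z) \<omega>) t s \<and>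
           t \<le> K * length (encode (LT_problem M1 M2 t0 (n i) (k\<^sub>u i) (k i) (k\<^sub>\<xi> i) (p i) (\<tau> i)) z) ^ d \<and>
           (\<phi> (z, \<omega>) \<longleftrightarrow> ireg s 0 \<noteq> 0))"
      using LT unfolding poly_time_solvable_def by blast
    show ?thesis
      unfolding poly_time_solvable_def
    \<comment> \<open>The exponent \<open>d + 1\<close> leaves room for the transformation, whose cost is linear in the input length, also when \<open>d = 0\<close>.\<close>
    proof (intro exI)
      show "\<forall>\<^sub>F i in sequentially. \<exists>\<phi>.
        Measurable.pred (samples (SCCA_problem (2 * n i) (k\<^sub>u i div 4) (k\<^sub>\<xi> i) (p i - k\<^sub>\<xi> i) (\<rho> i)) \<Otimes>\<^sub>M tape_law) \<phi> \<and>
        total_error (SCCA_problem (2 * n i) (k\<^sub>u i div 4) (k\<^sub>\<xi> i) (p i - k\<^sub>\<xi> i) (\<rho> i)) \<phi> \<le> ennreal (\<alpha> + \<eta>) \<and>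
        (\<forall>z\<in>space (samples (SCCA_problem (2 * n i) (k\<^sub>u i div 4) (k\<^sub>\<xi> i) (p i - k\<^sub>\<xi> i) (\<rho> i))).
          \<forall>\<omega>\<in>space tape_law. \<exists>t s.
           exec (Seq (convert_prog a b (M2 / c) t0) (Seq \<pi> negate_prog))
             (initial (ns i) (xs i @ encode (SCCA_problem (2 * n i) (k\<^sub>u i div 4) (k\<^sub>\<xi> i) (p i - k\<^sub>\<xi> i) (\<rho> i)) z) \<omega>) t s \<and>
           t \<le> (K + 203) * length (encode (SCCA_problem (2 * n i) (k\<^sub>u i div 4) (k\<^sub>\<xi> i) (p i - k\<^sub>\<xi> i) (\<rho> i)) z) ^ (d + 1) \<and>
           (\<phi> (z, \<omega>) \<longleftrightarrow> ireg s 0 \<noteq> 0))"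
        using solver k \<rho> eventually_sparse_regime[OF assms(8) lim(1,2,3) regime lim(4)]
      proof eventually_elim
        case (elim i)
        let ?n = "n i" and ?p = "p i" and ?q = "k\<^sub>\<xi> i" and ?s = "k\<^sub>u i div 4"
        let ?L = "LT_problem M1 M2 t0 ?n (k\<^sub>u i) (k i) ?q ?p (\<tau> i)"
        let ?S = "SCCA_problem (2 * ?n) ?s ?q (?p - ?q) (\<rho> i)"
        interpret R: reduction M1 M2 t0 "\<rho> i" ?n "k\<^sub>u i" "k i" ?q ?p ?s
          using elim assms(1,2) by unfold_locales linarith+
        have ab: "R.a = a" "R.b = b" by (simp_all add: R.a_def a_def R.b_def b_def)
        have \<tau>i: "\<tau> i = c * (\<rho> i)\<^sup>2 * real (k\<^sub>u i) / sqrt (real ?q)" using \<tau> by simp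
        have "4 \<le> k\<^sub>u i" using elim by simp
        then have "k\<^sub>u i \<le> 8 * ?s" by presburger
        then have shift: "\<tau> i \<le> R.shift"
          using c by (intro R.shift_lower_bound[OF c(1) _ _ \<tau>i]) (simp_all add: ab)
        obtain \<phi> where \<phi>: "Measurable.pred (samples ?L \<Otimes>\<^sub>M tape_law) \<phi>"
            "total_error ?L \<phi> \<le> ennreal (\<alpha> + \<eta>)"
          and run: "\<And>z \<omega>. z \<in> space (samples ?L) \<Longrightarrow> \<omega> \<in> space tape_law \<Longrightarrow> \<exists>t s.
             exec \<pi> (initial (ns i) (xs i @ encode ?L z) \<omega>) t s \<and> t \<le> K * length (encode ?L z) ^ d \<and>
             (\<phi> (z, \<omega>) \<longleftrightarrow> ireg s 0 \<noteq> 0)"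
          using elim(1) by blast
        have spaces: "samples ?L = R.lt_space" "samples ?S = R.scca_space"
          using R.q by (simp_all add: LT_problem_def SCCA_problem_def)
        note transfer = R.total_error_reduction[OF \<phi>(1)[unfolded spaces] shift]
        show ?case
        proof (rule exI[of _ "\<lambda>(z, \<omega>). \<not> \<phi> (R.regress z, \<omega>)"], intro conjI ballI)
          show "Measurable.pred (samples ?S \<Otimes>\<^sub>M tape_law) (\<lambda>(z, \<omega>). \<not> \<phi> (R.regress z, \<omega>))"
            using transfer(1) by (simp only: spaces)
          show "total_error ?S (\<lambda>(z, \<omega>). \<not> \<phi> (R.regress z, \<omega>)) \<le> ennreal (\<alpha> + \<eta>)"
            using transfer(2) \<phi>(2) by (rule order_trans)
          fix z \<omega> assume z: "z \<in> space (samples ?S)" and \<omega>: "\<omega> \<in> space tape_law"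
          have "R.regress z \<in> space (samples ?L)"
            using measurable_space[OF R.measurable_regress] z by (simp only: spaces)
          from run[OF this \<omega>] obtain t st where
            t: "exec \<pi> (initial [?n, k\<^sub>u i, k i, ?q, ?p] ([\<rho> i, \<tau> i] @ encode ?L (R.regress z)) \<omega>) t st"
              "t \<le> K * length (encode ?L (R.regress z)) ^ d" "\<phi> (R.regress z, \<omega>) \<longleftrightarrow> ireg st 0 \<noteq> 0"
            using ns xs by auto
          obtain t' st' where t': "exec (Seq (convert_prog a b (M2 / c) t0) (Seq \<pi> negate_prog))
              (initial (ns i) (xs i @ encode ?S z) \<omega>) t' st'" "t' \<le> 200 * (?n * ?p) + t + 3"
              "ireg st' 0 \<noteq> 0 \<longleftrightarrow> ireg st 0 = 0"
            using R.run_reduction[OF c(1) refl _ _ \<tau>i t(1)] elim ns xs unfolding ab by auto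
          let ?X = "2 * ?n * ?p"
          have len: "length (encode ?S z) = ?X"
          proof -
            have "length (concat (map (\<lambda>i. map (z i) [0..<?p]) [0..<m])) = m * ?p" for m
              by (induction m) auto
            then show ?thesis using R.q by (simp add: SCCA_problem_def)
          qed
          have X: "1 \<le> ?n * ?p" using R.q R.n by (simp add: Suc_le_eq)
          have len': "length (encode ?L z') \<le> ?X" for z'
          proof -
            have "length (concat (map (\<lambda>i. fst (z' i) # map (snd (z' i)) [0..<?p]) [0..<m])) = m * (?p + 1)" for m
              by (induction m) auto
            moreover have "?n * (?p + 1) \<le> ?n * (2 * ?p)" using R.q by (intro mult_left_mono) auto
            ultimately show ?thesis by (simp add: LT_problem_def mult.assoc mult.left_commute)
          qed
          have X1: "1 \<le> ?X" using X by simp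
          have "t \<le> K * ?X ^ (d + 1)"
            using t(2) power_mono[OF len', of "R.regress z" d] power_increasing[OF _ X1, of d "d + 1"]
            by (meson le_add1 le_trans mult_le_mono2 zero_le)
          moreover have "200 * (?n * ?p) + 3 \<le> 203 * ?X ^ (d + 1)"
          proof -
            have "?X = 2 * (?n * ?p)" by simp
            then have "200 * (?n * ?p) + 3 \<le> 203 * ?X" using X by linarith
            also have "\<dots> \<le> 203 * ?X ^ (d + 1)" using power_increasing[OF _ X1, of 1 "d + 1"] by simp
            finally show ?thesis .
          qed
          ultimately have time: "t' \<le> (K + 203) * length (encode ?S z) ^ (d + 1)"
            using t'(2) unfolding len add_mult_distrib by linarith
          show "\<exists>t s. exec (Seq (convert_prog a b (M2 / c) t0) (Seq \<pi> negate_prog))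
             (initial (ns i) (xs i @ encode ?S z) \<omega>) t s \<and>
             t \<le> (K + 203) * length (encode ?S z) ^ (d + 1) \<and>
             ((case (z, \<omega>) of (z, \<omega>) \<Rightarrow> \<not> \<phi> (R.regress z, \<omega>)) \<longleftrightarrow> ireg s 0 \<noteq> 0)"
            by (intro exI[of _ t'] exI[of _ st'] conjI t'(1) time) (use t'(3) t(3) in auto)
        qed
      qed
    qed
  qed
  ultimately show ?thesis
    by (intro exI[of _ "a * b * M2 / 8"] conjI allI impI) blast+
qed

end
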